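(* Let $n\ge2$. The Hardy space $H^2(\triangle_n)$ is isometrically isomorphic to $H^2(\partial_d(\triangle_n))$.
   Context: Let $n\ge2$, $\mathbb T$ the unit circle, and $\triangle_n=\{z\in\mathbb C^n:|z_1|<|z_2|<\dots<|z_n|<1\}$ the $n$-dimensional Hartogs triangle. Its distinguished boundary is $\partial_d(\triangle_n)=\mathbb T^n$, equipped with normalized Lebesgue measure. The Hardy space $H^2(\triangle_n)$ is the Hilbert space of holomorphic functions $f$ on $\triangle_n$ with $$\|f\|^2=\sup_{r_1,\dots,r_n\in(0,1)}\int_{[0,2\pi]^n}\Big|f\Big(\prod_{j=1}^n r_je^{i\theta_1},\prod_{j=2}^n r_je^{i\theta_2},\dots,r_ne^{i\theta_n}\Big)\Big|^2\prod_{j=1}^n r_j^{2j-1}\,\frac{d\theta}{(2\pi)^n}<\infty.$$ Let $\mathcal I=\{\alpha\in\mathbb Z^n:\sum_{j=1}^k\alpha_j+k-1\ge0,\ k=1,\dots,n\}$. Each $f\in H^2(\triangle_n)$ has a Laurent series representation $f(z)=\sum_{\alpha\in\mathcal I}a_\alpha z^\alpha$. $H^2(\partial_d(\triangle_n))$ is the closed subspace of $L^2(\partial_d(\triangle_n))=L^2(\mathbb T^n)$ given by $$H^2(\partial_d(\triangle_n))=\Big\{f(\zeta)=\sum_{\alpha\in\mathcal I}a_\alpha\zeta^\alpha:\ \|\{a_\alpha\}\|_{\ell^2}<\infty\Big\}.$$ The identification of the two spaces associates to $f(z)=\sum_{\alpha\in\mathcal I}a_\alpha z^\alpha$ in $H^2(\triangle_n)$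 its boundary function $\tilde f(\zeta)=\sum_{\alpha\in\mathcal I}a_\alpha\zeta^\alpha$, $\zeta\in\mathbb T^n$. *)

theory Defs
  imports "HOL-Analysis.Analysis"
begin

section \<open>Normed spaces on carrier sets and isometric isomorphisms\<close>

record 'v cnormed_space =
  vecs :: "'v set"
  vadd :: "'v \<Rightarrow> 'v \<Rightarrow> 'v"
  vscale :: "complex \<Rightarrow> 'v \<Rightarrow> 'v"
  vnorm :: "'v \<Rightarrow> real"

definition isometric_isomorphism ::
  "'v cnormed_space \<Rightarrow> 'w cnormed_space \<Rightarrow> ('v \<Rightarrow> 'w) \<Rightarrow> bool" where
  "isometric_isomorphism V W T \<longleftrightarrow>
     bij_betw T (vecs V) (vecs W) \<and>
     (\<forall>x\<in>vecs V. \<forall>y\<in>vecs V. T (vadd V x y) = vadd W (T x) (T y)) \<and>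
     (\<forall>c. \<forall>x\<in>vecs V. T (vscale V c x) = vscale W c (T x)) \<and>
     (\<forall>x\<in>vecs V. vnorm W (T x) = vnorm V x)"


section \<open>The Hartogs triangle and its Hardy space\<close>

text \<open>
  The coordinates \<open>1, \<dots>, n\<close> are the elements of a finite linearly ordered type \<open>'n\<close>
  with \<open>n = CARD('n)\<close>; \<open>pos j\<close> is the number, counted from 1, of the coordinate \<open>j\<close>.
\<close>

definition pos :: "'n::{finite,linorder} \<Rightarrow> nat" where
  "pos j = card {i. i \<le> j}"

definition hartogs_triangle :: "(complex ^ 'n::{finite,linorder}) set" where
  "hartogs_triangle =
     {z. (\<forall>i j. i < j \<longrightarrow> cmod (z $ i) < cmod (z $ j)) \<and> (\<forall>j. cmod (z $ j) < 1)}"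

definition holomorphic_multi :: "(complex ^ 'n \<Rightarrow> complex) \<Rightarrow> (complex ^ 'n) set \<Rightarrow> bool" where
  "holomorphic_multi f S \<longleftrightarrow>
     (\<forall>z\<in>S. \<exists>f'. (f has_derivative f') (at z) \<and> (\<forall>c v. f' (c *s v) = c * f' v))"

definition polar_point ::
  "real ^ 'n::{finite,linorder} \<Rightarrow> real ^ 'n::{finite,linorder} \<Rightarrow> complex ^ 'n::{finite,linorder}" where
  "polar_point r \<theta> = (\<chi> k. complex_of_real (\<Prod>j | k \<le> j. r $ j) * cis (\<theta> $ k))"

definition hardy_mean ::
  "(complex ^ 'n::{finite,linorder} \<Rightarrow> complex) \<Rightarrow> real ^ 'n::{finite,linorder} \<Rightarrow> ennreal" where
  "hardy_mean f r =
     (\<integral>\<^sup>+\<theta>\<in>cbox 0 (\<chi> j. 2 * pi).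
        ennreal ((cmod (f (polar_point r \<theta>)))\<^sup>2 * (\<Prod>j\<in>UNIV. (r $ j) ^ (2 * pos j - 1))
                 / (2 * pi) ^ CARD('n)) \<partial>lborel)"

definition hardy_norm_sq ::
  "(complex ^ 'n::{finite,linorder} \<Rightarrow> complex) \<Rightarrow> ennreal" where
  "hardy_norm_sq f = (SUP r\<in>{r. \<forall>j. 0 < r $ j \<and> r $ j < 1}. hardy_mean f r)"

text \<open>
  A function on the triangle is represented by its extension by zero, so that equality
  of elements of the space is equality of functions on the triangle.
\<close>

definition hardy_space ::
  "(complex ^ 'n::{finite,linorder} \<Rightarrow> complex) cnormed_space" where
  "hardy_space =
     \<lparr> vecs = {f. holomorphic_multi f hartogs_triangle \<and> hardy_norm_sq f < \<infinity> \<and>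
                 (\<forall>z. z \<notin> hartogs_triangle \<longrightarrow> f z = 0)},
       vadd = (\<lambda>f g z. f z + g z),
       vscale = (\<lambda>c f z. c * f z),
       vnorm = (\<lambda>f. sqrt (enn2real (hardy_norm_sq f))) \<rparr>"


section \<open>The space \<open>L\<^sup>2\<close> of the distinguished boundary\<close>

definition torus :: "(complex ^ 'n) set" where
  "torus = {\<zeta>. \<forall>j. cmod (\<zeta> $ j) = 1}"

definition torus_measure :: "(complex ^ 'n) measure" where
  "torus_measure =
     distr (uniform_measure lborel (cbox (0 :: real ^ 'n) (\<chi> j. 2 * pi)))
       (restrict_space borel torus) (\<lambda>\<theta>. \<chi> j. cis (\<theta> $ j))"

definition square_integrable :: "(complex ^ 'n \<Rightarrow> complex) \<Rightarrow> bool" where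
  "square_integrable u \<longleftrightarrow>
     u \<in> borel_measurable torus_measure \<and> integrable torus_measure (\<lambda>\<zeta>. (cmod (u \<zeta>))\<^sup>2)"

definition L2_seminorm :: "(complex ^ 'n \<Rightarrow> complex) \<Rightarrow> real" where
  "L2_seminorm u = sqrt (LINT \<zeta>|torus_measure. (cmod (u \<zeta>))\<^sup>2)"

definition ae_class :: "(complex ^ 'n \<Rightarrow> complex) \<Rightarrow> (complex ^ 'n \<Rightarrow> complex) set" where
  "ae_class u =
     {v \<in> borel_measurable torus_measure. AE \<zeta> in torus_measure. v \<zeta> = u \<zeta>}"

text \<open>
  Each union below is a union of identical sets: the result does not depend on the
  representatives.
\<close>

definition L2_torus :: "(complex ^ 'n \<Rightarrow> complex) set cnormed_space" where
  "L2_torus =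
     \<lparr> vecs = ae_class ` {u. square_integrable u},
       vadd = (\<lambda>X Y. \<Union>u\<in>X. \<Union>v\<in>Y. ae_class (\<lambda>\<zeta>. u \<zeta> + v \<zeta>)),
       vscale = (\<lambda>c X. \<Union>u\<in>X. ae_class (\<lambda>\<zeta>. c * u \<zeta>)),
       vnorm = (\<lambda>X. L2_seminorm (SOME u. u \<in> X)) \<rparr>"


section \<open>The Hardy space of the distinguished boundary\<close>

definition hardy_index :: "(int ^ 'n::{finite,linorder}) set" where
  "hardy_index = {\<alpha>. \<forall>k. (\<Sum>j | j \<le> k. \<alpha> $ j) + int (pos k) - 1 \<ge> 0}"

definition monomial :: "int ^ 'n \<Rightarrow> complex ^ 'n \<Rightarrow> complex" where
  "monomial \<alpha> z = (\<Prod>j\<in>UNIV. (z $ j) powi (\<alpha> $ j))"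

text \<open>
  \<open>boundary_series a u\<close>: the sequence \<open>a\<close> is in \<open>\<ell>\<^sup>2\<close> and \<open>u\<close> is the sum of
  \<open>\<Sum>\<^sub>\<alpha> a\<^sub>\<alpha> \<zeta>\<^sup>\<alpha>\<close>, the series converging unconditionally in the norm of \<open>L\<^sup>2\<close>.
\<close>

definition boundary_series ::
  "(int ^ 'n::{finite,linorder} \<Rightarrow> complex)
   \<Rightarrow> (complex ^ 'n::{finite,linorder} \<Rightarrow> complex) \<Rightarrow> bool" where
  "boundary_series a u \<longleftrightarrow>
     (\<lambda>\<alpha>. (cmod (a \<alpha>))\<^sup>2) summable_on hardy_index \<and>
     square_integrable u \<and>
     ((\<lambda>F. L2_seminorm (\<lambda>\<zeta>. u \<zeta> - (\<Sum>\<alpha>\<in>F. a \<alpha> * monomial \<alpha> \<zeta>))) \<longlongrightarrow> 0)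
       (finite_subsets_at_top hardy_index)"

definition boundary_hardy_space ::
  "(complex ^ 'n::{finite,linorder} \<Rightarrow> complex) set cnormed_space" where
  "boundary_hardy_space = L2_torus \<lparr> vecs := {ae_class u | u. \<exists>a. boundary_series a u} \<rparr>"

definition laurent_series ::
  "(int ^ 'n::{finite,linorder} \<Rightarrow> complex)
   \<Rightarrow> (complex ^ 'n::{finite,linorder} \<Rightarrow> complex) \<Rightarrow> bool" where
  "laurent_series a f \<longleftrightarrow>
     (\<forall>z\<in>hartogs_triangle. ((\<lambda>\<alpha>. a \<alpha> * monomial \<alpha> z) has_sum f z) hardy_index)"

definition boundary_function ::
  "(complex ^ 'n::{finite,linorder} \<Rightarrow> complex)
   \<Rightarrow> (complex ^ 'n::{finite,linorder} \<Rightarrow> complex) set \<Rightarrow> bool" where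
  "boundary_function f X \<longleftrightarrow>
     (\<exists>a u. laurent_series a f \<and> boundary_series a u \<and> X = ae_class u)"

end

theory Submission
  imports Defs "HOL-Complex_Analysis.Cauchy_Integral_Formula"
begin

text \<open>Put \<open>w\<^sub>j = z\<^sub>j / z\<^bsub>j+1\<^esub>\<close> for \<open>j < n\<close> and \<open>w\<^sub>n = z\<^sub>n\<close>. These coordinates turn the Hartogs triangle into a
polydisc (punctured in every variable except \<open>w\<^sub>1\<close>), with inverse \<open>z\<^sub>k = \<Prod>\<^bsub>j\<ge>k\<^esub> w\<^sub>j\<close>, and they
turn \<open>z\<^sup>\<alpha>\<close> into \<open>\<Prod>\<^sub>j w\<^sub>j\<^sup>s\<close> with \<open>s = \<alpha>\<^sub>1 + \<dots> + \<alpha>\<^sub>j\<close>. The factor \<open>\<Prod>\<^sub>j r\<^sub>j\<^bsup>2j-1\<^esup>\<close> in the norm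
shifts the exponents: \<open>|z\<^sup>\<alpha>|\<^sup>2\<close> times this factor is \<open>\<Prod>\<^sub>j r\<^sub>j\<^bsup>2 d\<^sub>j + 1\<^esup>\<close> with \<open>d\<^sub>j = s + j - 1\<close>.
The index set \<open>\<I>\<close> consists of the \<open>\<alpha>\<close> for which all \<open>d\<^sub>j\<close> are non-negative, that is, of those
for which the weighted monomial stays bounded as the radii vary.

Both spaces are therefore models of \<open>\<ell>\<^sup>2(\<I>)\<close>, and the isomorphism is composed of two isometries.

\<^item> A square summable family on \<open>\<I>\<close> defines a Laurent series that converges locally uniformly on the
  triangle, hence a holomorphic function (\<open>holomorphic_multi_hardy_series\<close>). By Parseval its
  weighted mean over the torus of radii \<open>r\<close> is \<open>\<Sum>\<^sub>\<alpha> |a\<^sub>\<alpha>|\<^sup>2 \<Prod>\<^sub>j r\<^sub>j\<^bsup>2 d\<^sub>j + 1\<^esup>\<close>; the supremum over \<open>r\<close> is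
  the limit as all radii tend to 1, which is \<open>\<Sum>\<^sub>\<alpha> |a\<^sub>\<alpha>|\<^sup>2\<close> (\<open>hardy_norm_sq_laurent_series\<close>).

\<^item> Conversely, every \<open>f\<close> in the Hardy space arises in this way (\<open>laurent_expansion\<close>). Its
  coefficients are torus averages, independent of the radii (\<open>laurent_coeff_const\<close>). Bessel's
  inequality bounds them by the norm; letting one radius tend to 0 kills the coefficients outside
  \<open>\<I>\<close>, and letting all radii tend to 1 gives square summability. On each torus \<open>f\<close> and its series
  are continuous with the same Fourier coefficients, so they agree.

\<^item> On the torus the characters \<open>\<zeta>\<^sup>\<alpha>\<close> are orthonormal, so the map from families to classes of
  functions is an isometry; it is defined everywhere by the Riesz--Fischer theorem
  (\<open>exists_boundary_series\<close>).

The Fourier analysis on the torus rests on the Stone--Weierstrass theorem: trigonometric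
polynomials are uniformly dense in the continuous functions (\<open>trig_poly_dense\<close>). Uniqueness of
Fourier coefficients and invariance of the measure under rotations follow by checking them on
characters.\<close>

section \<open>Integration over the torus\<close>

definition torus_point :: "real ^ 'n \<Rightarrow> complex ^ 'n" where
  "torus_point \<theta> = (\<chi> j. cis (\<theta> $ j))"

lemma torus_point_in_torus: "torus_point \<theta> \<in> torus"
  by (simp add: torus_point_def torus_def)

lemma continuous_on_torus_point: "continuous_on S torus_point"
  unfolding torus_point_def by (intro continuous_intros)

lemma torus_pointE:
  assumes "\<zeta> \<in> torus"
  obtains \<theta> where "\<theta> \<in> cbox 0 (\<chi> j. 2 * pi)" "\<zeta> = torus_point \<theta>"
proof
  show "(\<chi> j. Arg2pi (\<zeta> $ j)) \<in> cbox 0 (\<chi> j. 2 * pi)"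
    by (simp add: mem_box_cart Arg2pi less_imp_le)
  show "\<zeta> = torus_point (\<chi> j. Arg2pi (\<zeta> $ j))"
    using assms Arg2pi_eq unfolding torus_point_def torus_def vec_eq_iff cis_conv_exp
    by (metis (mono_tags, lifting) mem_Collect_eq mult_1 of_real_1 vec_lambda_beta)
qed

lemma torus_nonzero: "\<zeta> \<in> torus \<Longrightarrow> \<zeta> $ j \<noteq> 0"
  by (auto simp: torus_def dest: spec[of _ j])

lemma compact_torus: "compact (torus :: (complex ^ 'n) set)"
proof -
  have "torus = (torus_point :: real ^ 'n \<Rightarrow> _) ` cbox 0 (\<chi> j. 2 * pi)"
    using torus_pointE torus_point_in_torus by blast
  then show ?thesis
    by (metis compact_cbox compact_continuous_image continuous_on_torus_point)
qed

lemma measurable_torus_point: "torus_point \<in> borel \<rightarrow>\<^sub>M restrict_space borel torus"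
  by (intro measurable_restrict_space2 borel_measurable_continuous_onI continuous_on_torus_point)
    (auto simp: torus_point_in_torus)

lemma emeasure_angle_box:
  "emeasure lborel (cbox 0 (\<chi> j. 2 * pi) :: (real ^ 'n) set) = ennreal ((2 * pi) ^ CARD('n))"
proof -
  have "emeasure lborel (cbox 0 (\<chi> j. 2 * pi) :: (real ^ 'n) set) =
      ennreal (measure lborel (cbox 0 (\<chi> j. 2 * pi) :: (real ^ 'n) set))"
    using emeasure_lborel_cbox_finite[of "0 :: real ^ 'n" "\<chi> j. 2 * pi"]
    by (intro emeasure_eq_ennreal_measure) auto
  also have "measure lborel (cbox 0 (\<chi> j. 2 * pi) :: (real ^ 'n) set) = (2 * pi) ^ CARD('n)"
    by (subst content_cbox_cart) (auto simp: interval_ne_empty_cart)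
  finally show ?thesis .
qed

abbreviation angle_measure :: "(real ^ 'n) measure" where
  "angle_measure \<equiv> uniform_measure lborel (cbox 0 (\<chi> j. 2 * pi))"

lemma torus_measure_eq:
  "torus_measure = distr angle_measure (restrict_space borel torus) torus_point"
  by (simp add: torus_measure_def torus_point_def[abs_def])

lemma space_torus_measure [simp]: "space torus_measure = torus"
  by (simp add: torus_measure_eq space_restrict_space)

lemma sets_torus_measure: "sets torus_measure = sets (restrict_space borel torus)"
  by (simp add: torus_measure_eq)

lemma measurable_torus_point': "torus_point \<in> angle_measure \<rightarrow>\<^sub>M restrict_space borel torus"
  using measurable_torus_point by (simp cong: measurable_cong_sets)

lemma emeasure_torus: "emeasure (torus_measure :: (complex ^ 'n) measure) torus = 1"
proof -
  have "emeasure (torus_measure :: (complex ^ 'n) measure) (space torus_measure) =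
      emeasure angle_measure (space angle_measure :: (real ^ 'n) set)"
    unfolding torus_measure_eq
    by (subst emeasure_distr[OF measurable_torus_point'])
       (auto intro!: arg_cong2[where f = emeasure] simp: torus_point_in_torus space_restrict_space
         simp del: emeasure_uniform_measure intro: sets.top[of "restrict_space borel torus", simplified])
  also have "\<dots> = 1"
    by (auto simp: emeasure_angle_box ennreal_divide_times divide_ennreal)
  finally show ?thesis by simp
qed

interpretation torus: finite_measure torus_measure
  by standard (simp add: emeasure_torus)

lemma measure_torus: "measure torus_measure torus = 1"
  by (simp add: measure_def emeasure_torus)

lemma measurable_torusI: "continuous_on torus \<phi> \<Longrightarrow> \<phi> \<in> borel_measurable torus_measure"
  for \<phi> :: "_ \<Rightarrow> _ :: topological_space"
  by (subst measurable_cong_sets[OF sets_torus_measure refl])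
    (rule borel_measurable_continuous_on_restrict)

lemma integrable_torusI:
  fixes \<phi> :: "complex ^ 'n \<Rightarrow> 'b :: {banach, second_countable_topology}"
  assumes "continuous_on torus \<phi>"
  shows "integrable torus_measure \<phi>"
proof -
  obtain B where "\<forall>x\<in>torus. norm (\<phi> x) \<le> B"
    using compact_imp_bounded[OF compact_continuous_image[OF assms compact_torus]]
    by (auto simp: bounded_iff)
  then show ?thesis
    by (intro torus.integrable_const_bound[where B = B] AE_I2 measurable_torusI assms) auto
qed

lemma nn_integral_torus:
  fixes \<phi> :: "complex ^ 'n \<Rightarrow> ennreal"
  assumes "\<phi> \<in> borel_measurable torus_measure"
  shows "(\<integral>\<^sup>+\<zeta>. \<phi> \<zeta> \<partial>torus_measure) =
     (\<integral>\<^sup>+\<theta>\<in>cbox 0 (\<chi> j. 2 * pi). \<phi> (torus_point \<theta>) \<partial>lborel) / ennreal ((2 * pi) ^ CARD('n))"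
proof -
  have \<phi>: "\<phi> \<in> borel_measurable (restrict_space borel torus)"
    using assms measurable_cong_sets[OF sets_torus_measure refl] by blast
  have "(\<integral>\<^sup>+\<zeta>. \<phi> \<zeta> \<partial>torus_measure) = (\<integral>\<^sup>+\<theta>. \<phi> (torus_point \<theta>) \<partial>angle_measure)"
    unfolding torus_measure_eq
    by (subst nn_integral_distr) (use \<phi> measurable_torus_point' in auto)
  also have "\<dots> = (\<integral>\<^sup>+\<theta>\<in>cbox 0 (\<chi> j. 2 * pi). \<phi> (torus_point \<theta>) \<partial>lborel) / ennreal ((2 * pi) ^ CARD('n))"
    by (subst nn_integral_uniform_measure)
      (use measurable_compose[OF measurable_torus_point \<phi>] in \<open>auto simp: emeasure_angle_box\<close>)
  finally show ?thesis .
qed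

text \<open>Averages over the torus are integrals over the box of angles. Bochner integrals over the box are
convenient for product formulas; a version with gauge integrals, which allow exchanging the order of
integration for continuous functions, is given in \<open>integral_torus_box\<close>.\<close>
lemma integral_torus:
  fixes \<phi> :: "complex ^ 'n \<Rightarrow> 'b :: {banach, second_countable_topology}"
  assumes "continuous_on torus \<phi>"
  shows "(LINT \<zeta>|torus_measure. \<phi> \<zeta>) =
     (LINT \<theta>:cbox 0 (\<chi> j. 2 * pi)|lborel. \<phi> (torus_point \<theta>)) /\<^sub>R (2 * pi) ^ CARD('n)"
proof -
  let ?B = "cbox 0 (\<chi> j. 2 * pi) :: (real ^ 'n) set" and ?c = "(2 * pi) ^ CARD('n)"
  have \<phi>: "\<phi> \<in> borel_measurable (restrict_space borel torus)"
    by (rule borel_measurable_continuous_on_restrict[OF assms])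
  have "(LINT \<zeta>|torus_measure. \<phi> \<zeta>) = (LINT \<theta>|angle_measure. \<phi> (torus_point \<theta>))"
    unfolding torus_measure_eq
    by (subst integral_distr) (use \<phi> measurable_torus_point' in auto)
  also have "\<dots> = (LINT \<theta>|lborel. (indicator ?B \<theta> / ?c) *\<^sub>R \<phi> (torus_point \<theta>))"
  proof -
    have "angle_measure = density lborel (\<lambda>\<theta>. ennreal (indicator ?B \<theta> / ?c))"
      unfolding uniform_measure_def
      by (intro density_cong) (auto simp: emeasure_angle_box divide_ennreal indicator_def simp flip: ennreal_1)
    then show ?thesis
      using measurable_compose[OF measurable_torus_point \<phi>]
      by (simp only:) (subst integral_density, auto)
  qed
  also have "\<dots> = (LINT \<theta>:?B|lborel. \<phi> (torus_point \<theta>)) /\<^sub>R ?c"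
    unfolding set_lebesgue_integral_def
    by (subst integral_scaleR_right[symmetric])
      (auto intro!: Bochner_Integration.integral_cong simp: indicator_def divide_inverse)
  finally show ?thesis .
qed

text \<open>Lebesgue measure on a finite power of the line is the product measure, so integrals of products of
functions of one coordinate each factor. This is the only place where the measure on \<open>\<real>\<^sup>n\<close> is taken
apart.\<close>
lemma lborel_integral_prod_cart:
  fixes f :: "'n::finite \<Rightarrow> real \<Rightarrow> complex"
  assumes "\<And>i. integrable lborel (f i)"
  shows "(LINT x|lborel. (\<Prod>i\<in>UNIV. f i (x $ i))) = (\<Prod>i\<in>UNIV. LINT t|lborel. f i t)"
proof -
  have [measurable]: "f i \<in> borel_measurable borel" for i
    using assms[of i] by auto
  interpret product_sigma_finite "\<lambda>_ :: real ^ 'n. lborel :: real measure"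
    by (simp add: product_sigma_finite_def sigma_finite_lborel)
  have prod_Basis: "(\<Prod>b\<in>Basis. h b) = (\<Prod>i\<in>UNIV. h (axis i 1))" for h :: "real ^ 'n \<Rightarrow> complex"
    by (simp add: Basis_vec_def UNION_singleton_eq_range prod.reindex axis_eq_axis inj_on_def)
  have "(LINT x|lborel. (\<Prod>i\<in>UNIV. f i (x $ i))) =
     (LINT g|(\<Pi>\<^sub>M b\<in>Basis. lborel). (\<Prod>i\<in>UNIV. f i ((\<Sum>b\<in>Basis. g b *\<^sub>R b) $ i)))"
    by (subst lborel_eq, subst integral_distr) measurable
  also have "\<dots> = (LINT g|(\<Pi>\<^sub>M b\<in>(Basis :: (real ^ 'n) set). lborel). (\<Prod>b\<in>Basis. f (axis_index b) (g b)))"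
    by (simp add: prod_Basis cart_eq_inner_axis inner_sum_left inner_Basis if_distrib cong: if_cong)
  also have "\<dots> = (\<Prod>b\<in>(Basis :: (real ^ 'n) set). LINT t|lborel. f (axis_index b) t)"
    by (rule product_integral_prod) (use assms in auto)
  finally show ?thesis
    by (simp add: prod_Basis)
qed

lemma integral_cis_period:
  "(LINT t:{0..2 * pi}|lborel. cis (of_int m * t)) = (if m = 0 then 2 * pi else 0)"
proof (cases "m = 0")
  case True
  then show ?thesis by (simp add: set_lebesgue_integral_def scaleR_conv_of_real)
next
  case False
  let ?F = "\<lambda>t. cis (of_int m * t) / (\<i> * of_int m)"
  have deriv: "(?F has_vector_derivative cis (of_int m * t)) (at t within {0..2 * pi})" for t
  proof -
    have "((\<lambda>z. exp (\<i> * (of_int m * z)) / (\<i> * of_int m)) has_field_derivative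
        exp (\<i> * (of_int m * of_real t))) (at (of_real t))"
      using False by (auto intro!: derivative_eq_intros simp: field_simps)
    from has_vector_derivative_real_field[OF this] show ?thesis
      by (simp add: cis_conv_exp has_vector_derivative_at_within)
  qed
  have "(LINT t:{0..2 * pi}|lborel. cis (of_int m * t)) = ?F (2 * pi) - ?F 0"
    unfolding set_lebesgue_integral_def
    by (intro integral_FTC_Icc deriv) (auto intro!: continuous_intros)
  then show ?thesis
    using False cis_multiple_2pi[of "of_int m"] by (simp add: mult.commute)
qed

section \<open>Characters and density of trigonometric polynomials\<close>

lemma monomial_0 [simp]: "monomial 0 z = 1"
  by (simp add: monomial_def)

lemma monomial_mult: "monomial \<alpha> (w * z) = monomial \<alpha> w * monomial \<alpha> z"
  by (simp add: monomial_def power_int_mult_distrib prod.distrib)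

lemma monomial_add:
  "(\<And>j. z $ j \<noteq> 0) \<Longrightarrow> monomial (\<alpha> + \<beta>) z = monomial \<alpha> z * monomial \<beta> z"
  by (simp add: monomial_def power_int_add prod.distrib)

lemma cnj_monomial_torus: "\<zeta> \<in> torus \<Longrightarrow> cnj (monomial \<alpha> \<zeta>) = monomial (- \<alpha>) \<zeta>"
proof -
  assume "\<zeta> \<in> torus"
  then have "\<zeta> $ j * cnj (\<zeta> $ j) = 1" for j
    by (simp add: torus_def flip: complex_norm_square)
  then have "cnj (\<zeta> $ j) = inverse (\<zeta> $ j)" for j
    by (metis inverse_unique)
  then show ?thesis
    by (simp add: monomial_def power_int_minus power_int_inverse)
qed

lemma norm_monomial_torus: "\<zeta> \<in> torus \<Longrightarrow> cmod (monomial \<alpha> \<zeta>) = 1"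
  by (simp add: monomial_def prod_norm[symmetric] norm_power_int torus_def)

lemma continuous_on_monomial:
  "(\<And>z j. z \<in> S \<Longrightarrow> z $ j \<noteq> 0) \<Longrightarrow> continuous_on S (monomial \<alpha>)"
  unfolding monomial_def[abs_def] by (auto intro!: continuous_intros)

lemma continuous_on_monomial_torus: "continuous_on torus (monomial \<alpha>)"
  by (rule continuous_on_monomial) (rule torus_nonzero)

lemma integral_monomial_torus:
  fixes \<alpha> :: "int ^ 'n"
  shows "(LINT \<zeta>|torus_measure. monomial \<alpha> \<zeta>) = (if \<alpha> = 0 then 1 else 0)"
proof -
  have "(LINT \<theta>:cbox 0 (\<chi> j. 2 * pi)|lborel. monomial \<alpha> (torus_point \<theta>)) =
      (LINT \<theta>|lborel. (\<Prod>j\<in>UNIV. indicator {0..2 * pi} (\<theta> $ j) *\<^sub>R cis (of_int (\<alpha> $ j) * \<theta> $ j)))"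
    unfolding set_lebesgue_integral_def
  proof (rule Bochner_Integration.integral_cong[OF refl])
    fix \<theta> :: "real ^ 'n"
    have "indicator (cbox 0 (\<chi> j. 2 * pi)) \<theta> = (\<Prod>j\<in>UNIV. indicator {0..2 * pi} (\<theta> $ j) :: real)"
      by (auto simp: indicator_def mem_box_cart intro!: prod.neutral)
    then show "indicator (cbox 0 (\<chi> j. 2 * pi)) \<theta> *\<^sub>R monomial \<alpha> (torus_point \<theta>) =
      (\<Prod>j\<in>UNIV. indicator {0..2 * pi} (\<theta> $ j) *\<^sub>R cis (of_int (\<alpha> $ j) * \<theta> $ j))"
      by (simp add: monomial_def torus_point_def cis_power_int scaleR_conv_of_real prod.distrib)
  qed
  also have "\<dots> = (\<Prod>j\<in>UNIV. LINT t:{0..2 * pi}|lborel. cis (of_int (\<alpha> $ j) * t))"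
    unfolding set_lebesgue_integral_def
    by (rule lborel_integral_prod_cart)
      (intro borel_integrable_atLeastAtMost'[unfolded set_integrable_def] continuous_intros)
  also have "\<dots> = (if \<alpha> = 0 then (2 * pi) ^ CARD('n) else 0)"
    by (auto simp: integral_cis_period vec_eq_iff)
  finally show ?thesis
    by (simp add: integral_torus[OF continuous_on_monomial_torus] scaleR_conv_of_real field_simps)
qed

lemma inner_monomial_torus:
  "(LINT \<zeta>|torus_measure. monomial \<alpha> \<zeta> * monomial (- \<beta>) \<zeta>) = (if \<alpha> = \<beta> then 1 else 0)"
proof -
  have "(LINT \<zeta>|torus_measure. monomial \<alpha> \<zeta> * monomial (- \<beta>) \<zeta>) =
      (LINT \<zeta>|torus_measure. monomial (\<alpha> + (- \<beta>)) \<zeta>)"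
    by (intro Bochner_Integration.integral_cong refl monomial_add[symmetric])
      (auto simp: torus_nonzero)
  then show ?thesis
    by (simp add: integral_monomial_torus)
qed

text \<open>The closure under equality on the torus is what makes the class closed under products and
conjugation: the conjugate of \<open>\<zeta>\<^sup>\<alpha>\<close>, for instance, is \<open>\<zeta>\<^bsup>-\<alpha>\<^esup>\<close> on the torus but not elsewhere.\<close>
inductive trig_poly :: "(complex ^ 'n \<Rightarrow> complex) \<Rightarrow> bool" where
  trig_monomial: "trig_poly (\<lambda>\<zeta>. c * monomial \<alpha> \<zeta>)"
| trig_add: "trig_poly p \<Longrightarrow> trig_poly q \<Longrightarrow> trig_poly (\<lambda>\<zeta>. p \<zeta> + q \<zeta>)"
| trig_cong: "trig_poly p \<Longrightarrow> (\<And>\<zeta>. \<zeta> \<in> torus \<Longrightarrow> q \<zeta> = p \<zeta>) \<Longrightarrow> trig_poly q"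

lemma trig_poly_const: "trig_poly (\<lambda>_. c)"
  using trig_monomial[of c 0] by simp

lemma trig_poly_cmult: "trig_poly p \<Longrightarrow> trig_poly (\<lambda>\<zeta>. c * p \<zeta>)"
proof (induction rule: trig_poly.induct)
  case (trig_monomial d \<alpha>)
  show ?case using trig_poly.trig_monomial[of "c * d" \<alpha>] by (simp add: mult.assoc)
next
  case (trig_add p q)
  then show ?case by (simp add: ring_distribs trig_poly.trig_add)
next
  case (trig_cong p q)
  then show ?case by (auto intro: trig_poly.trig_cong[OF trig_cong(3)])
qed

lemma trig_poly_monomial_mult: "trig_poly p \<Longrightarrow> trig_poly (\<lambda>\<zeta>. monomial \<alpha> \<zeta> * p \<zeta>)"
proof (induction rule: trig_poly.induct)
  case (trig_monomial d \<beta>)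
  show ?case
    by (rule trig_cong[OF trig_poly.trig_monomial[of d "\<alpha> + \<beta>"]])
      (simp add: monomial_add torus_nonzero)
next
  case (trig_add p q)
  then show ?case by (simp add: ring_distribs trig_poly.trig_add)
next
  case (trig_cong p q)
  then show ?case by (auto intro: trig_poly.trig_cong[OF trig_cong(3)])
qed

lemma trig_poly_mult:
  assumes "trig_poly p" "trig_poly q"
  shows "trig_poly (\<lambda>\<zeta>. p \<zeta> * q \<zeta>)"
  using assms(1)
proof (induction rule: trig_poly.induct)
  case (trig_monomial c \<alpha>)
  then show ?case
    using trig_poly_cmult[OF trig_poly_monomial_mult[OF assms(2)], of c \<alpha>] by (simp add: mult.assoc)
next
  case (trig_add p q)
  then show ?case by (simp add: ring_distribs trig_poly.trig_add)
next
  case (trig_cong p q)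
  then show ?case by (auto intro: trig_poly.trig_cong[OF trig_cong(3)])
qed

lemma trig_poly_cnj: "trig_poly p \<Longrightarrow> trig_poly (\<lambda>\<zeta>. cnj (p \<zeta>))"
proof (induction rule: trig_poly.induct)
  case (trig_monomial c \<alpha>)
  show ?case
    by (rule trig_cong[OF trig_poly.trig_monomial[of "cnj c" "- \<alpha>"]]) (simp add: cnj_monomial_torus)
next
  case (trig_add p q)
  then show ?case by (simp add: trig_poly.trig_add)
next
  case (trig_cong p q)
  then show ?case by (auto intro: trig_poly.trig_cong[OF trig_cong(3)])
qed

lemma trig_poly_coordinate: "trig_poly (\<lambda>\<zeta> :: complex ^ 'b. \<zeta> $ j)"
proof -
  have "monomial (axis j 1) \<zeta> = \<zeta> $ j" for \<zeta> :: "complex ^ 'b"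
    by (simp add: monomial_def axis_def if_distrib[of "\<lambda>k. _ powi k"] cong: if_cong)
  then show ?thesis
    using trig_monomial[of 1 "axis j 1"] by simp
qed

lemma continuous_on_trig_poly: "trig_poly p \<Longrightarrow> continuous_on torus p"
proof (induction rule: trig_poly.induct)
  case (trig_cong p q)
  then show ?case by (metis continuous_on_cong)
qed (auto intro!: continuous_intros continuous_on_monomial_torus)

lemma trig_poly_Re: "trig_poly p \<Longrightarrow> trig_poly (\<lambda>\<zeta>. complex_of_real (Re (p \<zeta>)))"
proof -
  assume "trig_poly p"
  from trig_poly_cmult[OF trig_add[OF this trig_poly_cnj[OF this]], of "1 / 2"] show ?thesis
    by (simp add: complex_add_cnj)
qed

lemma trig_poly_Im: "trig_poly p \<Longrightarrow> trig_poly (\<lambda>\<zeta>. complex_of_real (Im (p \<zeta>)))"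
  using trig_poly_Re[OF trig_poly_cmult[of p "- \<i>"]] by simp

text \<open>Real-valued trigonometric polynomials form an algebra of real functions; it separates points because
it contains the real and imaginary parts of all coordinates.\<close>
lemma trig_poly_dense_real:
  fixes \<phi> :: "complex ^ 'n \<Rightarrow> real"
  assumes "continuous_on torus \<phi>" "0 < e"
  obtains p where "trig_poly (\<lambda>\<zeta>. complex_of_real (p \<zeta>))" "\<And>\<zeta>. \<zeta> \<in> torus \<Longrightarrow> \<bar>\<phi> \<zeta> - p \<zeta>\<bar> < e"
proof -
  have "\<exists>p. trig_poly (\<lambda>\<zeta>. complex_of_real (p \<zeta>)) \<and> (\<forall>\<zeta>\<in>torus. \<bar>\<phi> \<zeta> - p \<zeta>\<bar> < e)"
  proof (rule Stone_Weierstrass_HOL[OF compact_torus _ _ _ _ _ assms(1,2)])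
    show "trig_poly (\<lambda>\<zeta>. complex_of_real c)" for c
      by (rule trig_poly_const)
    show "continuous_on torus p" if "trig_poly (\<lambda>\<zeta>. complex_of_real (p \<zeta>))" for p :: "complex ^ 'n \<Rightarrow> real"
      using continuous_on_Re[OF continuous_on_trig_poly[OF that]] by simp
    fix x y :: "complex ^ 'n"
    assume "x \<in> torus \<and> y \<in> torus \<and> x \<noteq> y"
    then obtain j where "x $ j \<noteq> y $ j" by (auto simp: vec_eq_iff)
    then have "Re (x $ j) \<noteq> Re (y $ j) \<or> Im (x $ j) \<noteq> Im (y $ j)"
      by (simp add: complex_eq_iff)
    then show "\<exists>p. trig_poly (\<lambda>\<zeta>. complex_of_real (p \<zeta>)) \<and> p x \<noteq> p y"
      using trig_poly_Re[OF trig_poly_coordinate] trig_poly_Im[OF trig_poly_coordinate] by metis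
  qed (auto intro: trig_add trig_poly_mult)
  then show ?thesis using that by blast
qed

lemma trig_poly_dense:
  fixes \<phi> :: "complex ^ 'n \<Rightarrow> complex"
  assumes "continuous_on torus \<phi>" "0 < e"
  obtains p where "trig_poly p" "\<And>\<zeta>. \<zeta> \<in> torus \<Longrightarrow> cmod (\<phi> \<zeta> - p \<zeta>) \<le> e"
proof -
  obtain p where p: "trig_poly (\<lambda>\<zeta>. complex_of_real (p \<zeta>))" "\<And>\<zeta>. \<zeta> \<in> torus \<Longrightarrow> \<bar>Re (\<phi> \<zeta>) - p \<zeta>\<bar> < e / 2"
    using trig_poly_dense_real[OF continuous_on_Re[OF assms(1)], of "e / 2"] assms(2) by auto
  obtain q where q: "trig_poly (\<lambda>\<zeta>. complex_of_real (q \<zeta>))" "\<And>\<zeta>. \<zeta> \<in> torus \<Longrightarrow> \<bar>Im (\<phi> \<zeta>) - q \<zeta>\<bar> < e / 2"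
    using trig_poly_dense_real[OF continuous_on_Im[OF assms(1)], of "e / 2"] assms(2) by auto
  show ?thesis
  proof
    show "trig_poly (\<lambda>\<zeta>. complex_of_real (p \<zeta>) + \<i> * complex_of_real (q \<zeta>))"
      by (intro trig_add trig_poly_cmult p q)
    show "cmod (\<phi> \<zeta> - (complex_of_real (p \<zeta>) + \<i> * complex_of_real (q \<zeta>))) \<le> e" if "\<zeta> \<in> torus" for \<zeta>
      using p(2)[OF that] q(2)[OF that] cmod_le[of "\<phi> \<zeta> - (complex_of_real (p \<zeta>) + \<i> * complex_of_real (q \<zeta>))"]
      by auto
  qed
qed

lemma norm_integral_torus_le:
  fixes \<phi> :: "complex ^ 'n \<Rightarrow> complex"
  assumes "continuous_on torus \<phi>" "\<And>\<zeta>. \<zeta> \<in> torus \<Longrightarrow> cmod (\<phi> \<zeta>) \<le> e"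
  shows "cmod (LINT \<zeta>|torus_measure. \<phi> \<zeta>) \<le> e"
proof -
  have "cmod (LINT \<zeta>|torus_measure. \<phi> \<zeta>) \<le> (LINT \<zeta>|torus_measure. cmod (\<phi> \<zeta>))"
    by (rule integral_norm_bound)
  also have "\<dots> \<le> (LINT \<zeta>|(torus_measure :: (complex ^ 'n) measure). e)"
    by (intro integral_mono integrable_torusI continuous_intros assms) (use assms in auto)
  finally show ?thesis by (simp add: measure_torus)
qed

lemma torus_mult: "\<eta> \<in> torus \<Longrightarrow> \<zeta> \<in> torus \<Longrightarrow> \<eta> * \<zeta> \<in> torus"
  by (simp add: torus_def norm_mult)

lemma continuous_on_vec_mult [continuous_intros]:
  fixes f g :: "'a :: topological_space \<Rightarrow> complex ^ 'n"
  assumes "continuous_on S f" "continuous_on S g"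
  shows "continuous_on S (\<lambda>x. f x * g x)"
proof -
  have "continuous_on S (\<lambda>x. \<chi> i. f x $ i * g x $ i)"
    by (intro continuous_intros assms)
  then show ?thesis by (simp add: times_vec_def)
qed

text \<open>A rotation by \<open>\<eta>\<close> multiplies the character \<open>\<zeta>\<^sup>\<alpha>\<close> by the constant \<open>\<eta>\<^sup>\<alpha>\<close>, and the integral of the character
vanishes unless \<open>\<alpha> = 0\<close>. Thus the two sides agree on trigonometric polynomials, and both are continuous
in the uniform norm.\<close>
lemma integral_torus_rotate:
  fixes \<phi> :: "complex ^ 'n \<Rightarrow> complex"
  assumes \<phi>: "continuous_on torus \<phi>" and \<eta>: "\<eta> \<in> torus"
  shows "(LINT \<zeta>|torus_measure. \<phi> (\<eta> * \<zeta>)) = (LINT \<zeta>|torus_measure. \<phi> \<zeta>)"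
proof -
  have cont: "continuous_on torus (\<lambda>\<zeta>. \<psi> (\<eta> * \<zeta>))" if "continuous_on torus \<psi>" for \<psi> :: "complex ^ 'n \<Rightarrow> complex"
    by (rule continuous_on_compose2[OF that]) (auto intro!: continuous_intros torus_mult \<eta>)
  have trig: "(LINT \<zeta>|torus_measure. p (\<eta> * \<zeta>)) = (LINT \<zeta>|torus_measure. p \<zeta>)" if "trig_poly p" for p
    using that
  proof (induction rule: trig_poly.induct)
    case (trig_monomial c \<alpha>)
    then show ?case by (simp add: monomial_mult integral_monomial_torus mult.left_commute)
  next
    case (trig_add p q)
    then show ?case
      by (simp add: integrable_torusI cont continuous_on_trig_poly)
  next
    case (trig_cong p q)
    have "(LINT \<zeta>|torus_measure. q (\<eta> * \<zeta>)) = (LINT \<zeta>|torus_measure. p (\<eta> * \<zeta>))"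
      "(LINT \<zeta>|torus_measure. q \<zeta>) = (LINT \<zeta>|torus_measure. p \<zeta>)"
      using trig_cong(2) by (auto intro!: Bochner_Integration.integral_cong simp: torus_mult[OF \<eta>])
    then show ?case using trig_cong by simp
  qed
  have "cmod ((LINT \<zeta>|torus_measure. \<phi> (\<eta> * \<zeta>)) - (LINT \<zeta>|torus_measure. \<phi> \<zeta>)) \<le> e" if "0 < e" for e
  proof -
    have "0 < e / 2" using that by simp
    obtain p where p: "trig_poly p" "\<And>\<zeta>. \<zeta> \<in> torus \<Longrightarrow> cmod (\<phi> \<zeta> - p \<zeta>) \<le> e / 2"
      using trig_poly_dense[OF \<phi> \<open>0 < e / 2\<close>] by blast
    note c = continuous_on_trig_poly[OF p(1)]
    have "cmod (LINT \<zeta>|torus_measure. \<phi> (\<eta> * \<zeta>) - p (\<eta> * \<zeta>)) \<le> e / 2"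
      by (intro norm_integral_torus_le continuous_intros cont \<phi> c p torus_mult \<eta>)
    moreover have "cmod (LINT \<zeta>|torus_measure. \<phi> \<zeta> - p \<zeta>) \<le> e / 2"
      by (intro norm_integral_torus_le continuous_intros \<phi> c p)
    ultimately show ?thesis
      using trig[OF p(1)] norm_triangle_ineq4[of "LINT \<zeta>|torus_measure. \<phi> (\<eta> * \<zeta>) - p (\<eta> * \<zeta>)"
          "LINT \<zeta>|torus_measure. \<phi> \<zeta> - p \<zeta>"]
      by (simp add: integrable_torusI cont \<phi> c)
  qed
  then show ?thesis
    using field_le_epsilon[of "cmod _" 0] by (metis add_0 norm_le_zero_iff right_minus_eq)
qed

lemma continuous_nonneg_integral_0_torus:
  fixes \<phi> :: "complex ^ 'n \<Rightarrow> real"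
  assumes \<phi>: "continuous_on torus \<phi>" "\<And>\<zeta>. \<zeta> \<in> torus \<Longrightarrow> 0 \<le> \<phi> \<zeta>"
    and 0: "(LINT \<zeta>|torus_measure. \<phi> \<zeta>) = 0" and \<zeta>: "\<zeta> \<in> torus"
  shows "\<phi> \<zeta> = 0"
proof -
  let ?B = "cbox 0 (\<chi> j. 2 * pi) :: (real ^ 'n) set"
  have cont: "continuous_on ?B (\<lambda>\<theta>. \<phi> (torus_point \<theta>))"
    by (rule continuous_on_compose2[OF \<phi>(1) continuous_on_torus_point])
      (auto simp: torus_point_in_torus)
  have "set_integrable lborel ?B (\<lambda>\<theta>. \<phi> (torus_point \<theta>))"
    unfolding set_integrable_def
    using borel_integrable_compact[OF compact_cbox cont] by (simp add: indicator_scaleR_eq_if)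
  then have "((\<lambda>\<theta>. \<phi> (torus_point \<theta>)) has_integral 0) ?B"
    using has_integral_set_lebesgue[of ?B "\<lambda>\<theta>. \<phi> (torus_point \<theta>)"] 0 
    by (simp add: integral_torus[OF \<phi>(1)] set_borel_integral_eq_integral has_integral_iff)
  moreover have "box 0 (\<chi> j. 2 * pi) \<noteq> ({} :: (real ^ 'n) set)"
    by (simp add: interval_ne_empty_cart)
  moreover obtain \<theta> where "\<theta> \<in> ?B" "\<zeta> = torus_point \<theta>"
    using torus_pointE[OF \<zeta>] .
  ultimately show ?thesis
    using has_integral_0_cbox_imp_0[OF cont] \<phi>(2) torus_point_in_torus by blast
qed

text \<open>The function \<open>\<phi>\<close> is orthogonal to all trigonometric polynomials, in particular to uniform
approximations of itself, so its \<open>L\<^sup>2\<close> norm is zero.\<close>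
lemma Fourier_coefficients_0_imp_0:
  fixes \<phi> :: "complex ^ 'n \<Rightarrow> complex"
  assumes \<phi>: "continuous_on torus \<phi>"
    and 0: "\<And>\<alpha>. (LINT \<zeta>|torus_measure. \<phi> \<zeta> * monomial (- \<alpha>) \<zeta>) = 0" and \<zeta>: "\<zeta> \<in> torus"
  shows "\<phi> \<zeta> = 0"
proof -
  have trig: "(LINT \<zeta>|torus_measure. \<phi> \<zeta> * p \<zeta>) = 0" if "trig_poly p" for p
    using that
  proof (induction rule: trig_poly.induct)
    case (trig_monomial c \<alpha>)
    then show ?case using 0[of "- \<alpha>"] by (simp add: mult.left_commute)
  next
    case (trig_add p q)
    then show ?case
      by (simp add: ring_distribs integrable_torusI continuous_on_mult \<phi> continuous_on_trig_poly)
  next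
    case (trig_cong p q)
    have "(LINT \<zeta>|torus_measure. \<phi> \<zeta> * q \<zeta>) = (LINT \<zeta>|torus_measure. \<phi> \<zeta> * p \<zeta>)"
      using trig_cong(2) by (auto intro!: Bochner_Integration.integral_cong)
    then show ?case using trig_cong by simp
  qed
  obtain B where B: "\<And>\<zeta>. \<zeta> \<in> torus \<Longrightarrow> cmod (\<phi> \<zeta>) \<le> B"
    using compact_imp_bounded[OF compact_continuous_image[OF \<phi> compact_torus]]
    by (auto simp: bounded_iff)
  have "0 \<le> B" using B[OF \<zeta>] norm_ge_zero order_trans by blast
  have "cmod (LINT \<zeta>|torus_measure. \<phi> \<zeta> * cnj (\<phi> \<zeta>)) \<le> e" if "0 < e" for e
  proof -
    have "0 < e / (B + 1)" using that \<open>0 \<le> B\<close> by simp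
    obtain p where p: "trig_poly p" "\<And>\<zeta>. \<zeta> \<in> torus \<Longrightarrow> cmod (\<phi> \<zeta> - p \<zeta>) \<le> e / (B + 1)"
      using trig_poly_dense[OF \<phi> \<open>0 < e / (B + 1)\<close>] by blast
    note c = continuous_on_trig_poly[OF p(1)]
    have le: "cmod (\<phi> \<zeta> * (cnj (\<phi> \<zeta>) - cnj (p \<zeta>))) \<le> e" if "\<zeta> \<in> torus" for \<zeta>
    proof -
      have "cmod (\<phi> \<zeta> * (cnj (\<phi> \<zeta>) - cnj (p \<zeta>))) = cmod (\<phi> \<zeta>) * cmod (\<phi> \<zeta> - p \<zeta>)"
        by (metis complex_cnj_diff complex_mod_cnj norm_mult)
      also have "\<dots> \<le> B * (e / (B + 1))"
        by (intro mult_mono B p that \<open>0 \<le> B\<close>) auto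
      also have "\<dots> \<le> e"
        using \<open>0 < e\<close> \<open>0 \<le> B\<close> by (simp add: field_simps)
      finally show ?thesis .
    qed
    have "cmod (LINT \<zeta>|torus_measure. \<phi> \<zeta> * (cnj (\<phi> \<zeta>) - cnj (p \<zeta>))) \<le> e"
      by (intro norm_integral_torus_le le continuous_intros \<phi> c)
    then show ?thesis
      using trig[OF trig_poly_cnj[OF p(1)]]
      by (simp add: ring_distribs integrable_torusI continuous_on_mult continuous_on_cnj \<phi> c)
  qed
  then have "cmod (LINT \<zeta>|torus_measure. \<phi> \<zeta> * cnj (\<phi> \<zeta>)) \<le> 0"
    using field_le_epsilon[of "cmod _" 0] by simp
  then have "(LINT \<zeta>|torus_measure. complex_of_real ((cmod (\<phi> \<zeta>))\<^sup>2)) = 0"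
    by (simp add: complex_norm_square del: of_real_power)
  then have "(LINT \<zeta>|torus_measure. (cmod (\<phi> \<zeta>))\<^sup>2) = 0"
    by (simp del: of_real_power)
  from continuous_nonneg_integral_0_torus[OF _ _ this \<zeta>] show ?thesis
    by (simp add: \<phi> continuous_intros)
qed

section \<open>Monomials on the Hartogs triangle\<close>

abbreviation min_coord :: "'n::{finite,linorder}" where
  "min_coord \<equiv> Min UNIV"

lemma min_coord_le: "min_coord \<le> (k :: 'n::{finite,linorder})"
  by simp

lemma le_min_coord_iff: "k \<le> min_coord \<longleftrightarrow> k = (min_coord :: 'n::{finite,linorder})"
  using min_coord_le[of k] by (auto intro: antisym)

text \<open>The exponents of the polydisc coordinates \<open>w\<^sub>j\<close> in \<open>z\<^sup>\<alpha>\<close>, after the shift by \<open>j - 1\<close> that makes all of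
them non-negative exactly for \<open>\<alpha>\<close> in \<open>hardy_index\<close>.\<close>
definition polydisc_degree :: "int ^ 'n::{finite,linorder} \<Rightarrow> 'n::{finite,linorder} \<Rightarrow> nat" where
  "polydisc_degree \<alpha> j = nat ((\<Sum>k | k \<le> j. \<alpha> $ k) + int (pos j) - 1)"

lemma polydisc_degree_hardy_index:
  "\<alpha> \<in> hardy_index \<Longrightarrow> int (polydisc_degree \<alpha> j) = (\<Sum>k | k \<le> j. \<alpha> $ k) + int (pos j) - 1"
  by (simp add: polydisc_degree_def hardy_index_def)

lemma partial_sums_inject:
  fixes \<alpha> \<beta> :: "int ^ 'n::{finite,linorder}"
  assumes "\<And>j. (\<Sum>k | k \<le> j. \<alpha> $ k) = (\<Sum>k | k \<le> j. \<beta> $ k)"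
  shows "\<alpha> = \<beta>"
proof -
  have "\<alpha> $ j = \<beta> $ j" for j
  proof (induction "card {k. k < j}" arbitrary: j rule: less_induct)
    case less
    have split: "{k. k \<le> j} = insert j {k. k < j}" by auto
    have "\<alpha> $ k = \<beta> $ k" if "k < j" for k
      using that by (intro less psubset_card_mono) auto
    then have "(\<Sum>k | k < j. \<alpha> $ k) = (\<Sum>k | k < j. \<beta> $ k)"
      by (intro sum.cong) auto
    with assms[of j] show ?case
      by (simp add: split)
  qed
  then show ?thesis by (simp add: vec_eq_iff)
qed

lemma inj_on_polydisc_degree: "inj_on polydisc_degree (hardy_index :: (int ^ 'n::{finite,linorder}) set)"
proof (rule inj_onI)
  fix \<alpha> \<beta> :: "int ^ 'n::{finite,linorder}"
  assume "\<alpha> \<in> hardy_index" "\<beta> \<in> hardy_index" "polydisc_degree \<alpha> = polydisc_degree \<beta>"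
  then have "(\<Sum>k | k \<le> j. \<alpha> $ k) = (\<Sum>k | k \<le> j. \<beta> $ k)" for j
    using polydisc_degree_hardy_index[of \<alpha> j] polydisc_degree_hardy_index[of \<beta> j] by simp
  then show "\<alpha> = \<beta>" by (rule partial_sums_inject)
qed

text \<open>By injectivity of the exponent vector, the finite partial sums are bounded by partial sums of a
product of \<open>n\<close> geometric series.\<close>
lemma summable_polydisc_degree:
  fixes q :: real
  assumes "0 < q" "q < 1"
  shows "(\<lambda>\<alpha>. \<Prod>j\<in>UNIV. q ^ polydisc_degree \<alpha> j) summable_on (hardy_index :: (int ^ 'n::{finite,linorder}) set)"
proof (rule nonneg_bdd_above_summable_on)
  show "0 \<le> (\<Prod>j\<in>UNIV. q ^ polydisc_degree \<alpha> j)" for \<alpha> :: "int ^ 'n::{finite,linorder}"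
    using assms by (simp add: prod_nonneg)
  show "bdd_above (sum (\<lambda>\<alpha>. \<Prod>j\<in>UNIV. q ^ polydisc_degree \<alpha> j) ` {F. F \<subseteq> (hardy_index :: (int ^ 'n::{finite,linorder}) set) \<and> finite F})"
  proof (rule bdd_aboveI2)
    fix F :: "(int ^ 'n::{finite,linorder}) set"
    assume "F \<in> {F. F \<subseteq> hardy_index \<and> finite F}"
    then have F: "F \<subseteq> hardy_index" "finite F" by auto
    define N where "N = Max ((\<lambda>(\<alpha>, j). polydisc_degree \<alpha> j) ` (F \<times> UNIV))"
    have N: "polydisc_degree \<alpha> j \<le> N" if "\<alpha> \<in> F" for \<alpha> j
      unfolding N_def using F that by (intro Max_ge) (auto intro!: image_eqI[where x = "(\<alpha>, j)"])
    have "(\<Sum>\<alpha>\<in>F. \<Prod>j\<in>UNIV. q ^ polydisc_degree \<alpha> j) = (\<Sum>d\<in>polydisc_degree ` F. \<Prod>j\<in>UNIV. q ^ d j)"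
      using inj_on_subset[OF inj_on_polydisc_degree F(1)] by (simp add: sum.reindex)
    also have "\<dots> \<le> (\<Sum>d\<in>PiE (UNIV :: 'n set) (\<lambda>_. {..N}). \<Prod>j\<in>UNIV. q ^ d j)"
    proof (rule sum_mono2)
      show "finite (PiE (UNIV :: 'n set) (\<lambda>_. {..N}))" by (intro finite_PiE) auto
      show "polydisc_degree ` F \<subseteq> PiE UNIV (\<lambda>_. {..N})" by (intro image_subsetI PiE_I) (simp_all add: N)
      show "0 \<le> (\<Prod>j\<in>UNIV. q ^ d j)" for d :: "'n \<Rightarrow> nat"
        using assms by (intro prod_nonneg) simp
    qed
    also have "\<dots> = (\<Prod>j\<in>(UNIV :: 'n set). \<Sum>m\<le>N. q ^ m)"
      by (rule prod_sum_PiE[symmetric]) auto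
    also have "\<dots> \<le> (\<Prod>j\<in>(UNIV :: 'n set). 1 / (1 - q))"
    proof (intro prod_mono conjI)
      show "0 \<le> (\<Sum>m\<le>N. q ^ m)" using assms by (intro sum_nonneg) simp
      show "(\<Sum>m\<le>N. q ^ m) \<le> 1 / (1 - q)" using geometric_sum_less[of q "{..N}"] assms by simp
    qed
    finally show "(\<Sum>\<alpha>\<in>F. \<Prod>j\<in>UNIV. q ^ polydisc_degree \<alpha> j) \<le> (\<Prod>j\<in>(UNIV :: 'n set). 1 / (1 - q))" .
  qed
qed

lemma powi_prod: "(\<Prod>j\<in>A. f j) powi n = (\<Prod>j\<in>A. f j powi n)" for f :: "'b \<Rightarrow> 'a::field"
  by (induction A rule: infinite_finite_induct) (auto simp: power_int_mult_distrib)

lemma powi_sum: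
  "x \<noteq> 0 \<Longrightarrow> x powi (\<Sum>j\<in>A. f j) = (\<Prod>j\<in>A. x powi f j)" for x :: "'a::field"
  by (induction A rule: infinite_finite_induct) (auto simp: power_int_add)

text \<open>The monomial \<open>\<Prod>\<^sub>k z\<^sub>k\<^sup>\<beta>\<close> in polydisc coordinates: exchange the two products over pairs \<open>k \<le> j\<close>. The first
\<open>r\<close> may vanish, since only one factor contains it and no exponents are added there.\<close>
lemma prod_tail_products_powi:
  fixes r :: "'n::{finite,linorder} \<Rightarrow> 'a::field"
  assumes "\<And>j. j \<noteq> min_coord \<Longrightarrow> r j \<noteq> 0"
  shows "(\<Prod>k\<in>UNIV. (\<Prod>j | k \<le> j. r j) powi \<beta> k) = (\<Prod>j\<in>UNIV. r j powi (\<Sum>k | k \<le> j. \<beta> k))"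
proof -
  have "(\<Prod>k\<in>UNIV. (\<Prod>j | k \<le> j. r j) powi \<beta> k) = (\<Prod>k\<in>UNIV. \<Prod>j | j \<in> UNIV \<and> k \<le> j. r j powi \<beta> k)"
    by (simp add: powi_prod)
  also have "\<dots> = (\<Prod>j\<in>UNIV. \<Prod>k | k \<in> UNIV \<and> k \<le> j. r j powi \<beta> k)"
    by (rule prod.swap_restrict) auto
  also have "\<dots> = (\<Prod>j\<in>UNIV. r j powi (\<Sum>k | k \<le> j. \<beta> k))"
  proof (rule prod.cong[OF refl])
    fix j :: 'n
    show "(\<Prod>k | k \<in> UNIV \<and> k \<le> j. r j powi \<beta> k) = r j powi (\<Sum>k | k \<le> j. \<beta> k)"
    proof (cases "j = min_coord")
      case True
      have "{k. k \<le> j} = {j}" using le_min_coord_iff True by auto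
      then show ?thesis by simp
    next
      case False
      then show ?thesis using assms by (simp add: powi_sum)
    qed
  qed
  finally show ?thesis .
qed

lemma norm_monomial: "cmod (monomial \<alpha> z) = (\<Prod>k\<in>UNIV. cmod (z $ k) powi (\<alpha> $ k))"
  by (simp add: monomial_def norm_power_int flip: prod_norm)

lemma sum_plus_pos:
  "(\<Sum>k | k \<le> j. \<alpha> $ k + 1) = (\<Sum>k | k \<le> j. \<alpha> $ k) + int (pos j)" for \<alpha> :: "int ^ 'n::{finite,linorder}"
  by (simp add: sum.distrib pos_def)

text \<open>Multiplying by \<open>z\<^sub>2 \<cdots> z\<^sub>n\<close>, which is \<open>\<Prod>\<^sub>j w\<^sub>j\<^bsup>j-1\<^esup>\<close>, turns the monomial into a monomial in \<open>w\<close> with exponents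
in \<open>\<nat>\<close>. The first coordinate, which may vanish on the triangle, is left out of the product.\<close>
lemma norm_monomial_times_coords:
  fixes r :: "'n::{finite,linorder} \<Rightarrow> real"
  assumes z: "\<And>k. cmod (z $ k) = (\<Prod>j | k \<le> j. r j)"
    and r: "\<And>j. j \<noteq> min_coord \<Longrightarrow> r j \<noteq> 0" and \<alpha>: "\<alpha> \<in> hardy_index"
  shows "cmod (monomial \<alpha> z) * (\<Prod>k\<in>-{min_coord}. cmod (z $ k)) = (\<Prod>j\<in>UNIV. r j ^ polydisc_degree \<alpha> j)"
proof -
  \<comment> \<open>The exponents after multiplication by the coordinates other than the first; their partial sums
are the exponents in polydisc coordinates.\<close>
  define \<beta> where "\<beta> k = \<alpha> $ k + (if k = min_coord then 0 else 1)" for k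
  have nz: "cmod (z $ k) \<noteq> 0" if "k \<noteq> min_coord" for k
  proof -
    have "j \<noteq> min_coord" if "k \<le> j" for j
      using that \<open>k \<noteq> min_coord\<close> le_min_coord_iff by blast
    then show ?thesis unfolding z using r by simp
  qed
  have sum_\<beta>: "(\<Sum>k | k \<le> j. \<beta> k) = int (polydisc_degree \<alpha> j)" for j
  proof -
    have "(\<Sum>k | k \<le> j. \<beta> k) + 1 = (\<Sum>k | k \<le> j. \<beta> k) + (\<Sum>k | k \<le> j. if k = min_coord then 1 else 0)"
      by simp
    also have "\<dots> = (\<Sum>k | k \<le> j. \<alpha> $ k + 1)"
      unfolding sum.distrib[symmetric] \<beta>_def by (intro sum.cong) auto
    finally show ?thesis
      using sum_plus_pos[of \<alpha> j] polydisc_degree_hardy_index[OF \<alpha>, of j] by linarith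
  qed
  have "cmod (monomial \<alpha> z) * (\<Prod>k\<in>-{min_coord}. cmod (z $ k)) =
      (\<Prod>k\<in>UNIV. cmod (z $ k) powi (\<alpha> $ k)) * (\<Prod>k\<in>UNIV. if k = min_coord then 1 else cmod (z $ k))"
    unfolding norm_monomial by (intro arg_cong2[where f = times] refl prod.mono_neutral_cong_left) auto
  also have "\<dots> = (\<Prod>k\<in>UNIV. cmod (z $ k) powi \<beta> k)"
    unfolding prod.distrib[symmetric] \<beta>_def
    by (intro prod.cong refl) (auto simp: power_int_add[OF disjI1[OF nz]])
  also have "\<dots> = (\<Prod>j\<in>UNIV. r j powi (\<Sum>k | k \<le> j. \<beta> k))"
    unfolding z by (rule prod_tail_products_powi) (rule r)
  also have "\<dots> = (\<Prod>j\<in>UNIV. r j powi int (polydisc_degree \<alpha> j))"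
    by (simp only: sum_\<beta>)
  finally show ?thesis by simp
qed

text \<open>The polydisc coordinates of a point with increasing absolute values \<open>x\<^sub>k\<close>: the factor \<open>r\<^sub>j\<close> is
\<open>x\<^sub>j / x\<^bsub>j+1\<^esub>\<close>, and \<open>x\<^sub>n\<close> for the last one. All of them are at most \<open>q\<close> under the hypotheses.\<close>
lemma tail_product_representation:
  fixes x :: "'n::{finite,linorder} \<Rightarrow> real"
  assumes nonneg: "\<And>k. 0 \<le> x k" and pos: "\<And>k. k \<noteq> min_coord \<Longrightarrow> 0 < x k"
    and q: "\<And>i j. i < j \<Longrightarrow> x i \<le> q * x j" "\<And>j. x j \<le> q"
  obtains r where "\<And>j. 0 \<le> r j" "\<And>j. r j \<le> q" "\<And>j. j \<noteq> min_coord \<Longrightarrow> 0 < r j"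
    "\<And>k. x k = (\<Prod>j | k \<le> j. r j)"
proof -
  define next_val where "next_val k = (if {i. k < i} = {} then 1 else x (Min {i. k < i}))" for k
  have next_pos: "0 < next_val k" and next_le: "x k \<le> q * next_val k" for k
  proof -
    have gt: "Min {i. k < i} > k" if "{i. k < i} \<noteq> {}"
      using Min_in[OF _ that] by simp
    then have "Min {i. k < i} \<noteq> min_coord" if "{i. k < i} \<noteq> {}"
      using that min_coord_le[of k] not_le by metis
    then show "0 < next_val k" unfolding next_val_def using pos by simp
    show "x k \<le> q * next_val k" unfolding next_val_def using q gt by simp
  qed
  have "x k = (\<Prod>j | k \<le> j. x j / next_val j)" for k
  proof (induction "card {i. k < i}" arbitrary: k rule: less_induct)
    case less
    have split: "{j. k \<le> j} = insert k {j. k < j}" by auto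
    show ?case
    proof (cases "{i. k < i} = {}")
      case True
      then show ?thesis by (simp add: split next_val_def)
    next
      case False
      define m where "m = Min {i. k < i}"
      have m: "k < m" using Min_in[OF _ False] by (simp add: m_def)
      have "{i. m < i} \<subset> {i. k < i}" using m by auto
      then have IH: "x m = (\<Prod>j | m \<le> j. x j / next_val j)"
        by (intro less psubset_card_mono) auto
      have "{j. k < j} = {j. m \<le> j}"
        using m Min_le[of "{i. k < i}", folded m_def] by (auto dest: order_less_le_trans)
      then have "(\<Prod>j | k \<le> j. x j / next_val j) = x k / next_val k * x m"
        using m by (simp add: split IH[symmetric] not_le)
      moreover have "next_val k = x m" using False unfolding next_val_def m_def by (rule if_not_P)
      ultimately show ?thesis using next_pos[of k] by simp
    qed
  qed
  moreover have "x j / next_val j \<le> q" for j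
    using next_le[of j] next_pos[of j] by (simp add: pos_divide_le_eq)
  moreover have "0 \<le> x j / next_val j" for j
    using nonneg[of j] next_pos[of j] by simp
  moreover have "0 < x j / next_val j" if "j \<noteq> min_coord" for j
    using pos[OF that] next_pos[of j] by simp
  ultimately show ?thesis
    by (intro that[of "\<lambda>j. x j / next_val j"])
qed

lemma hartogs_triangle_coord_pos:
  fixes z :: "complex ^ 'n::{finite,linorder}"
  assumes "z \<in> hartogs_triangle" "k \<noteq> min_coord"
  shows "0 < cmod (z $ k)"
proof -
  have "min_coord < k" using assms(2) min_coord_le[of k] by (intro le_neq_trans) auto
  then have "cmod (z $ min_coord) < cmod (z $ k)"
    using assms(1) by (auto simp: hartogs_triangle_def)
  then show ?thesis using norm_ge_zero[of "z $ min_coord"] by linarith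
qed

text \<open>The defining strict inequalities of the triangle hold with a margin, and the margin persists on a
ball. The bound \<open>q\<close> on the ratios and the lower bound \<open>\<epsilon>\<close> on the coordinates other than the first are the
uniform constants from which the majorant of the monomials is built.\<close>
lemma hartogs_triangle_neighbourhood:
  fixes z :: "complex ^ 'n::{finite,linorder}"
  assumes z: "z \<in> hartogs_triangle"
  obtains q \<epsilon> \<delta> where "0 < q" "q < 1" "0 < \<epsilon>" "0 < \<delta>"
    "\<And>y i j. y \<in> ball z \<delta> \<Longrightarrow> i < j \<Longrightarrow> cmod (y $ i) < q * cmod (y $ j)"
    "\<And>y j. y \<in> ball z \<delta> \<Longrightarrow> cmod (y $ j) < q"
    "\<And>y k. y \<in> ball z \<delta> \<Longrightarrow> k \<noteq> min_coord \<Longrightarrow> \<epsilon> < cmod (y $ k)"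
proof -
  have lim: "((\<lambda>q. q * c) \<longlongrightarrow> c) (at_left 1)" for c :: real
    using tendsto_mult_right[OF tendsto_ident_at, of c 1] by simp
  have less: "cmod (z $ i) < cmod (z $ j)" if "i < j" for i j
    using z that by (simp add: hartogs_triangle_def)
  have less_1: "cmod (z $ j) < 1" for j
    using z by (simp add: hartogs_triangle_def)
  have "\<forall>\<^sub>F q in at_left 1. i < j \<longrightarrow> cmod (z $ i) < q * cmod (z $ j)" for i j
    using order_tendstoD(1)[OF lim less] by (cases "i < j") simp_all
  then have "\<forall>\<^sub>F q in at_left 1. \<forall>i j. i < j \<longrightarrow> cmod (z $ i) < q * cmod (z $ j)"
    by (intro eventually_all_finite)
  moreover have "\<forall>\<^sub>F q in at_left 1. cmod (z $ j) < q" for j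
    using order_tendstoD(1)[OF lim[of 1] less_1] by simp
  then have "\<forall>\<^sub>F q in at_left 1. \<forall>j. cmod (z $ j) < q"
    by (intro eventually_all_finite)
  moreover have "\<forall>\<^sub>F q in at_left 1. 0 < q \<and> q < (1 :: real)"
    using eventually_at_left_real[of 0 "1 :: real"] by (simp only: greaterThanLessThan_iff zero_less_one)
  ultimately have ev: "\<forall>\<^sub>F q in at_left 1. (\<forall>i j. i < j \<longrightarrow> cmod (z $ i) < q * cmod (z $ j)) \<and>
      (\<forall>j. cmod (z $ j) < q) \<and> 0 < q \<and> q < 1"
    by (simp only: eventually_conj_iff)
  obtain q where q: "\<And>i j. i < j \<Longrightarrow> cmod (z $ i) < q * cmod (z $ j)"
      "\<And>j. cmod (z $ j) < q" "0 < q" "q < 1"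
    using eventually_happens'[OF trivial_limit_at_left_real ev] by blast
  have "\<exists>\<epsilon>>0. \<forall>k. k \<noteq> min_coord \<longrightarrow> \<epsilon> < cmod (z $ k)"
  proof -
    have "\<forall>\<^sub>F \<epsilon> in at_right 0. k \<noteq> min_coord \<longrightarrow> \<epsilon> < cmod (z $ k)" for k
      using order_tendstoD(2)[OF tendsto_ident_at hartogs_triangle_coord_pos[OF z]]
      by (cases "k = min_coord") simp_all
    then have "\<forall>\<^sub>F \<epsilon> in at_right 0. \<forall>k. k \<noteq> min_coord \<longrightarrow> \<epsilon> < cmod (z $ k)"
      by (intro eventually_all_finite)
    then have ev: "\<forall>\<^sub>F \<epsilon> in at_right 0. 0 < \<epsilon> \<and> (\<forall>k. k \<noteq> min_coord \<longrightarrow> \<epsilon> < cmod (z $ k))"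
      by (intro eventually_conj eventually_at_right_less)
    show ?thesis
      using eventually_happens'[OF trivial_limit_at_right_real ev] by blast
  qed
  then obtain \<epsilon> where \<epsilon>: "0 < \<epsilon>" "\<And>k. k \<noteq> min_coord \<Longrightarrow> \<epsilon> < cmod (z $ k)" by blast
  define U where "U = {y :: complex ^ 'n::{finite,linorder}. (\<forall>i j. i < j \<longrightarrow> cmod (y $ i) < q * cmod (y $ j)) \<and>
      (\<forall>j. cmod (y $ j) < q) \<and> (\<forall>k. k \<noteq> min_coord \<longrightarrow> \<epsilon> < cmod (y $ k))}"
  have "open {y :: complex ^ 'n::{finite,linorder}. i < j \<longrightarrow> cmod (y $ i) < q * cmod (y $ j)}" for i j
    by (cases "i < j") (auto intro!: open_Collect_less continuous_intros)
  moreover have "open {y :: complex ^ 'n::{finite,linorder}. cmod (y $ j) < q}" for j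
    by (auto intro!: open_Collect_less continuous_intros)
  moreover have "open {y :: complex ^ 'n::{finite,linorder}. k \<noteq> min_coord \<longrightarrow> \<epsilon> < cmod (y $ k)}" for k
    by (cases "k = min_coord") (auto intro!: open_Collect_less continuous_intros)
  moreover have "U = (\<Inter>i. \<Inter>j. {y. i < j \<longrightarrow> cmod (y $ i) < q * cmod (y $ j)}) \<inter>
      (\<Inter>j. {y. cmod (y $ j) < q}) \<inter> (\<Inter>k. {y. k \<noteq> min_coord \<longrightarrow> \<epsilon> < cmod (y $ k)})"
    by (auto simp: U_def)
  ultimately have "open U"
    by (simp add: open_INT open_Int)
  moreover have "z \<in> U" using q \<epsilon> by (auto simp: U_def)
  ultimately obtain \<delta> where "0 < \<delta>" "ball z \<delta> \<subseteq> U"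
    using open_contains_ball by blast
  then have "y \<in> U" if "y \<in> ball z \<delta>" for y
    using that by blast
  then show ?thesis
    using q(3,4) \<epsilon>(1) \<open>0 < \<delta>\<close> unfolding U_def mem_Collect_eq
    by (intro that[of q \<epsilon> \<delta>]) simp_all
qed

lemma open_hartogs_triangle: "open (hartogs_triangle :: (complex ^ 'n::{finite,linorder}) set)"
proof -
  have "\<exists>\<delta>>0. ball z \<delta> \<subseteq> hartogs_triangle" if z: "z \<in> hartogs_triangle" for z :: "complex ^ 'n::{finite,linorder}"
  proof -
    obtain q \<epsilon> \<delta> where *: "0 < q" "q < 1" "0 < \<delta>"
      "\<And>y i j. y \<in> ball z \<delta> \<Longrightarrow> i < j \<Longrightarrow> cmod (y $ i) < q * cmod (y $ j)"
      "\<And>y j. y \<in> ball z \<delta> \<Longrightarrow> cmod (y $ j) < q"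
      using hartogs_triangle_neighbourhood[OF z] by metis
    have "q * cmod (y $ j) \<le> cmod (y $ j)" for y :: "complex ^ 'n::{finite,linorder}" and j
      using *(1,2) by (simp add: mult_left_le_one_le)
    then have "cmod (y $ i) < cmod (y $ j)" "cmod (y $ i) < 1" if "y \<in> ball z \<delta>" "i < j" for i j and y :: "complex ^ 'n::{finite,linorder}"
      using *(4)[OF that] less_trans[OF *(5)[OF that(1)] *(2)] order_less_le_trans by blast+
    moreover have "cmod (y $ i) < 1" if "y \<in> ball z \<delta>" for i and y :: "complex ^ 'n::{finite,linorder}"
      using less_trans[OF *(5)[OF that(1)] *(2)] .
    ultimately have "ball z \<delta> \<subseteq> hartogs_triangle"
      unfolding hartogs_triangle_def by blast
    then show ?thesis using *(3) by blast
  qed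
  then show ?thesis by (simp add: open_contains_ball)
qed

text \<open>The Weierstrass majorant behind all convergence statements: near a point of the triangle the monomial
with index \<open>\<alpha>\<close> is at most a constant times \<open>\<Prod>\<^sub>j q\<^bsup>d\<^sub>j\<^esup>\<close>, a multiple geometric series.\<close>
lemma monomials_dominated:
  fixes z :: "complex ^ 'n::{finite,linorder}"
  assumes z: "z \<in> hartogs_triangle"
  obtains M \<delta> where "0 < \<delta>" "ball z \<delta> \<subseteq> hartogs_triangle" "M summable_on hardy_index"
    "\<And>\<alpha> y. \<alpha> \<in> hardy_index \<Longrightarrow> y \<in> ball z \<delta> \<Longrightarrow> cmod (monomial \<alpha> y) \<le> M \<alpha>"
proof -
  obtain q \<epsilon> \<delta> where *: "0 < q" "q < 1" "0 < \<epsilon>" "0 < \<delta>"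
    "\<And>y i j. y \<in> ball z \<delta> \<Longrightarrow> i < j \<Longrightarrow> cmod (y $ i) < q * cmod (y $ j)"
    "\<And>y j. y \<in> ball z \<delta> \<Longrightarrow> cmod (y $ j) < q"
    "\<And>y k. y \<in> ball z \<delta> \<Longrightarrow> k \<noteq> min_coord \<Longrightarrow> \<epsilon> < cmod (y $ k)"
    using hartogs_triangle_neighbourhood[OF z] by metis
  obtain \<delta>' where \<delta>': "0 < \<delta>'" "ball z \<delta>' \<subseteq> hartogs_triangle"
    using open_hartogs_triangle z open_contains_ball by blast
  define C where "C = (\<Prod>k\<in>-{min_coord :: 'n}. 1 / \<epsilon>)"
  have "cmod (monomial \<alpha> y) \<le> C * (\<Prod>j\<in>UNIV. q ^ polydisc_degree \<alpha> j)"
    if \<alpha>: "\<alpha> \<in> hardy_index" and y: "y \<in> ball z \<delta>" for \<alpha> y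
  proof -
    obtain r where r: "\<And>j. 0 \<le> r j" "\<And>j. r j \<le> q" "\<And>j. j \<noteq> min_coord \<Longrightarrow> 0 < r j"
      "\<And>k. cmod (y $ k) = (\<Prod>j | k \<le> j. r j)"
      using tail_product_representation[of "\<lambda>k. cmod (y $ k)" q, OF norm_ge_zero less_trans[OF *(3) *(7)[OF y]]
          less_imp_le[OF *(5)[OF y]] less_imp_le[OF *(6)[OF y]]] by blast
    have "cmod (monomial \<alpha> y) * (\<Prod>k\<in>-{min_coord :: 'n}. \<epsilon>) \<le>
        cmod (monomial \<alpha> y) * (\<Prod>k\<in>-{min_coord}. cmod (y $ k))"
    proof (rule mult_left_mono)
      show "(\<Prod>k\<in>-{min_coord :: 'n}. \<epsilon>) \<le> (\<Prod>k\<in>-{min_coord}. cmod (y $ k))"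
        by (rule prod_mono) (use *(3) less_imp_le[OF *(7)[OF y]] in auto)
    qed simp
    also have "\<dots> = (\<Prod>j\<in>UNIV. r j ^ polydisc_degree \<alpha> j)"
      by (rule norm_monomial_times_coords[OF r(4) _ \<alpha>]) (use r in force)
    also have "\<dots> \<le> (\<Prod>j\<in>UNIV. q ^ polydisc_degree \<alpha> j)"
      using r by (intro prod_mono) (auto intro: power_mono)
    finally show ?thesis
      using *(3) by (simp add: C_def field_simps)
  qed
  moreover have "(\<lambda>\<alpha>. C * (\<Prod>j\<in>UNIV. q ^ polydisc_degree \<alpha> j)) summable_on (hardy_index :: (int ^ 'n::{finite,linorder}) set)"
    by (intro summable_on_cmult_right summable_polydisc_degree *)
  ultimately show ?thesis
    using that[of "min \<delta> \<delta>'"] *(4) \<delta>' by (auto simp: subset_iff)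
qed

text \<open>The point whose polydisc coordinates are the entries of \<open>r\<close>.\<close>
definition radial :: "real ^ 'n::{finite,linorder} \<Rightarrow> complex ^ 'n::{finite,linorder}" where
  "radial r = (\<chi> k. complex_of_real (\<Prod>j | k \<le> j. r $ j))"

definition unit_box :: "(real ^ 'n::{finite,linorder}) set" where
  "unit_box = {r. \<forall>j. 0 < r $ j \<and> r $ j < 1}"

lemma unit_box_pos: "r \<in> unit_box \<Longrightarrow> 0 < r $ j"
  by (simp add: unit_box_def)

lemma polar_point_eq: "polar_point r \<theta> = radial r * torus_point \<theta>"
  by (simp add: polar_point_def radial_def torus_point_def vec_eq_iff)

lemma radial_pos: "r \<in> unit_box \<Longrightarrow> 0 < (\<Prod>j | k \<le> j. r $ j)"
  by (intro prod_pos) (simp add: unit_box_pos)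

lemma radial_nonzero: "r \<in> unit_box \<Longrightarrow> radial r $ k \<noteq> 0"
  using radial_pos[of r k] unfolding radial_def vec_lambda_beta of_real_eq_0_iff
  by (metis less_irrefl)

lemma radial_torus_in_hartogs_triangle:
  fixes r :: "real ^ 'n::{finite,linorder}"
  assumes r: "r \<in> unit_box" and \<zeta>: "\<zeta> \<in> torus"
  shows "radial r * \<zeta> \<in> hartogs_triangle"
proof -
  have norm: "cmod ((radial r * \<zeta>) $ k) = (\<Prod>j | k \<le> j. r $ j)" for k
    using \<zeta> radial_pos[OF r, of k] by (simp add: radial_def norm_mult torus_def del: of_real_prod)
  have less: "(\<Prod>j\<in>A. r $ j) < (\<Prod>j\<in>B. r $ j)" if "B \<subset> A" for A B :: "'n set"
  proof -
    obtain i where "i \<in> A - B" using \<open>B \<subset> A\<close> by blast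
    then have "(\<Prod>j\<in>A - B. r $ j) < (\<Prod>j\<in>A - B. 1)"
      using r by (intro prod_mono_strict[of i]) (auto simp: unit_box_def less_imp_le)
    moreover have "(\<Prod>j\<in>B. r $ j) > 0" by (intro prod_pos) (simp add: unit_box_pos[OF r])
    moreover have "(\<Prod>j\<in>A. r $ j) = (\<Prod>j\<in>A - B. r $ j) * (\<Prod>j\<in>B. r $ j)"
      using that by (intro prod.subset_diff) auto
    ultimately show ?thesis by simp
  qed
  have "{j'. j \<le> j'} \<subset> {j'. i \<le> j'}" if "i < j" for i j :: 'n
    using that by (intro psubsetI) (auto dest: order_less_le_trans)
  moreover have "{} \<subset> {j'. i \<le> j'}" for i :: 'n by auto
  ultimately show ?thesis
    using less less[of "{}"] unfolding hartogs_triangle_def mem_Collect_eq norm by simp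
qed

lemma monomial_radial:
  assumes "r \<in> unit_box"
  shows "monomial \<alpha> (radial r) = complex_of_real (\<Prod>j\<in>UNIV. r $ j powi (\<Sum>k | k \<le> j. \<alpha> $ k))"
proof -
  have "r $ j \<noteq> 0" for j using unit_box_pos[OF assms, of j] by simp
  then have "(\<Prod>j\<in>UNIV. r $ j powi (\<Sum>k | k \<le> j. \<alpha> $ k)) = (\<Prod>k\<in>UNIV. (\<Prod>j | k \<le> j. r $ j) powi (\<alpha> $ k))"
    by (intro prod_tail_products_powi[symmetric])
  then show ?thesis by (simp add: monomial_def radial_def)
qed

lemma pos_ge_1: "1 \<le> pos j"
proof -
  have "card {j} \<le> card {i. i \<le> j}" by (intro card_mono) auto
  then show ?thesis by (simp add: pos_def)
qed

text \<open>This is why the weight in the Hardy norm matches the index set: for integer \<open>s\<close> the exponent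
\<open>2 s + 2 j - 1\<close> is odd, hence at least 1 when \<open>s + j - 1 \<ge> 0\<close> and at most \<open>-1\<close> otherwise.\<close>
lemma norm_monomial_radial_weight:
  assumes r: "r \<in> unit_box"
  shows "(cmod (monomial \<alpha> (radial r)))\<^sup>2 * (\<Prod>j\<in>UNIV. (r $ j) ^ (2 * pos j - 1)) =
    (\<Prod>j\<in>UNIV. r $ j powi (2 * (\<Sum>k | k \<le> j. \<alpha> $ k) + 2 * int (pos j) - 1))"
proof -
  have "0 < r $ j" for j using unit_box_pos[OF r] .
  then have *: "(r $ j powi s)\<^sup>2 * (r $ j) ^ (2 * pos j - 1) = r $ j powi (2 * s + 2 * int (pos j) - 1)" for s j
  proof -
    have "r $ j \<noteq> 0" using \<open>0 < r $ j\<close> by simp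
    have "(r $ j) ^ (2 * pos j - 1) = r $ j powi (int (2 * pos j - 1))"
      by (rule power_int_of_nat[symmetric])
    also have "int (2 * pos j - 1) = 2 * int (pos j) - 1"
      using pos_ge_1[of j] by (simp add: of_nat_diff)
    finally show ?thesis
      using \<open>r $ j \<noteq> 0\<close> power_int_add[of "r $ j" s s] power_int_add[of "r $ j" "2 * s" "2 * int (pos j) - 1"]
      by (simp add: power2_eq_square add_diff_eq)
  qed
  show ?thesis
    by (simp only: monomial_radial[OF r] norm_of_real power2_abs prod_power_distrib prod.distrib[symmetric] *)
qed

lemma norm_monomial_radial_weight_index:
  assumes "r \<in> unit_box" "\<alpha> \<in> hardy_index"
  shows "(cmod (monomial \<alpha> (radial r)))\<^sup>2 * (\<Prod>j\<in>UNIV. (r $ j) ^ (2 * pos j - 1)) =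
    (\<Prod>j\<in>UNIV. r $ j ^ (2 * polydisc_degree \<alpha> j + 1))"
proof -
  have "2 * (\<Sum>k | k \<le> j. \<alpha> $ k) + 2 * int (pos j) - 1 = int (2 * polydisc_degree \<alpha> j + 1)" for j
    using polydisc_degree_hardy_index[OF assms(2), of j] by simp
  then show ?thesis
    by (simp only: norm_monomial_radial_weight[OF assms(1)] power_int_of_nat)
qed

section \<open>Dominated series of holomorphic functions\<close>

text \<open>Cauchy's inequality bounds all Taylor coefficients by \<open>M\<close>; the remainder is a geometric tail.\<close>
lemma first_order_Taylor_bounded:
  fixes \<psi> :: "complex \<Rightarrow> complex"
  assumes hol: "\<psi> holomorphic_on ball 0 R" and R: "1 < R"
    and bd: "\<And>t. cmod t \<le> 1 \<Longrightarrow> cmod (\<psi> t) \<le> M"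
  shows "cmod (deriv \<psi> 0) \<le> M"
    and "cmod t \<le> 1 / 2 \<Longrightarrow> cmod (\<psi> t - \<psi> 0 - deriv \<psi> 0 * t) \<le> 2 * M * (cmod t)\<^sup>2"
proof -
  define c where "c n = (deriv ^^ n) \<psi> 0 / fact n" for n
  have cont: "continuous_on (cball 0 1) \<psi>"
    using R by (intro holomorphic_on_imp_continuous_on holomorphic_on_subset[OF hol]) auto
  have c: "cmod (c n) \<le> M" for n
  proof -
    have "cmod ((deriv ^^ n) \<psi> 0) \<le> fact n * M / 1 ^ n"
      using R by (intro Cauchy_inequality holomorphic_on_subset[OF hol] cont bd) auto
    then show ?thesis by (simp add: c_def norm_divide field_simps)
  qed
  from c[of 1] show "cmod (deriv \<psi> 0) \<le> M" by (simp add: c_def)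
  assume t: "cmod t \<le> 1 / 2"
  have "0 \<le> M" using c[of 0] norm_ge_zero order_trans by blast
  have "(\<lambda>n. c n * t ^ n) sums \<psi> t"
    using holomorphic_power_series[OF hol, of t] R t by (simp add: c_def)
  then have "(\<lambda>n. c (n + 2) * t ^ (n + 2)) sums (\<psi> t - (\<Sum>n<2. c n * t ^ n))"
    by (rule sums_split_initial_segment)
  then have sums: "(\<lambda>n. c (n + 2) * t ^ (n + 2)) sums (\<psi> t - \<psi> 0 - deriv \<psi> 0 * t)"
    by (simp add: numeral_2_eq_2 c_def diff_diff_eq)
  have geo: "(\<lambda>n. M * (cmod t)\<^sup>2 * cmod t ^ n) sums (M * (cmod t)\<^sup>2 * (1 / (1 - cmod t)))"
    using t by (intro sums_mult geometric_sums) auto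
  have "cmod (c (n + 2) * t ^ (n + 2)) \<le> M * (cmod t)\<^sup>2 * cmod t ^ n" for n
    using mult_right_mono[OF c[of "n + 2"], of "cmod t ^ (n + 2)"]
    by (simp add: norm_mult norm_power power_add power2_eq_square mult_ac)
  then have "cmod (suminf (\<lambda>n. c (n + 2) * t ^ (n + 2))) \<le> suminf (\<lambda>n. M * (cmod t)\<^sup>2 * cmod t ^ n)"
    using sums_summable[OF geo] by (rule norm_suminf_le)
  then have "cmod (\<psi> t - \<psi> 0 - deriv \<psi> 0 * t) \<le> M * (cmod t)\<^sup>2 * (1 / (1 - cmod t))"
    using sums_unique[OF sums] sums_unique[OF geo] by simp
  also have "\<dots> \<le> M * (cmod t)\<^sup>2 * 2"
    using t \<open>0 \<le> M\<close> by (intro mult_left_mono) (auto simp: field_simps)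
  finally show "cmod (\<psi> t - \<psi> 0 - deriv \<psi> 0 * t) \<le> 2 * M * (cmod t)\<^sup>2"
    by (simp add: mult_ac)
qed

lemma norm_complex_vec_scale: "norm (c *s v) = cmod c * norm v" for v :: "complex ^ 'n"
  by (simp add: norm_vec_def L2_set_right_distrib norm_mult)

lemma has_derivative_complex_line:
  fixes p v :: "complex ^ 'n"
  shows "((\<lambda>t. p + t *s v) has_derivative (\<lambda>h. h *s v)) F"
proof -
  have "linear (\<lambda>h. h *s v)"
    by (rule linearI) (simp_all add: vec_eq_iff ring_distribs)
  then have "bounded_linear (\<lambda>h. h *s v)"
    by (simp add: linear_conv_bounded_linear)
  from bounded_linear.has_derivative[OF this has_derivative_ident] show ?thesis
    by (auto intro!: derivative_eq_intros)
qed

lemma has_field_derivative_complex_line: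
  fixes f :: "complex ^ 'n \<Rightarrow> complex"
  assumes "(f has_derivative D) (at (p + t *s v))" and "\<And>c v. D (c *s v) = c * D v"
  shows "((\<lambda>t. f (p + t *s v)) has_field_derivative D v) (at t)"
proof -
  have "((\<lambda>t. f (p + t *s v)) has_derivative (\<lambda>h. D (h *s v))) (at t)"
    using diff_chain_at[OF has_derivative_complex_line assms(1)] by (simp add: o_def)
  moreover have "(\<lambda>h. h * D v) = (*) (D v)" by (simp add: fun_eq_iff)
  ultimately show ?thesis
    by (simp add: assms(2) has_field_derivative_def)
qed

lemma holomorphic_multi_along_line:
  assumes "holomorphic_multi f S" and "\<And>t. t \<in> T \<Longrightarrow> p + t *s v \<in> S"
  shows "(\<lambda>t. f (p + t *s v)) holomorphic_on T"
  unfolding holomorphic_on_def field_differentiable_def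
proof
  fix t assume "t \<in> T"
  then obtain D where "(f has_derivative D) (at (p + t *s v))" "\<And>c v. D (c *s v) = c * D v"
    using assms by (metis holomorphic_multi_def)
  from has_field_derivative_at_within[OF has_field_derivative_complex_line[OF this]]
  show "\<exists>f'. ((\<lambda>t. f (p + t *s v)) has_field_derivative f') (at t within T)" ..
qed

lemma holomorphic_multi_imp_continuous_on: "holomorphic_multi f S \<Longrightarrow> continuous_on S f"
  unfolding holomorphic_multi_def
  by (intro continuous_at_imp_continuous_on ballI) (metis has_derivative_continuous)

text \<open>Restriction to the complex line through \<open>z\<close> in direction \<open>h\<close> reduces the estimates to one variable.
Their right hand sides depend on \<open>\<phi>\<close> only through the factor \<open>M\<close>, which lets them be summed over a family
of functions.\<close>
lemma derivative_bounds_on_ball: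
  fixes \<phi> :: "complex ^ 'n \<Rightarrow> complex"
  assumes hol: "holomorphic_multi \<phi> (ball z \<delta>)" and \<delta>: "0 < \<delta>"
    and bd: "\<And>y. y \<in> ball z \<delta> \<Longrightarrow> cmod (\<phi> y) \<le> M"
    and D: "(\<phi> has_derivative D) (at z)" "\<And>c v. D (c *s v) = c * D v"
  shows "cmod (D h) \<le> M * (2 * norm h / \<delta>)"
    and "norm h \<le> \<delta> / 4 \<Longrightarrow> cmod (\<phi> (z + h) - \<phi> z - D h) \<le> M * (8 * (norm h)\<^sup>2 / \<delta>\<^sup>2)"
proof -
  have "0 \<le> M" using bd[of z] \<delta> norm_ge_zero order_trans by (metis centre_in_ball)
  have "cmod (D h) \<le> M * (2 * norm h / \<delta>) \<and>
    (norm h \<le> \<delta> / 4 \<longrightarrow> cmod (\<phi> (z + h) - \<phi> z - D h) \<le> M * (8 * (norm h)\<^sup>2 / \<delta>\<^sup>2))"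
  proof (cases "h = 0")
    case True
    have "D 0 = 0" using D(2)[of 0 0] by simp
    with True \<open>0 \<le> M\<close> show ?thesis by simp
  next
    case False
    \<comment> \<open>Rescaled so that the unit disc of the parameter stays in the ball of half the radius; then
\<open>|t| \<le> 1/2\<close> says that \<open>h\<close> has norm at most \<open>\<delta> / 4\<close>.\<close>
    define v where "v = complex_of_real (\<delta> / (2 * norm h)) *s h"
    define t where "t = complex_of_real (2 * norm h / \<delta>)"
    define \<psi> where "\<psi> s = \<phi> (z + s *s v)" for s
    have v: "norm v = \<delta> / 2"
      using False \<delta> by (simp add: v_def norm_complex_vec_scale norm_divide norm_mult)
    have th: "t *s v = h"
      using False \<delta> by (simp add: v_def t_def vec_eq_iff)
    have cmod_t: "cmod t = 2 * norm h / \<delta>" using \<delta> by (simp add: t_def norm_divide norm_mult)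
    have inside: "z + s *s v \<in> ball z \<delta>" if "cmod s < 2" for s
    proof -
      have "cmod s * (\<delta> / 2) < 2 * (\<delta> / 2)" using that \<delta> by (intro mult_strict_right_mono) auto
      then show ?thesis by (simp add: dist_norm norm_complex_vec_scale v)
    qed
    have "\<psi> holomorphic_on ball 0 2"
      unfolding \<psi>_def using inside by (intro holomorphic_multi_along_line[OF hol]) simp
    moreover have "cmod (\<psi> s) \<le> M" if "cmod s \<le> 1" for s
      unfolding \<psi>_def using that by (intro bd inside) simp
    moreover have "(\<psi> has_field_derivative D v) (at 0)"
      unfolding \<psi>_def by (rule has_field_derivative_complex_line) (simp_all add: D)
    then have "deriv \<psi> 0 = D v" by (rule DERIV_imp_deriv)
    ultimately have 1: "cmod (D v) \<le> M"
      and 2: "cmod t \<le> 1 / 2 \<Longrightarrow> cmod (\<psi> t - \<psi> 0 - D v * t) \<le> 2 * M * (cmod t)\<^sup>2"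
      using first_order_Taylor_bounded[of \<psi> 2 M] by auto
    have Dh: "D h = D v * t"
      using D(2)[of t v] by (simp add: th mult.commute)
    have "cmod (D h) \<le> M * (2 * norm h / \<delta>)"
      unfolding Dh norm_mult cmod_t using 1 \<delta> by (intro mult_right_mono) auto
    moreover have "cmod (\<phi> (z + h) - \<phi> z - D h) \<le> M * (8 * (norm h)\<^sup>2 / \<delta>\<^sup>2)" if "norm h \<le> \<delta> / 4"
    proof -
      have "cmod t \<le> 1 / 2" using that \<delta> by (simp add: cmod_t field_simps)
      from 2[OF this] show ?thesis
        unfolding cmod_t Dh by (simp add: \<psi>_def th power_divide power_mult_distrib mult_ac)
    qed
    ultimately show ?thesis by blast
  qed
  then show "cmod (D h) \<le> M * (2 * norm h / \<delta>)"
    and "norm h \<le> \<delta> / 4 \<Longrightarrow> cmod (\<phi> (z + h) - \<phi> z - D h) \<le> M * (8 * (norm h)\<^sup>2 / \<delta>\<^sup>2)"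
    by auto
qed

lemma dominated_summable_on:
  fixes f :: "'i \<Rightarrow> complex"
  assumes "M summable_on A" "\<And>x. x \<in> A \<Longrightarrow> cmod (f x) \<le> M x"
  shows "f summable_on A"
  by (rule abs_summable_summable, rule summable_on_comparison_test[OF assms]) auto

lemma norm_infsum_dominated:
  fixes f :: "'i \<Rightarrow> complex"
  assumes "M summable_on A" "\<And>x. x \<in> A \<Longrightarrow> cmod (f x) \<le> M x"
  shows "cmod (infsum f A) \<le> infsum M A"
  by (rule norm_infsum_le[OF has_sum_infsum[OF dominated_summable_on[OF assms]]
        has_sum_infsum[OF assms(1)] assms(2)])

lemma has_sum_diff:
  fixes f g :: "'i \<Rightarrow> 'b :: real_normed_vector"
  assumes "(f has_sum a) A" "(g has_sum b) A"
  shows "((\<lambda>x. f x - g x) has_sum (a - b)) A"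
  using has_sum_add[OF assms(1), of "\<lambda>x. - g x" "- b"] assms(2) by (simp add: has_sum_uminus)

text \<open>The derivative of the sum is the sum of the derivatives: the first-order remainders are bounded by
\<open>M \<alpha>\<close> times a common multiple of the squared increment, so their sum is of second order too. No ordering of the
index set is involved.\<close>
lemma holomorphic_multi_infsum:
  fixes \<phi> :: "'i \<Rightarrow> complex ^ 'n \<Rightarrow> complex"
  assumes hol: "\<And>\<alpha>. \<alpha> \<in> A \<Longrightarrow> holomorphic_multi (\<phi> \<alpha>) S"
    and dom: "\<And>z. z \<in> S \<Longrightarrow> \<exists>M \<delta>. 0 < \<delta> \<and> ball z \<delta> \<subseteq> S \<and> M summable_on A \<and>
      (\<forall>\<alpha>\<in>A. \<forall>y\<in>ball z \<delta>. cmod (\<phi> \<alpha> y) \<le> M \<alpha>)"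
  shows "holomorphic_multi (\<lambda>z. \<Sum>\<^sub>\<infinity>\<alpha>\<in>A. \<phi> \<alpha> z) S"
  unfolding holomorphic_multi_def
proof
  fix z assume "z \<in> S"
  then obtain M \<delta> where \<delta>: "0 < \<delta>" "ball z \<delta> \<subseteq> S" and M: "M summable_on A"
    and bd: "\<And>\<alpha> y. \<alpha> \<in> A \<Longrightarrow> y \<in> ball z \<delta> \<Longrightarrow> cmod (\<phi> \<alpha> y) \<le> M \<alpha>"
    using dom by metis
  have "\<forall>\<alpha>\<in>A. \<exists>D. (\<phi> \<alpha> has_derivative D) (at z) \<and> (\<forall>c v. D (c *s v) = c * D v)"
    using hol \<open>z \<in> S\<close> by (auto simp: holomorphic_multi_def)
  then obtain D where D: "\<And>\<alpha>. \<alpha> \<in> A \<Longrightarrow> (\<phi> \<alpha> has_derivative D \<alpha>) (at z)"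
    and Dc: "\<And>\<alpha> c v. \<alpha> \<in> A \<Longrightarrow> D \<alpha> (c *s v) = c * D \<alpha> v"
    by metis
  have hol': "holomorphic_multi (\<phi> \<alpha>) (ball z \<delta>)" if "\<alpha> \<in> A" for \<alpha>
    using hol[OF that] \<delta>(2) by (auto simp: holomorphic_multi_def)
  have bounds: "cmod (D \<alpha> h) \<le> M \<alpha> * (2 * norm h / \<delta>)"
    "norm h \<le> \<delta> / 4 \<Longrightarrow> cmod (\<phi> \<alpha> (z + h) - \<phi> \<alpha> z - D \<alpha> h) \<le> M \<alpha> * (8 * (norm h)\<^sup>2 / \<delta>\<^sup>2)"
    if "\<alpha> \<in> A" for \<alpha> h
    using derivative_bounds_on_ball[OF hol'[OF that] \<delta>(1) bd[OF that] D[OF that] Dc[OF that]] by auto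
  define g where "g y = (\<Sum>\<^sub>\<infinity>\<alpha>\<in>A. \<phi> \<alpha> y)" for y
  define G where "G h = (\<Sum>\<^sub>\<infinity>\<alpha>\<in>A. D \<alpha> h)" for h
  have sum_\<phi>: "(\<lambda>\<alpha>. \<phi> \<alpha> y) summable_on A" if "y \<in> ball z \<delta>" for y
    using bd that by (intro dominated_summable_on[OF M]) auto
  have sum_D: "(\<lambda>\<alpha>. D \<alpha> h) summable_on A" for h
    by (rule dominated_summable_on[OF summable_on_cmult_left[OF M] bounds(1)])
  have G_scale: "G (c *s v) = c * G v" for c v
    unfolding G_def by (subst infsum_cmult_right'[symmetric]) (auto intro!: infsum_cong simp: Dc)
  have lin: "linear G"
  proof (rule linearI)
    show "G (u + v) = G u + G v" for u v
      unfolding G_def infsum_add[OF sum_D sum_D, symmetric]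
      by (intro infsum_cong linear_add has_derivative_linear[OF D])
    show "G (r *\<^sub>R v) = r *\<^sub>R G v" for r v
    proof -
      have "r *\<^sub>R v = complex_of_real r *s v" by (simp add: vec_eq_iff scaleR_conv_of_real[where 'a = complex])
      then show ?thesis using G_scale by (simp add: scaleR_conv_of_real)
    qed
  qed
  have rem: "cmod (g (z + h) - g z - G h) \<le> (infsum M A * 8 / \<delta>\<^sup>2) * (norm h)\<^sup>2" if h: "norm h \<le> \<delta> / 4" for h
  proof -
    have "z + h \<in> ball z \<delta>" using h \<delta>(1) by (simp add: dist_norm)
    note s = sum_\<phi>[OF this] sum_\<phi>[of z]
    have "g (z + h) - g z - G h = (\<Sum>\<^sub>\<infinity>\<alpha>\<in>A. \<phi> \<alpha> (z + h) - \<phi> \<alpha> z - D \<alpha> h)"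
      unfolding g_def G_def using s sum_D[of h] \<delta>(1)
      by (intro infsumI[symmetric] has_sum_diff has_sum_infsum) simp_all
    also have "cmod \<dots> \<le> (\<Sum>\<^sub>\<infinity>\<alpha>\<in>A. M \<alpha> * (8 * (norm h)\<^sup>2 / \<delta>\<^sup>2))"
      by (rule norm_infsum_dominated[OF summable_on_cmult_left[OF M] bounds(2)]) (use h in auto)
    also have "\<dots> = (infsum M A * 8 / \<delta>\<^sup>2) * (norm h)\<^sup>2"
      by (subst infsum_cmult_left') simp
    finally show ?thesis .
  qed
  have "(g has_derivative G) (at z)"
    unfolding has_derivative_at
  proof (intro conjI)
    show "bounded_linear G" using lin by (simp add: linear_conv_bounded_linear)
    show "(\<lambda>h. norm (g (z + h) - g z - G h) / norm h) \<midarrow>0\<rightarrow> 0"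
    proof (rule tendsto_sandwich)
      show "\<forall>\<^sub>F h in at 0. 0 \<le> norm (g (z + h) - g z - G h) / norm h" by simp
      have "\<forall>\<^sub>F h in at 0. norm h \<le> \<delta> / 4"
        unfolding eventually_at using \<delta>(1) by (intro exI[of _ "\<delta> / 4"]) auto
      then show "\<forall>\<^sub>F h in at 0. norm (g (z + h) - g z - G h) / norm h \<le> (infsum M A * 8 / \<delta>\<^sup>2) * norm h"
      proof eventually_elim
        case (elim h)
        from rem[OF elim] show ?case
          by (cases "h = 0") (simp_all add: pos_divide_le_eq power2_eq_square mult.assoc)
      qed
      show "(\<lambda>h. (infsum M A * 8 / \<delta>\<^sup>2) * norm h) \<midarrow>(0 :: complex ^ 'n)\<rightarrow> 0"
        using \<open>0 < \<delta>\<close> by (auto intro!: tendsto_eq_intros)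
    qed simp
  qed
  then show "\<exists>f'. ((\<lambda>z. \<Sum>\<^sub>\<infinity>\<alpha>\<in>A. \<phi> \<alpha> z) has_derivative f') (at z) \<and> (\<forall>c v. f' (c *s v) = c * f' v)"
    unfolding g_def using G_scale by (intro exI[of _ G] conjI allI)
qed

section \<open>The norm of a Laurent series\<close>

lemma holomorphic_multi_mult:
  assumes "holomorphic_multi f S" "holomorphic_multi g S"
  shows "holomorphic_multi (\<lambda>z. f z * g z) S"
  unfolding holomorphic_multi_def
proof
  fix z assume "z \<in> S"
  then obtain D E where D: "(f has_derivative D) (at z)" "\<And>c v. D (c *s v) = c * D v"
    and E: "(g has_derivative E) (at z)" "\<And>c v. E (c *s v) = c * E v"
    using assms by (metis holomorphic_multi_def)
  have "((\<lambda>z. f z * g z) has_derivative (\<lambda>h. f z * E h + D h * g z)) (at z)"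
    by (rule has_derivative_mult[OF D(1) E(1)])
  moreover have "f z * E (c *s v) + D (c *s v) * g z = c * (f z * E v + D v * g z)" for c v
    by (simp add: D(2) E(2) algebra_simps)
  ultimately show "\<exists>f'. ((\<lambda>z. f z * g z) has_derivative f') (at z) \<and> (\<forall>c v. f' (c *s v) = c * f' v)"
    by (intro exI conjI allI)
qed

lemma holomorphic_multi_const: "holomorphic_multi (\<lambda>_. c) S"
  unfolding holomorphic_multi_def by (intro ballI exI[of _ "\<lambda>_. 0"]) simp

lemma holomorphic_multi_prod:
  "(\<And>i. i \<in> I \<Longrightarrow> holomorphic_multi (f i) S) \<Longrightarrow> holomorphic_multi (\<lambda>z. \<Prod>i\<in>I. f i z) S"
  by (induction I rule: infinite_finite_induct)
    (auto intro!: holomorphic_multi_const holomorphic_multi_mult)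

lemma holomorphic_multi_coordinate:
  fixes S :: "(complex ^ 'n) set"
  assumes "\<And>z. z \<in> S \<Longrightarrow> g field_differentiable at (z $ j)"
  shows "holomorphic_multi (\<lambda>z. g (z $ j)) S"
  unfolding holomorphic_multi_def
proof
  fix z assume "z \<in> S"
  then obtain d where "(g has_field_derivative d) (at (z $ j))"
    using assms by (auto simp: field_differentiable_def)
  moreover have "((\<lambda>z. z $ j) has_derivative (\<lambda>h. h $ j)) (at z)"
    by (intro bounded_linear.has_derivative[OF bounded_linear_vec_nth] has_derivative_ident)
  ultimately have "((\<lambda>z. g (z $ j)) has_derivative (\<lambda>h. d * h $ j)) (at z)"
    using has_derivative_compose[of "\<lambda>z. z $ j" "\<lambda>h. h $ j" z UNIV g "(*) d"]
    by (simp add: has_field_derivative_def)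
  then show "\<exists>f'. ((\<lambda>z. g (z $ j)) has_derivative f') (at z) \<and> (\<forall>c v. f' (c *s v) = c * f' v)"
    by (intro exI[of _ "\<lambda>h. d * h $ j"]) simp
qed

lemma hardy_index_min_coord:
  assumes "\<alpha> \<in> hardy_index"
  shows "0 \<le> \<alpha> $ (min_coord :: 'n::{finite,linorder})"
proof -
  have "{k. k \<le> (min_coord :: 'n)} = {min_coord}"
    using le_min_coord_iff by blast
  then show ?thesis
    using assms unfolding hardy_index_def pos_def
    by (auto dest: spec[of _ "min_coord :: 'n"])
qed

lemma holomorphic_multi_monomial:
  fixes \<alpha> :: "int ^ 'n::{finite,linorder}"
  assumes "\<alpha> \<in> hardy_index"
  shows "holomorphic_multi (monomial \<alpha>) hartogs_triangle"
  unfolding monomial_def[abs_def]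
proof (intro holomorphic_multi_prod holomorphic_multi_coordinate)
  fix j and z :: "complex ^ 'n::{finite,linorder}"
  assume z: "z \<in> hartogs_triangle"
  have "0 \<le> \<alpha> $ j \<or> z $ j \<noteq> 0"
    using hardy_index_min_coord[OF assms] hartogs_triangle_coord_pos[OF z, of j]
    by (cases "j = min_coord") auto
  from DERIV_power_int[OF DERIV_ident this]
  show "(\<lambda>w. w powi (\<alpha> $ j)) field_differentiable at (z $ j)"
    unfolding field_differentiable_def by (rule exI)
qed

lemma hardy_series_dominated:
  fixes a :: "int ^ 'n::{finite,linorder} \<Rightarrow> complex"
  assumes a: "\<And>\<alpha>. \<alpha> \<in> hardy_index \<Longrightarrow> cmod (a \<alpha>) \<le> B" and z: "z \<in> hartogs_triangle"
  shows "\<exists>M \<delta>. 0 < \<delta> \<and> ball z \<delta> \<subseteq> hartogs_triangle \<and> M summable_on hardy_index \<and>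
      (\<forall>\<alpha>\<in>hardy_index. \<forall>y\<in>ball z \<delta>. cmod (a \<alpha> * monomial \<alpha> y) \<le> M \<alpha>)"
proof -
  obtain M \<delta> where M: "0 < \<delta>" "ball z \<delta> \<subseteq> hartogs_triangle" "M summable_on hardy_index"
    "\<And>\<alpha> y. \<alpha> \<in> hardy_index \<Longrightarrow> y \<in> ball z \<delta> \<Longrightarrow> cmod (monomial \<alpha> y) \<le> M \<alpha>"
    using monomials_dominated[OF z] by metis
  have "cmod (a \<alpha> * monomial \<alpha> y) \<le> B * M \<alpha>" if "\<alpha> \<in> hardy_index" "y \<in> ball z \<delta>" for \<alpha> y
    unfolding norm_mult
    by (intro mult_mono a M(4) that order_trans[OF norm_ge_zero a[OF that(1)]] norm_ge_zero)
  then show ?thesis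
    using M(1,2) summable_on_cmult_right[OF M(3), of B]
    by (intro exI[of _ "\<lambda>\<alpha>. B * M \<alpha>"] exI[of _ \<delta>]) blast
qed

text \<open>The extension by zero off the triangle is the representation of functions used for the Hardy space.\<close>
definition hardy_series :: "(int ^ 'n::{finite,linorder} \<Rightarrow> complex) \<Rightarrow> complex ^ 'n::{finite,linorder} \<Rightarrow> complex" where
  "hardy_series a z = (if z \<in> hartogs_triangle then \<Sum>\<^sub>\<infinity>\<alpha>\<in>hardy_index. a \<alpha> * monomial \<alpha> z else 0)"

lemma laurent_series_hardy_series:
  assumes a: "\<And>\<alpha>. \<alpha> \<in> hardy_index \<Longrightarrow> cmod (a \<alpha>) \<le> B"
  shows "laurent_series a (hardy_series a)"
  unfolding laurent_series_def
proof
  fix z :: "complex ^ 'a::{finite,linorder}"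
  assume z: "z \<in> hartogs_triangle"
  obtain M \<delta> where "0 < \<delta>" "M summable_on hardy_index"
      "\<forall>\<alpha>\<in>hardy_index. \<forall>y\<in>ball z \<delta>. cmod (a \<alpha> * monomial \<alpha> y) \<le> M \<alpha>"
    using hardy_series_dominated[where a = a, OF a z] by metis
  then have "(\<lambda>\<alpha>. a \<alpha> * monomial \<alpha> z) summable_on hardy_index"
    by (intro dominated_summable_on[of M]) auto
  then show "((\<lambda>\<alpha>. a \<alpha> * monomial \<alpha> z) has_sum hardy_series a z) hardy_index"
    using z by (simp add: hardy_series_def)
qed

lemma holomorphic_multi_cong:
  assumes S: "open S" and f: "holomorphic_multi f S" and eq: "\<And>z. z \<in> S \<Longrightarrow> g z = f z"
  shows "holomorphic_multi g S"
  unfolding holomorphic_multi_def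
proof
  fix z assume z: "z \<in> S"
  then obtain D where D: "(f has_derivative D) (at z)" "\<forall>c v. D (c *s v) = c * D v"
    using f by (auto simp: holomorphic_multi_def)
  have "(g has_derivative D) (at z)"
    by (rule has_derivative_transform_within_open[OF D(1) S z]) (simp add: eq)
  with D(2) show "\<exists>f'. (g has_derivative f') (at z) \<and> (\<forall>c v. f' (c *s v) = c * f' v)" by blast
qed

lemma holomorphic_multi_hardy_series:
  fixes a :: "int ^ 'n::{finite,linorder} \<Rightarrow> complex"
  assumes a: "\<And>\<alpha>. \<alpha> \<in> hardy_index \<Longrightarrow> cmod (a \<alpha>) \<le> B"
  shows "holomorphic_multi (hardy_series a) hartogs_triangle"
proof (rule holomorphic_multi_cong[OF open_hartogs_triangle holomorphic_multi_infsum])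
  show "holomorphic_multi (\<lambda>z. a \<alpha> * monomial \<alpha> z) hartogs_triangle" if "\<alpha> \<in> hardy_index" for \<alpha>
    by (intro holomorphic_multi_mult holomorphic_multi_const holomorphic_multi_monomial that)
qed (simp_all add: hardy_series_def hardy_series_dominated[where a = a, OF a])

lemma laurent_series_eq:
  assumes "laurent_series a f" "z \<in> hartogs_triangle"
  shows "f z = hardy_series a z"
  using assms by (auto simp: laurent_series_def hardy_series_def dest!: bspec intro: infsumI[symmetric])

lemma square_summable_bounded:
  assumes "(\<lambda>\<alpha>. (cmod (a \<alpha>))\<^sup>2) summable_on A" "\<alpha> \<in> A"
  shows "cmod (a \<alpha>) \<le> sqrt (\<Sum>\<^sub>\<infinity>\<alpha>\<in>A. (cmod (a \<alpha>))\<^sup>2)"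
proof -
  have "(\<Sum>\<alpha>\<in>{\<alpha>}. (cmod (a \<alpha>))\<^sup>2) \<le> (\<Sum>\<^sub>\<infinity>\<alpha>\<in>A. (cmod (a \<alpha>))\<^sup>2)"
    using assms by (intro finite_sum_le_infsum) auto
  then show ?thesis by (simp add: real_le_rsqrt)
qed

text \<open>Termwise integration against a continuous \<open>\<psi>\<close>, by the Weierstrass test.\<close>
lemma has_sum_integral_torus:
  fixes \<phi> \<psi> :: "complex ^ 'n \<Rightarrow> complex"
  assumes \<phi>: "\<And>\<zeta>. \<zeta> \<in> torus \<Longrightarrow> ((\<lambda>\<alpha>. b \<alpha> * monomial \<alpha> \<zeta>) has_sum \<phi> \<zeta>) A"
    and b: "(\<lambda>\<alpha>. cmod (b \<alpha>)) summable_on A"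
    and \<phi>_cont: "continuous_on torus \<phi>" and \<psi>: "continuous_on torus \<psi>"
  shows "((\<lambda>\<alpha>. b \<alpha> * (LINT \<zeta>|torus_measure. monomial \<alpha> \<zeta> * \<psi> \<zeta>)) has_sum
      (LINT \<zeta>|torus_measure. \<phi> \<zeta> * \<psi> \<zeta>)) A"
proof -
  obtain B where B: "\<And>\<zeta>. \<zeta> \<in> torus \<Longrightarrow> cmod (\<psi> \<zeta>) \<le> B" "0 < B"
    using compact_imp_bounded[OF compact_continuous_image[OF \<psi> compact_torus]]
    by (auto simp: bounded_pos)
  have unif: "uniform_limit torus (\<lambda>F \<zeta>. \<Sum>\<alpha>\<in>F. b \<alpha> * monomial \<alpha> \<zeta>) \<phi> (finite_subsets_at_top A)"
    by (rule Weierstrass_m_test_general'[OF _ \<phi> b]) (simp_all add: norm_mult norm_monomial_torus)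
  have sum_eq: "(LINT \<zeta>|torus_measure. (\<Sum>\<alpha>\<in>F. b \<alpha> * monomial \<alpha> \<zeta>) * \<psi> \<zeta>) =
      (\<Sum>\<alpha>\<in>F. b \<alpha> * (LINT \<zeta>|torus_measure. monomial \<alpha> \<zeta> * \<psi> \<zeta>))" for F
    unfolding sum_distrib_right mult.assoc
    by (subst Bochner_Integration.integral_sum)
      (auto intro!: integrable_torusI continuous_intros continuous_on_monomial_torus \<psi>)
  have "((\<lambda>F. LINT \<zeta>|torus_measure. (\<Sum>\<alpha>\<in>F. b \<alpha> * monomial \<alpha> \<zeta>) * \<psi> \<zeta>) \<longlongrightarrow>
      (LINT \<zeta>|torus_measure. \<phi> \<zeta> * \<psi> \<zeta>)) (finite_subsets_at_top A)"
  proof (rule tendstoI)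
    fix e :: real assume "0 < e"
    then have "0 < e / (2 * B)" using B(2) by simp
    from uniform_limitD[OF unif this]
    show "\<forall>\<^sub>F F in finite_subsets_at_top A. dist (LINT \<zeta>|torus_measure. (\<Sum>\<alpha>\<in>F. b \<alpha> * monomial \<alpha> \<zeta>) * \<psi> \<zeta>)
        (LINT \<zeta>|torus_measure. \<phi> \<zeta> * \<psi> \<zeta>) < e"
    proof eventually_elim
      case (elim F)
      let ?S = "\<lambda>\<zeta>. \<Sum>\<alpha>\<in>F. b \<alpha> * monomial \<alpha> \<zeta>"
      have S: "continuous_on torus ?S" by (intro continuous_intros continuous_on_monomial_torus)
      have "cmod (LINT \<zeta>|torus_measure. (?S \<zeta> - \<phi> \<zeta>) * \<psi> \<zeta>) \<le> e / (2 * B) * B"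
      proof (rule norm_integral_torus_le)
        show "continuous_on torus (\<lambda>\<zeta>. (?S \<zeta> - \<phi> \<zeta>) * \<psi> \<zeta>)"
          by (intro continuous_on_mult continuous_on_diff S \<phi>_cont \<psi>)
        show "cmod ((?S \<zeta> - \<phi> \<zeta>) * \<psi> \<zeta>) \<le> e / (2 * B) * B" if "\<zeta> \<in> torus" for \<zeta>
          unfolding norm_mult using elim that B \<open>0 < e\<close>
          by (intro mult_mono) (auto simp: dist_norm intro: less_imp_le)
      qed
      also have "(LINT \<zeta>|torus_measure. (?S \<zeta> - \<phi> \<zeta>) * \<psi> \<zeta>) =
          (LINT \<zeta>|torus_measure. ?S \<zeta> * \<psi> \<zeta>) - (LINT \<zeta>|torus_measure. \<phi> \<zeta> * \<psi> \<zeta>)"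
        unfolding left_diff_distrib
        by (intro Bochner_Integration.integral_diff integrable_torusI continuous_on_mult S \<phi>_cont \<psi>)
      finally show ?case
        using B(2) \<open>0 < e\<close> by (simp add: dist_norm)
    qed
  qed
  then show ?thesis unfolding has_sum_def sum_eq .
qed

lemma Fourier_coefficient_of_series:
  fixes \<phi> :: "complex ^ 'n \<Rightarrow> complex"
  assumes \<phi>: "\<And>\<zeta>. \<zeta> \<in> torus \<Longrightarrow> ((\<lambda>\<alpha>. b \<alpha> * monomial \<alpha> \<zeta>) has_sum \<phi> \<zeta>) A"
    and b: "(\<lambda>\<alpha>. cmod (b \<alpha>)) summable_on A"
    and \<phi>_cont: "continuous_on torus \<phi>"
  shows "(LINT \<zeta>|torus_measure. \<phi> \<zeta> * monomial (- \<beta>) \<zeta>) = (if \<beta> \<in> A then b \<beta> else 0)"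
proof (rule has_sum_unique[OF has_sum_integral_torus[OF \<phi> b \<phi>_cont continuous_on_monomial_torus]])
  show "((\<lambda>\<alpha>. b \<alpha> * (LINT \<zeta>|torus_measure. monomial \<alpha> \<zeta> * monomial (- \<beta>) \<zeta>)) has_sum
      (if \<beta> \<in> A then b \<beta> else 0)) A"
    by (rule has_sum_finite_neutralI[of "if \<beta> \<in> A then {\<beta>} else {}"])
      (auto simp: inner_monomial_torus split: if_splits)
qed

text \<open>Integrate the series termwise against the conjugate of its own sum.\<close>
lemma Parseval_series:
  fixes \<phi> :: "complex ^ 'n \<Rightarrow> complex"
  assumes \<phi>: "\<And>\<zeta>. \<zeta> \<in> torus \<Longrightarrow> ((\<lambda>\<alpha>. b \<alpha> * monomial \<alpha> \<zeta>) has_sum \<phi> \<zeta>) A"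
    and b: "(\<lambda>\<alpha>. cmod (b \<alpha>)) summable_on A"
    and \<phi>_cont: "continuous_on torus \<phi>"
  shows "((\<lambda>\<alpha>. (cmod (b \<alpha>))\<^sup>2) has_sum (LINT \<zeta>|torus_measure. (cmod (\<phi> \<zeta>))\<^sup>2)) A"
proof -
  have "(LINT \<zeta>|torus_measure. monomial \<alpha> \<zeta> * cnj (\<phi> \<zeta>)) = cnj (b \<alpha>)" if "\<alpha> \<in> A" for \<alpha>
  proof -
    have "(LINT \<zeta>|torus_measure. monomial \<alpha> \<zeta> * cnj (\<phi> \<zeta>)) =
        (LINT \<zeta>|torus_measure. cnj (\<phi> \<zeta> * monomial (- \<alpha>) \<zeta>))"
      by (intro Bochner_Integration.integral_cong refl) (simp add: cnj_monomial_torus mult.commute)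
    also have "\<dots> = cnj (LINT \<zeta>|torus_measure. \<phi> \<zeta> * monomial (- \<alpha>) \<zeta>)"
      by (rule Bochner_Integration.integral_cnj)
    finally show ?thesis
      using Fourier_coefficient_of_series[OF \<phi> b \<phi>_cont, of \<alpha>] that by simp
  qed
  then have "((\<lambda>\<alpha>. b \<alpha> * cnj (b \<alpha>)) has_sum (LINT \<zeta>|torus_measure. \<phi> \<zeta> * cnj (\<phi> \<zeta>))) A"
    using has_sum_integral_torus[OF \<phi> b \<phi>_cont continuous_on_cnj[OF \<phi>_cont]]
    by (subst has_sum_cong[where g = "\<lambda>\<alpha>. b \<alpha> * (LINT \<zeta>|torus_measure. monomial \<alpha> \<zeta> * cnj (\<phi> \<zeta>))"]) auto
  then have "((\<lambda>\<alpha>. complex_of_real ((cmod (b \<alpha>))\<^sup>2)) has_sum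
      (LINT \<zeta>|torus_measure. complex_of_real ((cmod (\<phi> \<zeta>))\<^sup>2))) A"
    unfolding complex_norm_square .
  then show ?thesis
    unfolding integral_complex_of_real has_sum_of_real_iff .
qed

lemma continuous_on_torus_radial:
  fixes f :: "complex ^ 'n::{finite,linorder} \<Rightarrow> complex"
  assumes f: "continuous_on hartogs_triangle f" and r: "r \<in> unit_box"
  shows "continuous_on torus (\<lambda>\<zeta>. f (radial r * \<zeta>))"
  by (rule continuous_on_compose2[OF f])
    (auto intro!: continuous_intros radial_torus_in_hartogs_triangle r)

lemma hardy_mean_eq:
  fixes f :: "complex ^ 'n::{finite,linorder} \<Rightarrow> complex"
  assumes f: "continuous_on hartogs_triangle f" and r: "r \<in> unit_box"
  shows "hardy_mean f r = ennreal ((LINT \<zeta>|torus_measure. (cmod (f (radial r * \<zeta>)))\<^sup>2) *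
      (\<Prod>j\<in>UNIV. (r $ j) ^ (2 * pos j - 1)))"
proof -
  define c where "c = (2 * pi) ^ CARD('n)"
  let ?w = "\<Prod>j\<in>UNIV. (r $ j) ^ (2 * pos j - 1)"
  let ?B = "cbox 0 (\<chi> j. 2 * pi) :: (real ^ 'n::{finite,linorder}) set"
  define \<phi> where "\<phi> \<zeta> = (cmod (f (radial r * \<zeta>)))\<^sup>2" for \<zeta>
  have c: "0 < c" by (simp add: c_def)
  have w: "0 \<le> ?w" using unit_box_pos[OF r] by (intro prod_nonneg) (simp add: less_imp_le)
  have \<phi>: "continuous_on torus \<phi>"
    unfolding \<phi>_def by (intro continuous_intros continuous_on_torus_radial f r)
  have meas: "(\<lambda>\<theta>. ennreal (\<phi> (torus_point \<theta>))) \<in> borel_measurable borel"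
    using measurable_compose[OF measurable_torus_point borel_measurable_continuous_on_restrict[OF \<phi>]] by simp
  have "hardy_mean f r = (\<integral>\<^sup>+\<theta>. ennreal (?w / c) * (ennreal (\<phi> (torus_point \<theta>)) * indicator ?B \<theta>) \<partial>lborel)"
  proof -
    have "ennreal (x * ?w / c) = ennreal (?w / c) * ennreal x" for x
      by (subst ennreal_mult'[symmetric]) (use w c in \<open>auto simp: mult.commute\<close>)
    then show ?thesis
      unfolding hardy_mean_def polar_point_eq \<phi>_def c_def[symmetric] by (simp only: mult.assoc)
  qed
  also have "\<dots> = ennreal (?w / c) * (\<integral>\<^sup>+\<theta>\<in>?B. ennreal (\<phi> (torus_point \<theta>)) \<partial>lborel)"
    using meas by (intro nn_integral_cmult) simp
  also have "\<dots> = ennreal ?w * ((\<integral>\<^sup>+\<theta>\<in>?B. ennreal (\<phi> (torus_point \<theta>)) \<partial>lborel) / ennreal c)"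
    using w c by (simp add: divide_ennreal_def inverse_ennreal divide_inverse ennreal_mult mult_ac)
  also have "(\<integral>\<^sup>+\<theta>\<in>?B. ennreal (\<phi> (torus_point \<theta>)) \<partial>lborel) / ennreal c = (\<integral>\<^sup>+\<zeta>. ennreal (\<phi> \<zeta>) \<partial>torus_measure)"
    using measurable_torusI[OF \<phi>] unfolding c_def by (intro nn_integral_torus[symmetric]) simp
  also have "\<dots> = ennreal (LINT \<zeta>|torus_measure. \<phi> \<zeta>)"
    by (intro nn_integral_eq_integral integrable_torusI \<phi>) (simp add: \<phi>_def)
  finally show ?thesis
    using w by (simp add: ennreal_mult'' \<phi>_def mult.commute)
qed

text \<open>Evaluate at radii all equal to \<open>x\<close> and let \<open>x\<close> tend to 1 from below: every exponent is positive, so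
the weights tend to 1. Only a lower bound for the means is assumed, so that the lemma applies both to
Parseval's identity for series and to Bessel's inequality for arbitrary holomorphic functions.\<close>
lemma hardy_norm_sq_ge:
  fixes f :: "complex ^ 'n::{finite,linorder} \<Rightarrow> complex"
  assumes "finite F" "F \<subseteq> hardy_index"
    and mean: "\<And>r. r \<in> unit_box \<Longrightarrow>
      ennreal (\<Sum>\<alpha>\<in>F. (cmod (a \<alpha>))\<^sup>2 * (\<Prod>j\<in>UNIV. r $ j ^ (2 * polydisc_degree \<alpha> j + 1))) \<le> hardy_mean f r"
  shows "ennreal (\<Sum>\<alpha>\<in>F. (cmod (a \<alpha>))\<^sup>2) \<le> hardy_norm_sq f"
proof (rule tendsto_upperbound)
  let ?g = "\<lambda>x. \<Sum>\<alpha>\<in>F. (cmod (a \<alpha>))\<^sup>2 * (\<Prod>j\<in>UNIV. x ^ (2 * polydisc_degree \<alpha> j + 1))"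
  have "(?g \<longlongrightarrow> (\<Sum>\<alpha>\<in>F. (cmod (a \<alpha>))\<^sup>2 * (\<Prod>j\<in>(UNIV :: 'n set). 1 ^ (2 * polydisc_degree \<alpha> j + 1)))) (at_left 1)"
    by (intro tendsto_intros)
  then show "((\<lambda>x. ennreal (?g x)) \<longlongrightarrow> ennreal (\<Sum>\<alpha>\<in>F. (cmod (a \<alpha>))\<^sup>2)) (at_left 1)"
    by (simp add: tendsto_ennrealI)
  have "\<forall>\<^sub>F x in at_left (1 :: real). x \<in> {0<..<1}"
    by (rule eventually_at_left_real) simp
  then show "\<forall>\<^sub>F x in at_left 1. ennreal (?g x) \<le> hardy_norm_sq f"
  proof eventually_elim
    case (elim x)
    then have box: "(\<chi> j. x) \<in> (unit_box :: (real ^ 'n::{finite,linorder}) set)" by (simp add: unit_box_def)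
    have "ennreal (?g x) \<le> hardy_mean f (\<chi> j. x)"
      using mean[OF box] by simp
    also have "\<dots> \<le> hardy_norm_sq f"
      unfolding hardy_norm_sq_def using box by (intro SUP_upper) (simp add: unit_box_def)
    finally show ?case .
  qed
qed simp

lemma hardy_mean_series:
  fixes f :: "complex ^ 'n::{finite,linorder} \<Rightarrow> complex"
  assumes f: "laurent_series a f" and a: "\<And>\<alpha>. \<alpha> \<in> hardy_index \<Longrightarrow> cmod (a \<alpha>) \<le> B"
    and r: "r \<in> unit_box"
  obtains s where "hardy_mean f r = ennreal s"
    "((\<lambda>\<alpha>. (cmod (a \<alpha>))\<^sup>2 * (\<Prod>j\<in>UNIV. r $ j ^ (2 * polydisc_degree \<alpha> j + 1))) has_sum s) hardy_index"
proof
  have cont: "continuous_on hartogs_triangle f"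
    using holomorphic_multi_imp_continuous_on[OF holomorphic_multi_hardy_series[where a = a, OF a]] laurent_series_eq[OF f]
    by (simp cong: continuous_on_cong)
  have "1 \<in> (torus :: (complex ^ 'n::{finite,linorder}) set)" by (simp add: torus_def)
  then have "radial r * 1 \<in> hartogs_triangle" by (rule radial_torus_in_hartogs_triangle[OF r])
  then have z: "radial r \<in> hartogs_triangle" by simp
  obtain M \<delta> where M: "0 < \<delta>" "M summable_on hardy_index"
      "\<forall>\<alpha>\<in>hardy_index. \<forall>y\<in>ball (radial r) \<delta>. cmod (a \<alpha> * monomial \<alpha> y) \<le> M \<alpha>"
    using hardy_series_dominated[where a = a, OF a z] by metis
  have "((\<lambda>\<alpha>. (cmod (a \<alpha> * monomial \<alpha> (radial r)))\<^sup>2) has_sum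
      (LINT \<zeta>|torus_measure. (cmod (f (radial r * \<zeta>)))\<^sup>2)) hardy_index"
  proof (rule Parseval_series)
    show "((\<lambda>\<alpha>. a \<alpha> * monomial \<alpha> (radial r) * monomial \<alpha> \<zeta>) has_sum f (radial r * \<zeta>)) hardy_index"
      if "\<zeta> \<in> torus" for \<zeta>
      using bspec[OF f[unfolded laurent_series_def] radial_torus_in_hartogs_triangle[OF r that]]
      by (simp add: monomial_mult mult.assoc)
    show "(\<lambda>\<alpha>. cmod (a \<alpha> * monomial \<alpha> (radial r))) summable_on hardy_index"
      by (rule summable_on_comparison_test[OF M(2)]) (use M in auto)
    show "continuous_on torus (\<lambda>\<zeta>. f (radial r * \<zeta>))"
      by (rule continuous_on_torus_radial[OF cont r])
  qed
  then have *: "((\<lambda>\<alpha>. (cmod (a \<alpha> * monomial \<alpha> (radial r)))\<^sup>2 * (\<Prod>j\<in>UNIV. (r $ j) ^ (2 * pos j - 1))) has_sum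
      (LINT \<zeta>|torus_measure. (cmod (f (radial r * \<zeta>)))\<^sup>2) * (\<Prod>j\<in>UNIV. (r $ j) ^ (2 * pos j - 1))) hardy_index"
    by (rule has_sum_cmult_left)
  show "((\<lambda>\<alpha>. (cmod (a \<alpha>))\<^sup>2 * (\<Prod>j\<in>UNIV. r $ j ^ (2 * polydisc_degree \<alpha> j + 1))) has_sum
    (LINT \<zeta>|torus_measure. (cmod (f (radial r * \<zeta>)))\<^sup>2) * (\<Prod>j\<in>UNIV. (r $ j) ^ (2 * pos j - 1))) hardy_index"
    by (rule has_sum_cong[THEN iffD1, OF _ *])
      (simp only: norm_mult power_mult_distrib mult.assoc norm_monomial_radial_weight_index[OF r])
  show "hardy_mean f r = ennreal ((LINT \<zeta>|torus_measure. (cmod (f (radial r * \<zeta>)))\<^sup>2) *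
    (\<Prod>j\<in>UNIV. (r $ j) ^ (2 * pos j - 1)))"
    by (rule hardy_mean_eq[OF cont r])
qed

text \<open>All weights \<open>\<Prod>\<^sub>j r\<^sub>j\<^bsup>2 d\<^sub>j + 1\<^esup>\<close> are at most 1, which bounds every mean from above; the lower bound comes
from the limit of all radii at 1.\<close>
lemma hardy_norm_sq_laurent_series:
  fixes f :: "complex ^ 'n::{finite,linorder} \<Rightarrow> complex"
  assumes f: "laurent_series a f" and a: "(\<lambda>\<alpha>. (cmod (a \<alpha>))\<^sup>2) summable_on hardy_index"
  shows "hardy_norm_sq f = ennreal (\<Sum>\<^sub>\<infinity>\<alpha>\<in>hardy_index. (cmod (a \<alpha>))\<^sup>2)"
proof (rule antisym)
  let ?c = "\<lambda>r \<alpha>. \<Prod>j\<in>UNIV. r $ j ^ (2 * polydisc_degree \<alpha> j + 1)"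
  have c: "0 \<le> ?c r \<alpha>" "?c r \<alpha> \<le> 1" if "r \<in> unit_box" for r \<alpha>
    using that by (auto simp: unit_box_def less_imp_le intro!: prod_nonneg prod_le_1 mult_le_one power_le_one)
  have "hardy_mean f r \<le> ennreal (\<Sum>\<^sub>\<infinity>\<alpha>\<in>hardy_index. (cmod (a \<alpha>))\<^sup>2)" if r: "r \<in> unit_box" for r
  proof -
    obtain s where s: "hardy_mean f r = ennreal s" "((\<lambda>\<alpha>. (cmod (a \<alpha>))\<^sup>2 * ?c r \<alpha>) has_sum s) hardy_index"
      by (rule hardy_mean_series[OF f _ r]) (rule square_summable_bounded[OF a])
    have "s \<le> (\<Sum>\<^sub>\<infinity>\<alpha>\<in>hardy_index. (cmod (a \<alpha>))\<^sup>2)"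
      by (rule has_sum_mono[OF s(2) has_sum_infsum[OF a]]) (intro mult_left_le c[OF r] zero_le_power2)
    then show ?thesis by (simp add: s(1) ennreal_leI)
  qed
  then show "hardy_norm_sq f \<le> ennreal (\<Sum>\<^sub>\<infinity>\<alpha>\<in>hardy_index. (cmod (a \<alpha>))\<^sup>2)"
    unfolding hardy_norm_sq_def by (intro SUP_least) (simp add: unit_box_def)
  show "ennreal (\<Sum>\<^sub>\<infinity>\<alpha>\<in>hardy_index. (cmod (a \<alpha>))\<^sup>2) \<le> hardy_norm_sq f"
  proof (rule tendsto_upperbound[OF tendsto_ennrealI])
    show "((\<lambda>F. \<Sum>\<alpha>\<in>F. (cmod (a \<alpha>))\<^sup>2) \<longlongrightarrow> (\<Sum>\<^sub>\<infinity>\<alpha>\<in>hardy_index. (cmod (a \<alpha>))\<^sup>2)) (finite_subsets_at_top hardy_index)"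
      using has_sum_infsum[OF a] by (simp only: has_sum_def)
    have "ennreal (\<Sum>\<alpha>\<in>F. (cmod (a \<alpha>))\<^sup>2) \<le> hardy_norm_sq f" if F: "finite F" "F \<subseteq> hardy_index" for F
    proof (rule hardy_norm_sq_ge[OF F])
      fix r :: "real ^ 'n::{finite,linorder}" assume r: "r \<in> unit_box"
      obtain s where s: "hardy_mean f r = ennreal s" "((\<lambda>\<alpha>. (cmod (a \<alpha>))\<^sup>2 * ?c r \<alpha>) has_sum s) hardy_index"
        by (rule hardy_mean_series[OF f _ r]) (rule square_summable_bounded[OF a])
      have "(\<Sum>\<alpha>\<in>F. (cmod (a \<alpha>))\<^sup>2 * ?c r \<alpha>) \<le> s"
        by (rule finite_sum_le_has_sum[OF s(2) F]) (intro mult_nonneg_nonneg c(1)[OF r] zero_le_power2)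
      then show "ennreal (\<Sum>\<alpha>\<in>F. (cmod (a \<alpha>))\<^sup>2 * ?c r \<alpha>) \<le> hardy_mean f r"
        unfolding s(1) by (rule ennreal_leI)
    qed
    then show "\<forall>\<^sub>F F in finite_subsets_at_top hardy_index. ennreal (\<Sum>\<alpha>\<in>F. (cmod (a \<alpha>))\<^sup>2) \<le> hardy_norm_sq f"
      by (intro eventually_finite_subsets_at_top_weakI)
  qed simp
qed

section \<open>Laurent expansion in the Hardy space\<close>

text \<open>Pull back by the exponential: \<open>H \<circ> exp\<close> is holomorphic on a half plane and so has a primitive \<open>P\<close> there.
The increment of \<open>P\<close> over a period does not depend on the base point, because its derivative vanishes,
and it is \<open>\<i>\<close> times the integral over the circle.\<close>
lemma circle_integral_radius_independent:
  assumes hol: "H holomorphic_on {z. 0 < cmod z \<and> cmod z < R}"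
    and "0 < s" "s < R" "0 < s'" "s' < R"
  shows "integral {0..2 * pi} (\<lambda>t. H (of_real s * cis t)) = integral {0..2 * pi} (\<lambda>t. H (of_real s' * cis t))"
proof -
  let ?S = "{w. Re w < ln R}"
  have "0 < R" using assms by linarith
  have S: "convex ?S" "open ?S"
    by (auto simp: convex_halfspace_Re_lt open_halfspace_Re_lt)
  have "(\<lambda>w. H (exp w)) holomorphic_on ?S"
  proof (rule holomorphic_on_compose_gen[OF _ hol, unfolded o_def])
    show "exp ` ?S \<subseteq> {z. 0 < cmod z \<and> cmod z < R}"
    proof clarify
      fix w :: complex assume "Re w < ln R"
      then have "exp (Re w) < exp (ln R)" by simp
      then show "0 < cmod (exp w) \<and> cmod (exp w) < R" using \<open>0 < R\<close> by simp
    qed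
  qed (rule holomorphic_on_exp)
  then obtain P where P: "\<And>w. w \<in> ?S \<Longrightarrow> (P has_field_derivative H (exp w)) (at w within ?S)"
    using holomorphic_convex_primitive'[OF S] by blast
  have P': "(P has_field_derivative H (exp w)) (at w)" if "w \<in> ?S" for w
    using P[OF that] at_within_open[OF that S(2)] by simp
  define Q where "Q w = P (w + 2 * pi * \<i>) - P w" for w
  have "(Q has_field_derivative 0) (at w within ?S)" if "w \<in> ?S" for w
  proof -
    have "w + 2 * pi * \<i> \<in> ?S" using that by simp
    have period: "exp (complex_of_real (2 * pi) * \<i>) = 1"
      unfolding of_real_mult of_real_numeral by (rule exp_two_pi_i)
    from P'[OF \<open>w + 2 * pi * \<i> \<in> ?S\<close>, unfolded DERIV_shift]
    have "((\<lambda>w. P (w + 2 * pi * \<i>)) has_field_derivative H (exp w)) (at w)"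
      by (simp only: exp_add period mult_1_right)
    from DERIV_diff[OF this P'[OF that]] show ?thesis
      unfolding Q_def by (simp add: has_field_derivative_at_within)
  qed
  then obtain C where C: "\<And>w. w \<in> ?S \<Longrightarrow> Q w = C"
    using has_field_derivative_zero_constant[OF S(1), of Q] by blast
  have "((\<lambda>t. H (of_real s * cis t)) has_integral C / \<i>) {0..2 * pi}" if s: "0 < s" "s < R" for s
  proof -
    have lns: "of_real (ln s) + \<i> * of_real t \<in> ?S" for t
      using s \<open>0 < R\<close> by simp
    have exp: "exp (of_real (ln s) + \<i> * of_real t) = of_real s * cis t" for t
      using s by (simp add: exp_add cis_conv_exp exp_of_real)
    have "((\<lambda>t. P (of_real (ln s) + \<i> * of_real t)) has_vector_derivative \<i> * H (of_real s * cis t)) (at t)" for t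
    proof -
      have "((\<lambda>t. of_real (ln s) + \<i> * of_real t) has_vector_derivative \<i>) (at t)"
        by (auto intro!: derivative_eq_intros)
      from field_vector_diff_chain_at[OF this P'[OF lns]] show ?thesis
        by (simp add: exp o_def)
    qed
    note primitive = has_vector_derivative_at_within[OF this]
    have "((\<lambda>t. \<i> * H (of_real s * cis t)) has_integral
        P (of_real (ln s) + \<i> * of_real (2 * pi)) - P (of_real (ln s) + \<i> * of_real 0)) {0..2 * pi}"
      by (rule fundamental_theorem_of_calculus[OF _ primitive]) simp
    also have "P (of_real (ln s) + \<i> * of_real (2 * pi)) - P (of_real (ln s) + \<i> * of_real 0) = C"
    proof -
      have "complex_of_real (ln s) + \<i> * of_real (2 * pi) = of_real (ln s) + \<i> * of_real 0 + 2 * pi * \<i>"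
        by simp
      then show ?thesis using C[OF lns[of 0]] unfolding Q_def by (simp only:)
    qed
    finally have "((\<lambda>t. 1 / \<i> * (\<i> * H (of_real s * cis t))) has_integral 1 / \<i> * C) {0..2 * pi}"
      by (rule has_integral_mult_right)
    then show ?thesis by (simp flip: mult.assoc)
  qed
  from this[OF assms(2,3)] this[OF assms(4,5)] show ?thesis
    by (metis integral_unique)
qed

lemma integral_torus_box:
  fixes \<phi> :: "complex ^ 'n \<Rightarrow> complex"
  assumes \<phi>: "continuous_on torus \<phi>"
  shows "(LINT \<zeta>|torus_measure. \<phi> \<zeta>) = integral (cbox 0 (\<chi> j. 2 * pi)) (\<lambda>\<theta>. \<phi> (torus_point \<theta>)) /\<^sub>R (2 * pi) ^ CARD('n)"
proof -
  have cont: "continuous_on (cbox 0 (\<chi> j. 2 * pi)) (\<lambda>\<theta>. \<phi> (torus_point \<theta>))"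
    by (rule continuous_on_compose2[OF \<phi> continuous_on_torus_point])
      (auto simp: torus_point_in_torus)
  have "set_integrable lborel (cbox 0 (\<chi> j. 2 * pi)) (\<lambda>\<theta>. \<phi> (torus_point \<theta>))"
    unfolding set_integrable_def
    using borel_integrable_compact[OF compact_cbox cont] by (simp add: indicator_scaleR_eq_if)
  then show ?thesis
    by (simp add: integral_torus[OF \<phi>] set_borel_integral_eq_integral)
qed

text \<open>Multiplication by this vector multiplies the polydisc coordinate \<open>w\<^sub>j\<close> by \<open>c\<close> and fixes all the other
ones.\<close>
definition head_scale :: "'n::{finite,linorder} \<Rightarrow> complex \<Rightarrow> complex ^ 'n::{finite,linorder}" where
  "head_scale j c = (\<chi> k. if k \<le> j then c else 1)"

lemma head_scale_mult: "head_scale j (c * d) = head_scale j c * head_scale j d"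
  by (simp add: head_scale_def vec_eq_iff)

lemma head_scale_torus: "cmod c = 1 \<Longrightarrow> head_scale j c \<in> torus"
  by (simp add: head_scale_def torus_def)

lemma continuous_on_head_scale [continuous_intros]:
  fixes g :: "'b :: topological_space \<Rightarrow> complex"
  assumes "continuous_on S g"
  shows "continuous_on S (\<lambda>x. head_scale j (g x))"
  unfolding head_scale_def
proof (rule continuous_on_vec_lambda)
  show "continuous_on S (\<lambda>x. if k \<le> j then g x else 1)" for k
    using assms by (cases "k \<le> j") simp_all
qed

definition set_coord :: "real ^ 'n \<Rightarrow> 'n \<Rightarrow> real \<Rightarrow> real ^ 'n" where
  "set_coord r j y = (\<chi> i. if i = j then y else r $ i)"

lemma set_coord_unit_box: "r \<in> unit_box \<Longrightarrow> 0 < y \<Longrightarrow> y < 1 \<Longrightarrow> set_coord r j y \<in> unit_box"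
  by (simp add: unit_box_def set_coord_def)

lemma radial_set_coord: "radial (set_coord r j y) = head_scale j (of_real y) * radial (set_coord r j 1)"
proof -
  have "(\<Prod>i | k \<le> i. set_coord r j y $ i) = (if k \<le> j then y else 1) * (\<Prod>i | k \<le> i. set_coord r j 1 $ i)" for k
  proof (cases "k \<le> j")
    case True
    then have "(\<Prod>i | k \<le> i. set_coord r j x $ i) = set_coord r j x $ j * (\<Prod>i\<in>{i. k \<le> i} - {j}. set_coord r j x $ i)" for x
      by (intro prod.remove) auto
    also have "set_coord r j x $ j * (\<Prod>i\<in>{i. k \<le> i} - {j}. set_coord r j x $ i) = x * (\<Prod>i\<in>{i. k \<le> i} - {j}. r $ i)" for x
      by (intro arg_cong2[where f = times] prod.cong) (auto simp: set_coord_def)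
    finally have "(\<Prod>i | k \<le> i. set_coord r j x $ i) = x * (\<Prod>i\<in>{i. k \<le> i} - {j}. r $ i)" for x .
    then show ?thesis using True by simp
  next
    case False
    then have "set_coord r j y $ i = set_coord r j 1 $ i" if "k \<le> i" for i
      using that by (auto simp: set_coord_def)
    then show ?thesis using False by simp
  qed
  then show ?thesis
    by (simp add: radial_def head_scale_def vec_eq_iff)
qed

text \<open>The torus average of \<open>f z z\<^bsup>-\<alpha>\<^esup>\<close>, which is the Fourier coefficient of \<open>f\<close> on the torus of radii \<open>r\<close>
divided by the value of the monomial at these radii.\<close>
definition laurent_coeff ::
  "(complex ^ 'n::{finite,linorder} \<Rightarrow> complex) \<Rightarrow> int ^ 'n::{finite,linorder} \<Rightarrow> real ^ 'n::{finite,linorder} \<Rightarrow> complex" where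
  "laurent_coeff f \<alpha> r = (LINT \<zeta>|torus_measure. f (radial r * \<zeta>) * monomial (- \<alpha>) (radial r * \<zeta>))"

text \<open>Write \<open>h z = f z z\<^bsup>-\<alpha>\<^esup>\<close>. Since the measure is invariant under rotations, the average of \<open>h\<close> over the
torus can be replaced by the average over the torus and over one additional circle, acting on the
coordinates up to \<open>j\<close>. Performing the circle integral first leaves an integral of a holomorphic function of one
variable on a punctured disc, which does not depend on the radius.\<close>
lemma laurent_coeff_set_coord:
  fixes f :: "complex ^ 'n::{finite,linorder} \<Rightarrow> complex"
  assumes f: "holomorphic_multi f hartogs_triangle" and r: "r \<in> unit_box"
    and y: "0 < y" "y < 1" "0 < y'" "y' < 1"
  shows "laurent_coeff f \<alpha> (set_coord r j y) = laurent_coeff f \<alpha> (set_coord r j y')"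
proof -
  let ?T = "{z :: complex ^ 'n::{finite,linorder}. z \<in> hartogs_triangle \<and> (\<forall>k. z $ k \<noteq> 0)}"
  let ?B = "cbox 0 (\<chi> j. 2 * pi) :: (real ^ 'n::{finite,linorder}) set"
  define h where "h z = f z * monomial (- \<alpha>) z" for z
  define w where "w = radial (set_coord r j 1)"
  have h: "continuous_on ?T h"
    unfolding h_def
    by (intro continuous_on_mult continuous_on_monomial
        continuous_on_subset[OF holomorphic_multi_imp_continuous_on[OF f]]) auto
  have in_T: "head_scale j c * (w * \<zeta>) \<in> ?T" if c: "0 < cmod c" "cmod c < 1" and \<zeta>: "\<zeta> \<in> torus" for c \<zeta>
  proof -
    have "c = of_real (cmod c) * cis (Arg c)" using rcis_cmod_Arg[of c] by (simp add: rcis_def)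
    then have "head_scale j c * (w * \<zeta>) =
        head_scale j (of_real (cmod c)) * w * (head_scale j (cis (Arg c)) * \<zeta>)"
      using head_scale_mult[of j "of_real (cmod c)" "cis (Arg c)"] by (simp only: mult_ac)
    also have "\<dots> = radial (set_coord r j (cmod c)) * (head_scale j (cis (Arg c)) * \<zeta>)"
      unfolding w_def radial_set_coord[of r j "cmod c"] ..
    finally have eq: "head_scale j c * (w * \<zeta>) = radial (set_coord r j (cmod c)) * (head_scale j (cis (Arg c)) * \<zeta>)" .
    have box: "set_coord r j (cmod c) \<in> unit_box" by (rule set_coord_unit_box[OF r c])
    have tor: "head_scale j (cis (Arg c)) * \<zeta> \<in> torus" by (intro torus_mult head_scale_torus \<zeta>) simp
    show ?thesis
      unfolding eq using radial_torus_in_hartogs_triangle[OF box tor] radial_nonzero[OF box] torus_nonzero[OF tor]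
      by simp
  qed
  have rot: "laurent_coeff f \<alpha> (set_coord r j x) = (LINT \<zeta>|torus_measure. h (head_scale j (of_real x * cis t) * (w * \<zeta>)))"
    if x: "0 < x" "x < 1" for x t
  proof -
    have cont: "continuous_on torus (\<lambda>\<zeta>. h (head_scale j (of_real x) * (w * \<zeta>)))"
      by (rule continuous_on_compose2[OF h]) (use in_T[of "of_real x"] x in \<open>auto intro!: continuous_intros\<close>)
    have "laurent_coeff f \<alpha> (set_coord r j x) = (LINT \<zeta>|torus_measure. h (head_scale j (of_real x) * (w * \<zeta>)))"
      unfolding laurent_coeff_def h_def w_def radial_set_coord[of r j x] mult.assoc ..
    also have "\<dots> = (LINT \<zeta>|torus_measure. h (head_scale j (of_real x) * (w * (head_scale j (cis t) * \<zeta>))))"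
      by (rule integral_torus_rotate[symmetric, OF cont]) (simp add: head_scale_torus)
    finally show ?thesis by (simp add: head_scale_mult mult_ac)
  qed
  define J where "J \<theta> x = integral {0..2 * pi} (\<lambda>t. h (head_scale j (of_real x * cis t) * (w * torus_point \<theta>)))" for \<theta> x
  have "(2 * pi) *\<^sub>R laurent_coeff f \<alpha> (set_coord r j x) = integral ?B (\<lambda>\<theta>. J \<theta> x) /\<^sub>R (2 * pi) ^ CARD('n)"
    if x: "0 < x" "x < 1" for x
  proof -
    let ?g = "\<lambda>\<theta> t. h (head_scale j (of_real x * cis t) * (w * torus_point \<theta>))"
    have tp: "continuous_on S (\<lambda>p. torus_point (fst p))" for S :: "((real ^ 'n::{finite,linorder}) \<times> real) set"
      by (intro continuous_on_compose2[OF continuous_on_torus_point[of UNIV]] continuous_intros) auto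
    have in_T': "head_scale j (of_real x * cis t) * (w * \<zeta>) \<in> ?T" if "\<zeta> \<in> torus" for t \<zeta>
      using x that by (intro in_T) (simp_all add: norm_mult)
    have cont: "continuous_on (cbox (0, 0) ((\<chi> j. 2 * pi) :: real ^ 'n::{finite,linorder}, 2 * pi)) (\<lambda>(\<theta>, t). ?g \<theta> t)"
      unfolding case_prod_beta
    proof (rule continuous_on_compose2[OF h])
      show "continuous_on S (\<lambda>p. head_scale j (of_real x * cis (snd p)) * (w * torus_point (fst p)))"
        for S :: "((real ^ 'n::{finite,linorder}) \<times> real) set"
        by (intro continuous_intros tp)
    qed (intro image_subsetI in_T'[OF torus_point_in_torus])
    have cont': "continuous_on torus (\<lambda>\<zeta>. h (head_scale j (of_real x * cis t) * (w * \<zeta>)))" for t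
      by (rule continuous_on_compose2[OF h]) (use in_T' in \<open>auto intro!: continuous_intros\<close>)
    have "(2 * pi) *\<^sub>R laurent_coeff f \<alpha> (set_coord r j x) = integral (cbox 0 (2 * pi)) (\<lambda>t. laurent_coeff f \<alpha> (set_coord r j x))"
      by simp
    also have "\<dots> = integral (cbox 0 (2 * pi)) (\<lambda>t. integral ?B (\<lambda>\<theta>. ?g \<theta> t) /\<^sub>R (2 * pi) ^ CARD('n))"
      using rot[OF x] integral_torus_box[OF cont'] by (intro integral_cong) metis
    also have "\<dots> = integral (cbox 0 (2 * pi)) (\<lambda>t. integral ?B (\<lambda>\<theta>. ?g \<theta> t)) /\<^sub>R (2 * pi) ^ CARD('n)"
      by (rule integral_cmul)
    also have "integral (cbox 0 (2 * pi)) (\<lambda>t. integral ?B (\<lambda>\<theta>. ?g \<theta> t)) = integral ?B (\<lambda>\<theta>. J \<theta> x)"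
      using integral_swap_continuous[OF cont] by (simp add: J_def)
    finally show ?thesis .
  qed
  moreover have "J \<theta> y = J \<theta> y'" for \<theta>
    unfolding J_def
  proof (rule circle_integral_radius_independent[OF _ y])
    define u where "u = w * torus_point \<theta>"
    \<comment> \<open>Scaling the coordinates up to \<open>j\<close> moves along a complex line.\<close>
    define p where "p = (\<chi> k. if k \<le> j then 0 else u $ k)"
    define v where "v = (\<chi> k. if k \<le> j then u $ k else 0)"
    have line: "head_scale j c * u = p + c *s v" for c
      by (simp add: head_scale_def p_def v_def vec_eq_iff)
    have hol_f: "(\<lambda>c. f (head_scale j c * u)) holomorphic_on {c. 0 < cmod c \<and> cmod c < 1}"
      unfolding line
      by (rule holomorphic_multi_along_line[OF f])
        (use in_T[OF _ _ torus_point_in_torus] in \<open>auto simp flip: line simp: u_def\<close>)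
    have "(\<lambda>c. monomial (- \<alpha>) (head_scale j c)) holomorphic_on {c. 0 < cmod c \<and> cmod c < 1}"
      unfolding monomial_def head_scale_def
    proof (intro holomorphic_on_prod)
      fix k
      show "(\<lambda>c. (\<chi> k. if k \<le> j then c else 1) $ k powi ((- \<alpha>) $ k)) holomorphic_on {c. 0 < cmod c \<and> cmod c < 1}"
        by (cases "k \<le> j") (auto intro!: holomorphic_intros)
    qed
    from holomorphic_on_mult[OF hol_f holomorphic_on_mult[OF this holomorphic_on_const[of "monomial (- \<alpha>) u"]]]
    show "(\<lambda>c. h (head_scale j c * (w * torus_point \<theta>))) holomorphic_on {c. 0 < cmod c \<and> cmod c < 1}"
      by (simp add: h_def monomial_mult u_def)
  qed
  ultimately have "(2 * pi) *\<^sub>R laurent_coeff f \<alpha> (set_coord r j y) = (2 * pi) *\<^sub>R laurent_coeff f \<alpha> (set_coord r j y')"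
    using y by simp
  then show ?thesis by simp
qed

lemma laurent_coeff_const:
  fixes f :: "complex ^ 'n::{finite,linorder} \<Rightarrow> complex"
  assumes f: "holomorphic_multi f hartogs_triangle" and r: "r \<in> unit_box" "r' \<in> unit_box"
  shows "laurent_coeff f \<alpha> r = laurent_coeff f \<alpha> r'"
proof -
  \<comment> \<open>Change the radii one coordinate at a time.\<close>
  define mix where "mix A = (\<chi> i. if i \<in> A then r' $ i else r $ i)" for A
  have box: "mix A \<in> unit_box" for A
    using r by (simp add: mix_def unit_box_def)
  have "laurent_coeff f \<alpha> (mix A) = laurent_coeff f \<alpha> r" for A
  proof (induction A rule: finite_induct[OF finite])
    case 1
    then show ?case by (simp add: mix_def)
  next
    case (2 j A)
    have "mix (insert j A) = set_coord (mix A) j (r' $ j)" "mix A = set_coord (mix A) j (r $ j)"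
      using 2 by (auto simp: mix_def set_coord_def vec_eq_iff)
    moreover have "laurent_coeff f \<alpha> (set_coord (mix A) j (r' $ j)) = laurent_coeff f \<alpha> (set_coord (mix A) j (r $ j))"
      using r by (intro laurent_coeff_set_coord f box) (simp_all add: unit_box_def)
    ultimately show ?case using 2 by simp
  qed
  from this[of UNIV] show ?thesis by (simp add: mix_def)
qed

text \<open>Expand the non-negative integral of \<open>|\<phi> - p|\<^sup>2\<close>, where \<open>p\<close> is the partial Fourier sum.\<close>
lemma Bessel_inequality_torus:
  fixes \<phi> :: "complex ^ 'n \<Rightarrow> complex"
  assumes \<phi>: "continuous_on torus \<phi>" and F: "finite F"
    and c: "\<And>\<alpha>. c \<alpha> = (LINT \<zeta>|torus_measure. \<phi> \<zeta> * monomial (- \<alpha>) \<zeta>)"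
  shows "(\<Sum>\<alpha>\<in>F. (cmod (c \<alpha>))\<^sup>2) \<le> (LINT \<zeta>|torus_measure. (cmod (\<phi> \<zeta>))\<^sup>2)"
proof -
  let ?S = "\<Sum>\<alpha>\<in>F. (cmod (c \<alpha>))\<^sup>2"
  define p where "p \<zeta> = (\<Sum>\<alpha>\<in>F. c \<alpha> * monomial \<alpha> \<zeta>)" for \<zeta>
  have p: "continuous_on torus p"
    unfolding p_def by (intro continuous_intros continuous_on_monomial_torus)
  have "((\<lambda>\<alpha>. (cmod (c \<alpha>))\<^sup>2) has_sum (LINT \<zeta>|torus_measure. (cmod (p \<zeta>))\<^sup>2)) F"
    by (rule Parseval_series[OF _ _ p]) (use F in \<open>auto simp: p_def has_sum_finite\<close>)
  then have pp: "(LINT \<zeta>|torus_measure. (cmod (p \<zeta>))\<^sup>2) = ?S"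
    using has_sum_finite[OF F] has_sum_unique by blast
  have "(LINT \<zeta>|torus_measure. \<phi> \<zeta> * cnj (p \<zeta>)) =
      (LINT \<zeta>|torus_measure. (\<Sum>\<alpha>\<in>F. cnj (c \<alpha>) * (\<phi> \<zeta> * monomial (- \<alpha>) \<zeta>)))"
    by (intro Bochner_Integration.integral_cong refl)
      (simp add: p_def cnj_monomial_torus sum_distrib_left mult_ac)
  also have "\<dots> = (\<Sum>\<alpha>\<in>F. cnj (c \<alpha>) * c \<alpha>)"
    by (subst Bochner_Integration.integral_sum)
      (auto simp: c intro!: integrable_torusI continuous_intros continuous_on_monomial_torus \<phi>)
  also have "\<dots> = complex_of_real ?S"
    by (simp add: complex_norm_square mult.commute del: of_real_power)
  finally have \<phi>p: "(LINT \<zeta>|torus_measure. Re (\<phi> \<zeta> * cnj (p \<zeta>))) = ?S"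
    by (subst integral_Re) (auto intro!: integrable_torusI continuous_intros \<phi> p)
  have eq: "(cmod (\<phi> \<zeta> - p \<zeta>))\<^sup>2 = (cmod (\<phi> \<zeta>))\<^sup>2 - 2 * Re (\<phi> \<zeta> * cnj (p \<zeta>)) + (cmod (p \<zeta>))\<^sup>2" for \<zeta>
    by (simp only: cmod_power2) (simp add: power2_eq_square algebra_simps)
  have "0 \<le> (LINT \<zeta>|torus_measure. (cmod (\<phi> \<zeta> - p \<zeta>))\<^sup>2)"
    by (rule integral_nonneg_AE) simp
  also have "\<dots> = (LINT \<zeta>|torus_measure. (cmod (\<phi> \<zeta>))\<^sup>2) - 2 * (LINT \<zeta>|torus_measure. Re (\<phi> \<zeta> * cnj (p \<zeta>)))
      + (LINT \<zeta>|torus_measure. (cmod (p \<zeta>))\<^sup>2)"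
  proof -
    have 1: "integrable torus_measure (\<lambda>\<zeta>. (cmod (\<phi> \<zeta>))\<^sup>2)" "integrable torus_measure (\<lambda>\<zeta>. (cmod (p \<zeta>))\<^sup>2)"
      "integrable torus_measure (\<lambda>\<zeta>. 2 * Re (\<phi> \<zeta> * cnj (p \<zeta>)))"
      by (intro integrable_torusI continuous_intros \<phi> p)+
    show ?thesis
      unfolding eq Bochner_Integration.integral_add[OF Bochner_Integration.integrable_diff[OF 1(1,3)] 1(2)]
        Bochner_Integration.integral_diff[OF 1(1,3)] integral_mult_right_zero ..
  qed
  finally show ?thesis
    unfolding pp \<phi>p by simp
qed

text \<open>The points of the triangle off the coordinate hyperplanes are covered by the tori of radii in the
open unit box.\<close>
lemma hartogs_triangle_polar:
  fixes z :: "complex ^ 'n::{finite,linorder}"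
  assumes z: "z \<in> hartogs_triangle" and nz: "\<And>k. z $ k \<noteq> 0"
  obtains r \<zeta> where "r \<in> unit_box" "\<zeta> \<in> torus" "z = radial r * \<zeta>"
proof -
  obtain q \<delta> where q: "0 < q" "q < 1" "0 < \<delta>"
    "\<And>y i j. y \<in> ball z \<delta> \<Longrightarrow> i < j \<Longrightarrow> cmod (y $ i) < q * cmod (y $ j)"
    "\<And>y j. y \<in> ball z \<delta> \<Longrightarrow> cmod (y $ j) < q"
    using hartogs_triangle_neighbourhood[OF z] by metis
  have zb: "z \<in> ball z \<delta>" using q(3) by simp
  have pos: "0 < cmod (z $ k)" for k using nz by simp
  obtain r where r: "\<And>j. 0 \<le> r j" "\<And>j. r j \<le> q" "\<And>j. j \<noteq> min_coord \<Longrightarrow> 0 < r j"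
    "\<And>k. cmod (z $ k) = (\<Prod>j | k \<le> j. r j)"
    using tail_product_representation[of "\<lambda>k. cmod (z $ k)" q, OF norm_ge_zero pos
        less_imp_le[OF q(4)[OF zb]] less_imp_le[OF q(5)[OF zb]]] by blast
  have r0: "0 \<noteq> r j" for j
  proof
    assume "0 = r j"
    then have "(\<Prod>i | j \<le> i. r i) = 0" by (intro prod_zero bexI[of _ j]) simp_all
    with pos[of j] r(4)[of j] show False by simp
  qed
  have "(\<chi> j. r j) \<in> unit_box"
    using le_less_trans[OF r(2) q(2)] le_neq_trans[OF r(1) r0] by (simp add: unit_box_def)
  moreover have "(\<chi> k. sgn (z $ k)) \<in> torus"
    using nz by (simp add: torus_def norm_sgn)
  moreover have "z = radial (\<chi> j. r j) * (\<chi> k. sgn (z $ k))"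
  proof -
    have "z $ k = complex_of_real (\<Prod>j | k \<le> j. r j) * sgn (z $ k)" for k
      unfolding r(4)[symmetric] using nz[of k] by (simp add: sgn_eq)
    then show ?thesis by (simp add: vec_eq_iff radial_def)
  qed
  ultimately show ?thesis by (rule that)
qed

lemma Fourier_coefficient_radial:
  fixes f :: "complex ^ 'n::{finite,linorder} \<Rightarrow> complex"
  assumes r: "r \<in> unit_box"
  shows "(LINT \<zeta>|torus_measure. f (radial r * \<zeta>) * monomial (- \<alpha>) \<zeta>) =
    laurent_coeff f \<alpha> r * monomial \<alpha> (radial r)"
proof -
  have 1: "monomial (- \<alpha>) (radial r) * monomial \<alpha> (radial r) = 1"
    using monomial_add[of "radial r" "- \<alpha>" \<alpha>] radial_nonzero[OF r] by simp
  have "laurent_coeff f \<alpha> r = monomial (- \<alpha>) (radial r) *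
      (LINT \<zeta>|torus_measure. f (radial r * \<zeta>) * monomial (- \<alpha>) \<zeta>)"
    unfolding laurent_coeff_def integral_mult_right_zero[symmetric]
    by (simp add: monomial_mult mult_ac)
  then show ?thesis using 1 by (simp add: mult_ac)
qed

lemma laurent_coeff_Bessel:
  fixes f :: "complex ^ 'n::{finite,linorder} \<Rightarrow> complex"
  assumes f: "holomorphic_multi f hartogs_triangle" and r: "r \<in> unit_box" and F: "finite F"
  shows "ennreal (\<Sum>\<alpha>\<in>F. (cmod (laurent_coeff f \<alpha> r))\<^sup>2 *
      (\<Prod>j\<in>UNIV. r $ j powi (2 * (\<Sum>k | k \<le> j. \<alpha> $ k) + 2 * int (pos j) - 1))) \<le> hardy_mean f r"
proof -
  let ?w = "\<Prod>j\<in>UNIV. (r $ j) ^ (2 * pos j - 1)"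
  note cont = holomorphic_multi_imp_continuous_on[OF f]
  have "0 \<le> ?w" using unit_box_pos[OF r] by (intro prod_nonneg) (simp add: less_imp_le)
  have "(\<Sum>\<alpha>\<in>F. (cmod (laurent_coeff f \<alpha> r * monomial \<alpha> (radial r)))\<^sup>2) \<le>
      (LINT \<zeta>|torus_measure. (cmod (f (radial r * \<zeta>)))\<^sup>2)"
    by (rule Bessel_inequality_torus[OF continuous_on_torus_radial[OF cont r] F])
      (rule Fourier_coefficient_radial[OF r, symmetric])
  from mult_right_mono[OF this \<open>0 \<le> ?w\<close>] show ?thesis
    unfolding hardy_mean_eq[OF cont r]
    by (intro ennreal_leI)
      (simp only: sum_distrib_right norm_mult power_mult_distrib mult.assoc norm_monomial_radial_weight[OF r])
qed

lemma hardy_mean_le_norm_sq: "r \<in> unit_box \<Longrightarrow> hardy_mean f r \<le> hardy_norm_sq f"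
  unfolding hardy_norm_sq_def by (intro SUP_upper) (simp add: unit_box_def)

text \<open>For an index outside \<open>hardy_index\<close> some exponent of the weighted monomial is at most \<open>-1\<close>. When the
corresponding radius \<open>x\<close> tends to 0, the weighted square of the monomial grows at least like \<open>1 / x\<close>, while
Bessel's inequality keeps its product with the squared coefficient bounded.\<close>
lemma laurent_coeff_eq_0:
  fixes f :: "complex ^ 'n::{finite,linorder} \<Rightarrow> complex"
  assumes f: "holomorphic_multi f hartogs_triangle" and fin: "hardy_norm_sq f < \<infinity>"
    and \<alpha>: "\<alpha> \<notin> hardy_index" and r: "r \<in> unit_box"
  shows "laurent_coeff f \<alpha> r = 0"
proof (rule ccontr)
  define N where "N = enn2real (hardy_norm_sq f)"
  have N: "hardy_norm_sq f = ennreal N" "0 \<le> N"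
    using fin by (simp_all add: N_def ennreal_enn2real_if infinity_ennreal_def less_top)
  define e where "e j = 2 * (\<Sum>k | k \<le> j. \<alpha> $ k) + 2 * int (pos j) - 1" for j
  obtain k where "(\<Sum>j | j \<le> k. \<alpha> $ j) + int (pos k) - 1 < 0"
    using \<alpha> unfolding hardy_index_def mem_Collect_eq not_all not_le by blast
  then have k: "e k \<le> -1" by (simp add: e_def)
  define C where "C = (\<Prod>j\<in>UNIV - {k}. (1 / 2 :: real) powi e j)"
  define D where "D = (cmod (laurent_coeff f \<alpha> r))\<^sup>2 * C"
  assume "laurent_coeff f \<alpha> r \<noteq> 0"
  moreover have "0 < C" unfolding C_def by (intro prod_pos) simp
  ultimately have "0 < D" by (simp add: D_def)
  have le: "D \<le> N * x" if x: "0 < x" "x < 1" for x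
  proof -
    define R where "R = set_coord (\<chi> j. 1 / 2) k x"
    have R: "R \<in> unit_box"
      unfolding R_def by (rule set_coord_unit_box) (use x in \<open>simp_all add: unit_box_def\<close>)
    have "(\<Prod>j\<in>UNIV. R $ j powi e j) = R $ k powi e k * (\<Prod>j\<in>UNIV - {k}. R $ j powi e j)"
      by (rule prod.remove) simp_all
    also have "(\<Prod>j\<in>UNIV - {k}. R $ j powi e j) = C"
      unfolding C_def by (intro prod.cong) (auto simp: R_def set_coord_def)
    also have "R $ k = x" by (simp add: R_def set_coord_def)
    finally have prod: "(\<Prod>j\<in>UNIV. R $ j powi e j) = x powi e k * C" .
    have "ennreal (\<Sum>\<alpha>\<in>{\<alpha>}. (cmod (laurent_coeff f \<alpha> R))\<^sup>2 *
        (\<Prod>j\<in>UNIV. R $ j powi (2 * (\<Sum>k | k \<le> j. \<alpha> $ k) + 2 * int (pos j) - 1))) \<le> ennreal N"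
      using order_trans[OF laurent_coeff_Bessel[OF f R] hardy_mean_le_norm_sq[OF R]] unfolding N(1) by blast
    then have "(cmod (laurent_coeff f \<alpha> R))\<^sup>2 * (x powi e k * C) \<le> N"
      using N(2) by (simp add: e_def[symmetric] prod)
    then have "D * x powi e k \<le> N"
      by (simp add: D_def laurent_coeff_const[OF f R r] mult_ac)
    moreover have "1 / x \<le> x powi e k"
      using power_int_decreasing[OF k, of x] x by (simp add: power_int_minus divide_inverse)
    then have "D * (1 / x) \<le> D * x powi e k"
      using \<open>0 < D\<close> by (intro mult_left_mono) simp_all
    ultimately have "D * (1 / x) \<le> N" by linarith
    then show ?thesis using x by (simp add: field_simps)
  qed
  \<comment> \<open>A value in the unit interval with \<open>N x < D\<close>.\<close>
  define x where "x = D / (D + N + 1)"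
  have x: "0 < x" "x < 1" using \<open>0 < D\<close> N(2) by (simp_all add: x_def)
  have "N * x < (D + N + 1) * x" using x \<open>0 < D\<close> by (intro mult_strict_right_mono) simp_all
  also have "\<dots> = D" using \<open>0 < D\<close> N(2) by (simp add: x_def)
  finally show False using le[OF x] by simp
qed

text \<open>The coefficients are square summable by Bessel's inequality, so their Laurent series defines a
holomorphic \<open>g\<close>. On each torus \<open>f\<close> and \<open>g\<close> have the same Fourier coefficients, hence they agree at all
points with non-zero coordinates, and by continuity also where the first coordinate vanishes.\<close>
lemma laurent_expansion:
  fixes f :: "complex ^ 'n::{finite,linorder} \<Rightarrow> complex"
  assumes f: "holomorphic_multi f hartogs_triangle" and fin: "hardy_norm_sq f < \<infinity>"
  obtains a where "(\<lambda>\<alpha>. (cmod (a \<alpha>))\<^sup>2) summable_on hardy_index" "laurent_series a f"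
proof -
  define r0 where "r0 = (\<chi> j. 1 / 2 :: real ^ 'n::{finite,linorder})"
  have r0: "r0 \<in> unit_box" by (simp add: r0_def unit_box_def)
  define a where "a \<alpha> = laurent_coeff f \<alpha> r0" for \<alpha>
  have a: "laurent_coeff f \<alpha> r = a \<alpha>" if "r \<in> unit_box" for \<alpha> r
    unfolding a_def by (rule laurent_coeff_const[OF f that r0])
  have a0: "a \<alpha> = 0" if "\<alpha> \<notin> hardy_index" for \<alpha>
    unfolding a_def by (rule laurent_coeff_eq_0[OF f fin that r0])
  have bound: "ennreal (\<Sum>\<alpha>\<in>F. (cmod (a \<alpha>))\<^sup>2) \<le> hardy_norm_sq f"
    if F: "finite F" "F \<subseteq> hardy_index" for F
  proof (rule hardy_norm_sq_ge[OF F])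
    fix r :: "real ^ 'n::{finite,linorder}" assume r: "r \<in> unit_box"
    have exponent: "2 * (\<Sum>k | k \<le> j. \<alpha> $ k) + 2 * int (pos j) - 1 = int (2 * polydisc_degree \<alpha> j + 1)"
      if "\<alpha> \<in> F" for \<alpha> j
      using polydisc_degree_hardy_index[of \<alpha> j] F(2) that by auto
    have "(\<Sum>\<alpha>\<in>F. (cmod (a \<alpha>))\<^sup>2 * (\<Prod>j\<in>UNIV. r $ j ^ (2 * polydisc_degree \<alpha> j + 1))) =
        (\<Sum>\<alpha>\<in>F. (cmod (laurent_coeff f \<alpha> r))\<^sup>2 *
        (\<Prod>j\<in>UNIV. r $ j powi (2 * (\<Sum>k | k \<le> j. \<alpha> $ k) + 2 * int (pos j) - 1)))"
      by (intro sum.cong refl) (simp only: a[OF r] exponent power_int_of_nat)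
    then show "ennreal (\<Sum>\<alpha>\<in>F. (cmod (a \<alpha>))\<^sup>2 * (\<Prod>j\<in>UNIV. r $ j ^ (2 * polydisc_degree \<alpha> j + 1))) \<le> hardy_mean f r"
      using laurent_coeff_Bessel[OF f r F(1)] by simp
  qed
  have summable: "(\<lambda>\<alpha>. (cmod (a \<alpha>))\<^sup>2) summable_on hardy_index"
  proof (rule nonneg_bdd_above_summable_on)
    have "(\<Sum>\<alpha>\<in>F. (cmod (a \<alpha>))\<^sup>2) \<le> enn2real (hardy_norm_sq f)" if "finite F" "F \<subseteq> hardy_index" for F
      using enn2real_mono[OF bound[OF that]] fin by (simp add: sum_nonneg less_top)
    then show "bdd_above (sum (\<lambda>\<alpha>. (cmod (a \<alpha>))\<^sup>2) ` {F. F \<subseteq> hardy_index \<and> finite F})"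
      by (intro bdd_aboveI2[where M = "enn2real (hardy_norm_sq f)"]) simp
  qed simp
  define g where "g = hardy_series a"
  have g_series: "laurent_series a g"
    unfolding g_def by (rule laurent_series_hardy_series) (rule square_summable_bounded[OF summable])
  have g: "holomorphic_multi g hartogs_triangle"
    unfolding g_def by (rule holomorphic_multi_hardy_series) (rule square_summable_bounded[OF summable])
  note cont = holomorphic_multi_imp_continuous_on[OF f] holomorphic_multi_imp_continuous_on[OF g]
  have eq: "f z = g z" if z: "z \<in> hartogs_triangle" "\<And>k. z $ k \<noteq> 0" for z :: "complex ^ 'n::{finite,linorder}"
  proof -
    obtain r \<zeta> where r: "r \<in> unit_box" and \<zeta>: "\<zeta> \<in> torus" and z_eq: "z = radial r * \<zeta>"
      using hartogs_triangle_polar[OF z] .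
    have "radial r * 1 \<in> hartogs_triangle"
      by (rule radial_torus_in_hartogs_triangle[OF r]) (simp add: torus_def)
    then have rad: "radial r \<in> hartogs_triangle" by simp
    obtain M \<delta> where M: "0 < \<delta>" "M summable_on hardy_index"
      "\<forall>\<alpha>\<in>hardy_index. \<forall>y\<in>ball (radial r) \<delta>. cmod (a \<alpha> * monomial \<alpha> y) \<le> M \<alpha>"
      using hardy_series_dominated[where a = a, OF square_summable_bounded[where a = a, OF summable] rad] by metis
    have contr: "continuous_on torus (\<lambda>\<zeta>. f (radial r * \<zeta>))" "continuous_on torus (\<lambda>\<zeta>. g (radial r * \<zeta>))"
      by (intro continuous_on_torus_radial cont r)+
    have "(LINT \<zeta>|torus_measure. (f (radial r * \<zeta>) - g (radial r * \<zeta>)) * monomial (- \<alpha>) \<zeta>) = 0" for \<alpha>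
    proof -
      have "(LINT \<zeta>|torus_measure. g (radial r * \<zeta>) * monomial (- \<alpha>) \<zeta>) =
          (if \<alpha> \<in> hardy_index then a \<alpha> * monomial \<alpha> (radial r) else 0)"
      proof (rule Fourier_coefficient_of_series[OF _ _ contr(2)])
        show "((\<lambda>\<alpha>. a \<alpha> * monomial \<alpha> (radial r) * monomial \<alpha> \<zeta>) has_sum g (radial r * \<zeta>)) hardy_index"
          if "\<zeta> \<in> torus" for \<zeta>
          using bspec[OF g_series[unfolded laurent_series_def] radial_torus_in_hartogs_triangle[OF r that]]
          by (simp add: monomial_mult mult.assoc)
        show "(\<lambda>\<alpha>. cmod (a \<alpha> * monomial \<alpha> (radial r))) summable_on hardy_index"
          by (rule summable_on_comparison_test[OF M(2)]) (use M in auto)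
      qed
      moreover have "(LINT \<zeta>|torus_measure. f (radial r * \<zeta>) * monomial (- \<alpha>) \<zeta>) = a \<alpha> * monomial \<alpha> (radial r)"
        using Fourier_coefficient_radial[OF r] a[OF r] by simp
      ultimately show ?thesis
        unfolding left_diff_distrib
        by (subst Bochner_Integration.integral_diff)
          (auto simp: a0 intro!: integrable_torusI continuous_on_mult contr continuous_on_monomial_torus)
    qed
    then have "f (radial r * \<zeta>) - g (radial r * \<zeta>) = 0"
      by (intro Fourier_coefficients_0_imp_0[of "\<lambda>\<zeta>. f (radial r * \<zeta>) - g (radial r * \<zeta>)", OF _ _ \<zeta>]
          continuous_on_diff contr)
    then show ?thesis by (simp add: z_eq)
  qed
  have "f z = g z" if z: "z \<in> hartogs_triangle" for z :: "complex ^ 'n::{finite,linorder}"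
  proof -
    define d where "d w = f w - g w" for w
    define m where "m = (min_coord :: 'n)"
    \<comment> \<open>Only the first coordinate can vanish; move it off zero.\<close>
    define x where "x n = z + axis m (complex_of_real (if z $ m = 0 then inverse (real (Suc n)) else 0))" for n
    have "(\<lambda>n. if z $ m = 0 then inverse (real (Suc n)) else 0) \<longlonglongrightarrow> 0"
      using LIMSEQ_inverse_real_of_nat by (cases "z $ m = 0") simp_all
    then have lim0: "(\<lambda>n. complex_of_real (if z $ m = 0 then inverse (real (Suc n)) else 0)) \<longlonglongrightarrow> 0"
      by (metis of_real_0 tendsto_of_real)
    have "(\<lambda>n. axis m (complex_of_real (if z $ m = 0 then inverse (real (Suc n)) else 0))) \<longlonglongrightarrow> axis m 0"
      unfolding axis_def
    proof (rule tendsto_vec_lambda)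
      show "(\<lambda>n. if i = m then complex_of_real (if z $ m = 0 then inverse (real (Suc n)) else 0) else 0)
        \<longlonglongrightarrow> (if i = m then 0 else 0)" for i
        using lim0 by (cases "i = m") simp_all
    qed
    then have x_lim: "x \<longlonglongrightarrow> z"
      unfolding x_def using tendsto_add[OF tendsto_const, of _ "axis m 0" sequentially z] by (simp add: axis_def zero_vec_def[symmetric])
    have "\<forall>\<^sub>F n in sequentially. x n \<in> hartogs_triangle"
      using topological_tendstoD[OF x_lim open_hartogs_triangle z] .
    then have ev0: "\<forall>\<^sub>F n in sequentially. d (x n) = 0"
    proof eventually_elim
      case (elim n)
      have "x n $ k \<noteq> 0" for k
      proof (cases "k = m")
        case True
        then show ?thesis by (simp add: x_def axis_def del: of_nat_Suc)
      next
        case False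
        then show ?thesis using hartogs_triangle_coord_pos[OF z, of k] by (simp add: x_def axis_def m_def)
      qed
      then show ?case using eq[OF elim] by (simp add: d_def)
    qed
    have "isCont f z" "isCont g z"
      using cont z by (simp_all add: continuous_on_eq_continuous_at[OF open_hartogs_triangle])
    then have "isCont d z"
      unfolding d_def by (intro continuous_intros)
    then have "(\<lambda>n. d (x n)) \<longlonglongrightarrow> d z"
      using x_lim by (rule isCont_tendsto_compose)
    then have "d z = 0"
      using tendsto_eventually[OF ev0] by (rule LIMSEQ_unique)
    then show ?thesis by (simp add: d_def)
  qed
  then have "laurent_series a f"
    using g_series by (simp add: laurent_series_def)
  with summable show ?thesis by (rule that)
qed

section \<open>Boundary series and the Riesz--Fischer theorem\<close>

lemma square_integrable_continuous:
  assumes "continuous_on torus u"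
  shows "square_integrable u"
proof -
  have "continuous_on torus (\<lambda>\<zeta>. (cmod (u \<zeta>))\<^sup>2)"
    by (intro continuous_intros assms)
  then show ?thesis
    using measurable_torusI[OF assms] by (simp add: square_integrable_def integrable_torusI)
qed

lemma square_integrable_scale:
  assumes "square_integrable u"
  shows "square_integrable (\<lambda>\<zeta>. c * u \<zeta>)"
proof -
  have [measurable]: "u \<in> borel_measurable torus_measure"
    and "integrable torus_measure (\<lambda>\<zeta>. (cmod (u \<zeta>))\<^sup>2)"
    using assms by (simp_all add: square_integrable_def)
  then have "integrable torus_measure (\<lambda>\<zeta>. (cmod c)\<^sup>2 * (cmod (u \<zeta>))\<^sup>2)"
    by (intro integrable_mult_right)
  moreover have "(\<lambda>\<zeta>. c * u \<zeta>) \<in> borel_measurable torus_measure" by measurable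
  ultimately show ?thesis
    by (simp add: square_integrable_def norm_mult power_mult_distrib)
qed

lemma cmod_add_squared_le: "(cmod (a + b))\<^sup>2 \<le> 2 * (cmod a)\<^sup>2 + 2 * (cmod b)\<^sup>2"
proof -
  have "(cmod (a + b))\<^sup>2 \<le> (cmod a + cmod b)\<^sup>2"
    by (intro power_mono norm_triangle_ineq) simp
  then show ?thesis
    using power2_sum[of "cmod a" "cmod b"] sum_squares_bound[of "cmod a" "cmod b"] by linarith
qed

lemma square_integrable_add:
  assumes u: "square_integrable u" and v: "square_integrable v"
  shows "square_integrable (\<lambda>\<zeta>. u \<zeta> + v \<zeta>)"
proof -
  have [measurable]: "u \<in> borel_measurable torus_measure" "v \<in> borel_measurable torus_measure"
    using u v by (simp_all add: square_integrable_def)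
  have bd: "norm ((cmod (a + b))\<^sup>2) \<le> norm (2 * (cmod a)\<^sup>2 + 2 * (cmod b)\<^sup>2)" for a b
    using cmod_add_squared_le[of a b] by simp
  have "integrable torus_measure (\<lambda>\<zeta>. 2 * (cmod (u \<zeta>))\<^sup>2 + 2 * (cmod (v \<zeta>))\<^sup>2)"
    using u v by (simp add: square_integrable_def)
  then have "integrable torus_measure (\<lambda>\<zeta>. (cmod (u \<zeta> + v \<zeta>))\<^sup>2)"
    by (rule Bochner_Integration.integrable_bound) (simp_all only: bd AE_I2, measurable)
  then show ?thesis by (simp add: square_integrable_def)
qed

lemma square_integrable_diff:
  "square_integrable u \<Longrightarrow> square_integrable v \<Longrightarrow> square_integrable (\<lambda>\<zeta>. u \<zeta> - v \<zeta>)"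
  using square_integrable_add[OF _ square_integrable_scale, of u v "-1"] by simp

lemma L2_seminorm_sq: "(L2_seminorm u)\<^sup>2 = (LINT \<zeta>|torus_measure. (cmod (u \<zeta>))\<^sup>2)"
  unfolding L2_seminorm_def by (intro real_sqrt_pow2 integral_nonneg_AE) simp

lemma L2_seminorm_nonneg: "0 \<le> L2_seminorm u"
  unfolding L2_seminorm_def by (intro real_sqrt_ge_zero integral_nonneg_AE) simp

lemma L2_seminorm_scale: "L2_seminorm (\<lambda>\<zeta>. c * u \<zeta>) = cmod c * L2_seminorm u"
  by (simp add: L2_seminorm_def norm_mult power_mult_distrib real_sqrt_mult)

lemma L2_seminorm_triangle:
  assumes u: "square_integrable u" and v: "square_integrable v"
  shows "L2_seminorm (\<lambda>\<zeta>. u \<zeta> + v \<zeta>) \<le> L2_seminorm u + L2_seminorm v"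
proof (rule power2_le_imp_le)
  have [measurable]: "u \<in> borel_measurable torus_measure" "v \<in> borel_measurable torus_measure"
    and int: "integrable torus_measure (\<lambda>\<zeta>. (cmod (u \<zeta>))\<^sup>2)" "integrable torus_measure (\<lambda>\<zeta>. (cmod (v \<zeta>))\<^sup>2)"
    using u v by (simp_all add: square_integrable_def)
  have int_uv: "integrable torus_measure (\<lambda>\<zeta>. cmod (u \<zeta>) * cmod (v \<zeta>))"
  proof (rule Bochner_Integration.integrable_bound)
    show "integrable torus_measure (\<lambda>\<zeta>. (cmod (u \<zeta>))\<^sup>2 + (cmod (v \<zeta>))\<^sup>2)"
      using int by simp
    show "AE \<zeta> in torus_measure. norm (cmod (u \<zeta>) * cmod (v \<zeta>)) \<le> norm ((cmod (u \<zeta>))\<^sup>2 + (cmod (v \<zeta>))\<^sup>2)"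
    proof (rule AE_I2)
      fix \<zeta>
      have "0 \<le> cmod (u \<zeta>) * cmod (v \<zeta>)" by simp
      then have "cmod (u \<zeta>) * cmod (v \<zeta>) \<le> (cmod (u \<zeta>))\<^sup>2 + (cmod (v \<zeta>))\<^sup>2"
        using sum_squares_bound[of "cmod (u \<zeta>)" "cmod (v \<zeta>)"] by linarith
      then show "norm (cmod (u \<zeta>) * cmod (v \<zeta>)) \<le> norm ((cmod (u \<zeta>))\<^sup>2 + (cmod (v \<zeta>))\<^sup>2)"
        by simp
    qed
  qed simp
  have nn: "(\<integral>\<^sup>+\<zeta>. (ennreal (cmod (w \<zeta>)))\<^sup>2 \<partial>torus_measure) = ennreal ((L2_seminorm w)\<^sup>2)" if "square_integrable w" for w
    using that unfolding L2_seminorm_sq square_integrable_def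
    by (subst nn_integral_eq_integral[symmetric]) (simp_all add: ennreal_power)
  have "(\<integral>\<^sup>+\<zeta>. ennreal (cmod (u \<zeta>)) * ennreal (cmod (v \<zeta>)) \<partial>torus_measure) =
      ennreal (LINT \<zeta>|torus_measure. cmod (u \<zeta>) * cmod (v \<zeta>))"
    using int_uv by (subst nn_integral_eq_integral[symmetric]) (simp_all add: ennreal_mult)
  then have "(ennreal (LINT \<zeta>|torus_measure. cmod (u \<zeta>) * cmod (v \<zeta>)))\<^sup>2 \<le>
      ennreal ((L2_seminorm u)\<^sup>2) * ennreal ((L2_seminorm v)\<^sup>2)"
    using Cauchy_Schwarz_nn_integral[of "\<lambda>\<zeta>. ennreal (cmod (u \<zeta>))" torus_measure "\<lambda>\<zeta>. ennreal (cmod (v \<zeta>))"]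
    by (simp add: nn u v)
  then have "(LINT \<zeta>|torus_measure. cmod (u \<zeta>) * cmod (v \<zeta>))\<^sup>2 \<le> (L2_seminorm u * L2_seminorm v)\<^sup>2"
    by (simp add: ennreal_power ennreal_mult[symmetric] power_mult_distrib integral_nonneg_AE)
  then have CS: "(LINT \<zeta>|torus_measure. cmod (u \<zeta>) * cmod (v \<zeta>)) \<le> L2_seminorm u * L2_seminorm v"
    by (rule power2_le_imp_le) (simp add: L2_seminorm_nonneg)
  have "(L2_seminorm (\<lambda>\<zeta>. u \<zeta> + v \<zeta>))\<^sup>2 \<le>
      (LINT \<zeta>|torus_measure. (cmod (u \<zeta>))\<^sup>2 + (cmod (v \<zeta>))\<^sup>2 + 2 * (cmod (u \<zeta>) * cmod (v \<zeta>)))"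
    unfolding L2_seminorm_sq
  proof (rule integral_mono)
    show "integrable torus_measure (\<lambda>\<zeta>. (cmod (u \<zeta> + v \<zeta>))\<^sup>2)"
      using square_integrable_add[OF u v] by (simp add: square_integrable_def)
    show "integrable torus_measure (\<lambda>\<zeta>. (cmod (u \<zeta>))\<^sup>2 + (cmod (v \<zeta>))\<^sup>2 + 2 * (cmod (u \<zeta>) * cmod (v \<zeta>)))"
      using int int_uv by simp
    show "(cmod (u \<zeta> + v \<zeta>))\<^sup>2 \<le> (cmod (u \<zeta>))\<^sup>2 + (cmod (v \<zeta>))\<^sup>2 + 2 * (cmod (u \<zeta>) * cmod (v \<zeta>))" for \<zeta>
      using power_mono[OF norm_triangle_ineq[of "u \<zeta>" "v \<zeta>"], of 2] by (simp add: power2_sum)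
  qed
  also have "\<dots> = (L2_seminorm u)\<^sup>2 + (L2_seminorm v)\<^sup>2 + 2 * (LINT \<zeta>|torus_measure. cmod (u \<zeta>) * cmod (v \<zeta>))"
    using int int_uv unfolding L2_seminorm_sq by simp
  also have "\<dots> \<le> (L2_seminorm u + L2_seminorm v)\<^sup>2"
    using CS by (simp add: power2_sum)
  finally show "(L2_seminorm (\<lambda>\<zeta>. u \<zeta> + v \<zeta>))\<^sup>2 \<le> (L2_seminorm u + L2_seminorm v)\<^sup>2" .
qed (simp add: L2_seminorm_nonneg)

definition char_sum :: "(int ^ 'n \<Rightarrow> complex) \<Rightarrow> (int ^ 'n) set \<Rightarrow> complex ^ 'n \<Rightarrow> complex" where
  "char_sum a F \<zeta> = (\<Sum>\<alpha>\<in>F. a \<alpha> * monomial \<alpha> \<zeta>)"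

lemma continuous_on_char_sum: "continuous_on torus (char_sum a F)"
  unfolding char_sum_def by (intro continuous_intros continuous_on_monomial_torus)

lemmas square_integrable_char_sum = square_integrable_continuous[OF continuous_on_char_sum]

lemma L2_seminorm_char_sum:
  assumes "finite F"
  shows "(L2_seminorm (char_sum a F))\<^sup>2 = (\<Sum>\<alpha>\<in>F. (cmod (a \<alpha>))\<^sup>2)"
proof -
  have "((\<lambda>\<alpha>. (cmod (a \<alpha>))\<^sup>2) has_sum (L2_seminorm (char_sum a F))\<^sup>2) F"
    unfolding L2_seminorm_sq
    by (rule Parseval_series[OF _ _ continuous_on_char_sum])
      (use assms in \<open>auto simp: char_sum_def has_sum_finite\<close>)
  then show ?thesis using has_sum_finite[OF assms] has_sum_unique by blast
qed

lemma L2_seminorm_char_sum_diff: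
  assumes G: "finite G" and H: "finite H"
  shows "(L2_seminorm (\<lambda>\<zeta>. char_sum a G \<zeta> - char_sum a H \<zeta>))\<^sup>2 = (\<Sum>\<alpha>\<in>(G - H) \<union> (H - G). (cmod (a \<alpha>))\<^sup>2)"
proof -
  \<comment> \<open>The difference is the sum over the symmetric difference with signs, which do not affect norms.\<close>
  define b where "b \<alpha> = (if \<alpha> \<in> H then - a \<alpha> else a \<alpha>)" for \<alpha>
  have "char_sum a G \<zeta> - char_sum a H \<zeta> = char_sum b ((G - H) \<union> (H - G)) \<zeta>" for \<zeta>
  proof -
    have "char_sum a G \<zeta> = char_sum a (G - H) \<zeta> + char_sum a (G \<inter> H) \<zeta>"
      "char_sum a H \<zeta> = char_sum a (H - G) \<zeta> + char_sum a (G \<inter> H) \<zeta>"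
      unfolding char_sum_def using sum.Int_Diff[OF G, of _ H] sum.Int_Diff[OF H, of _ G]
      by (simp_all add: Int_commute add.commute)
    moreover have "char_sum b ((G - H) \<union> (H - G)) \<zeta> = char_sum a (G - H) \<zeta> - char_sum a (H - G) \<zeta>"
      unfolding char_sum_def using G H
      by (subst sum.union_disjoint) (auto simp: b_def sum_negf[symmetric] intro!: arg_cong2[where f = plus] sum.cong)
    ultimately show ?thesis by simp
  qed
  then have "(L2_seminorm (\<lambda>\<zeta>. char_sum a G \<zeta> - char_sum a H \<zeta>))\<^sup>2 =
      (\<Sum>\<alpha>\<in>(G - H) \<union> (H - G). (cmod (b \<alpha>))\<^sup>2)"
    using L2_seminorm_char_sum[of "(G - H) \<union> (H - G)" b] G H by simp
  then show ?thesis by (simp add: b_def if_distrib[of cmod] cong: if_cong)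
qed

lemma boundary_series_iff:
  "boundary_series a u \<longleftrightarrow> (\<lambda>\<alpha>. (cmod (a \<alpha>))\<^sup>2) summable_on hardy_index \<and> square_integrable u \<and>
    ((\<lambda>F. L2_seminorm (\<lambda>\<zeta>. u \<zeta> - char_sum a F \<zeta>)) \<longlongrightarrow> 0) (finite_subsets_at_top hardy_index)"
  by (simp add: boundary_series_def char_sum_def)

lemma boundary_series_scale:
  assumes "boundary_series a u"
  shows "boundary_series (\<lambda>\<alpha>. c * a \<alpha>) (\<lambda>\<zeta>. c * u \<zeta>)"
proof -
  have "(\<lambda>\<alpha>. (cmod c)\<^sup>2 * (cmod (a \<alpha>))\<^sup>2) summable_on hardy_index"
    using assms by (intro summable_on_cmult_right) (simp add: boundary_series_def)
  moreover have "c * u \<zeta> - char_sum (\<lambda>\<alpha>. c * a \<alpha>) F \<zeta> = c * (u \<zeta> - char_sum a F \<zeta>)" for F \<zeta>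
    by (simp add: char_sum_def sum_distrib_left right_diff_distrib mult.assoc)
  moreover have "((\<lambda>F. cmod c * L2_seminorm (\<lambda>\<zeta>. u \<zeta> - char_sum a F \<zeta>)) \<longlongrightarrow> cmod c * 0)
      (finite_subsets_at_top hardy_index)"
    using assms by (intro tendsto_mult_left) (simp add: boundary_series_iff)
  ultimately show ?thesis
    using assms by (simp add: boundary_series_iff norm_mult power_mult_distrib L2_seminorm_scale square_integrable_scale)
qed

lemma boundary_series_add:
  assumes u: "boundary_series a u" and v: "boundary_series b v"
  shows "boundary_series (\<lambda>\<alpha>. a \<alpha> + b \<alpha>) (\<lambda>\<zeta>. u \<zeta> + v \<zeta>)"
proof -
  note u' = u[unfolded boundary_series_iff] and v' = v[unfolded boundary_series_iff]
  have summable: "(\<lambda>\<alpha>. (cmod (a \<alpha> + b \<alpha>))\<^sup>2) summable_on hardy_index"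
  proof (rule summable_on_comparison_test)
    show "(\<lambda>\<alpha>. 2 * (cmod (a \<alpha>))\<^sup>2 + 2 * (cmod (b \<alpha>))\<^sup>2) summable_on hardy_index"
      using u' v' by (intro summable_on_add summable_on_cmult_right) simp_all
  qed (simp_all add: cmod_add_squared_le)
  let ?U = "\<lambda>F \<zeta>. u \<zeta> - char_sum a F \<zeta>" and ?V = "\<lambda>F \<zeta>. v \<zeta> - char_sum b F \<zeta>"
  have split: "u \<zeta> + v \<zeta> - char_sum (\<lambda>\<alpha>. a \<alpha> + b \<alpha>) F \<zeta> = ?U F \<zeta> + ?V F \<zeta>" for F \<zeta>
    by (simp add: char_sum_def sum.distrib ring_distribs)
  have "((\<lambda>F. L2_seminorm (\<lambda>\<zeta>. ?U F \<zeta> + ?V F \<zeta>)) \<longlongrightarrow> 0) (finite_subsets_at_top hardy_index)"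
  proof (rule Lim_null_comparison)
    show "((\<lambda>F. L2_seminorm (?U F) + L2_seminorm (?V F)) \<longlongrightarrow> 0) (finite_subsets_at_top hardy_index)"
      using tendsto_add[of _ 0 _ _ 0] u' v' by force
    have "L2_seminorm (\<lambda>\<zeta>. ?U F \<zeta> + ?V F \<zeta>) \<le> L2_seminorm (?U F) + L2_seminorm (?V F)" for F
      using u' v' by (intro L2_seminorm_triangle square_integrable_diff square_integrable_char_sum) simp_all
    then show "\<forall>\<^sub>F F in finite_subsets_at_top hardy_index.
        norm (L2_seminorm (\<lambda>\<zeta>. ?U F \<zeta> + ?V F \<zeta>)) \<le> L2_seminorm (?U F) + L2_seminorm (?V F)"
      by (simp add: always_eventually L2_seminorm_nonneg)
  qed
  then show ?thesis
    using summable square_integrable_add u' v' unfolding boundary_series_iff split by blast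
qed

lemma boundary_series_diff:
  assumes "boundary_series a u" "boundary_series b v"
  shows "boundary_series (\<lambda>\<alpha>. a \<alpha> - b \<alpha>) (\<lambda>\<zeta>. u \<zeta> - v \<zeta>)"
  using boundary_series_add[OF assms(1) boundary_series_scale[OF assms(2), of "-1"]] by simp

text \<open>The seminorm is continuous for its own convergence, and the partial sums satisfy Parseval.\<close>
lemma L2_seminorm_boundary_series:
  assumes u: "boundary_series a u"
  shows "L2_seminorm u = sqrt (\<Sum>\<^sub>\<infinity>\<alpha>\<in>hardy_index. (cmod (a \<alpha>))\<^sup>2)"
proof (rule tendsto_unique)
  let ?F = "finite_subsets_at_top (hardy_index :: (int ^ 'a::{finite,linorder}) set)"
  note u' = u[unfolded boundary_series_iff]
  show "?F \<noteq> bot" by simp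
  have "((\<lambda>F. \<Sum>\<alpha>\<in>F. (cmod (a \<alpha>))\<^sup>2) \<longlongrightarrow> (\<Sum>\<^sub>\<infinity>\<alpha>\<in>hardy_index. (cmod (a \<alpha>))\<^sup>2)) ?F"
    using has_sum_infsum u' unfolding has_sum_def by blast
  from tendsto_real_sqrt[OF this]
  show "((\<lambda>F. L2_seminorm (char_sum a F)) \<longlongrightarrow> sqrt (\<Sum>\<^sub>\<infinity>\<alpha>\<in>hardy_index. (cmod (a \<alpha>))\<^sup>2)) ?F"
  proof (rule Lim_transform_eventually)
    show "\<forall>\<^sub>F F in ?F. sqrt (\<Sum>\<alpha>\<in>F. (cmod (a \<alpha>))\<^sup>2) = L2_seminorm (char_sum a F)"
      by (intro eventually_finite_subsets_at_top_weakI)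
        (simp add: L2_seminorm_char_sum[symmetric] L2_seminorm_nonneg)
  qed
  have "((\<lambda>F. L2_seminorm (char_sum a F) - L2_seminorm u) \<longlongrightarrow> 0) ?F"
  proof (rule Lim_null_comparison)
    show "((\<lambda>F. L2_seminorm (\<lambda>\<zeta>. u \<zeta> - char_sum a F \<zeta>)) \<longlongrightarrow> 0) ?F"
      using u' by blast
    have "\<bar>L2_seminorm (char_sum a F) - L2_seminorm u\<bar> \<le> L2_seminorm (\<lambda>\<zeta>. u \<zeta> - char_sum a F \<zeta>)" for F
    proof -
      have d: "square_integrable (\<lambda>\<zeta>. u \<zeta> - char_sum a F \<zeta>)" and c: "square_integrable (char_sum a F)"
        and s: "square_integrable u"
        using u' by (simp_all add: square_integrable_diff square_integrable_char_sum)
      have "L2_seminorm u \<le> L2_seminorm (\<lambda>\<zeta>. u \<zeta> - char_sum a F \<zeta>) + L2_seminorm (char_sum a F)"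
        using L2_seminorm_triangle[OF d c] by simp
      moreover have "L2_seminorm (char_sum a F) \<le> L2_seminorm u + L2_seminorm (\<lambda>\<zeta>. u \<zeta> - char_sum a F \<zeta>)"
        using L2_seminorm_triangle[OF s square_integrable_scale[OF d, of "-1"]]
          L2_seminorm_scale[of "-1" "\<lambda>\<zeta>. u \<zeta> - char_sum a F \<zeta>"] by simp
      ultimately show ?thesis by linarith
    qed
    then show "\<forall>\<^sub>F F in ?F. norm (L2_seminorm (char_sum a F) - L2_seminorm u) \<le> L2_seminorm (\<lambda>\<zeta>. u \<zeta> - char_sum a F \<zeta>)"
      by (simp add: always_eventually)
  qed
  then show "((\<lambda>F. L2_seminorm (char_sum a F)) \<longlongrightarrow> L2_seminorm u) ?F"
    by (simp add: LIM_zero_iff)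
qed

lemma L2_seminorm_eq_0_iff:
  assumes "square_integrable u"
  shows "L2_seminorm u = 0 \<longleftrightarrow> (AE \<zeta> in torus_measure. u \<zeta> = 0)"
  using assms integral_nonneg_eq_0_iff_AE[of torus_measure "\<lambda>\<zeta>. (cmod (u \<zeta>))\<^sup>2"]
  by (simp add: L2_seminorm_def square_integrable_def)

lemma infsum_cmod_sq_eq_0:
  assumes "(\<lambda>\<alpha>. (cmod (a \<alpha>))\<^sup>2) summable_on A" "(\<Sum>\<^sub>\<infinity>\<alpha>\<in>A. (cmod (a \<alpha>))\<^sup>2) = 0" "\<alpha> \<in> A"
  shows "a \<alpha> = 0"
  using square_summable_bounded[OF assms(1,3)] assms(2) by simp

lemma boundary_series_determines_function:
  assumes u: "boundary_series a u" and v: "boundary_series b v"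
    and eq: "\<And>\<alpha>. \<alpha> \<in> hardy_index \<Longrightarrow> a \<alpha> = b \<alpha>"
  shows "AE \<zeta> in torus_measure. u \<zeta> = v \<zeta>"
proof -
  note d = boundary_series_diff[OF u v]
  have "(\<Sum>\<^sub>\<infinity>\<alpha>\<in>hardy_index. (cmod (a \<alpha> - b \<alpha>))\<^sup>2) = 0"
    by (rule infsum_0) (simp add: eq)
  then have "L2_seminorm (\<lambda>\<zeta>. u \<zeta> - v \<zeta>) = 0"
    using L2_seminorm_boundary_series[OF d] by simp
  then show ?thesis
    using L2_seminorm_eq_0_iff[of "\<lambda>\<zeta>. u \<zeta> - v \<zeta>"] d by (simp add: boundary_series_def)
qed

lemma boundary_series_determines_coefficients:
  assumes u: "boundary_series a u" and v: "boundary_series b v"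
    and eq: "AE \<zeta> in torus_measure. u \<zeta> = v \<zeta>" and \<alpha>: "\<alpha> \<in> hardy_index"
  shows "a \<alpha> = b \<alpha>"
proof -
  note d = boundary_series_diff[OF u v]
  have "L2_seminorm (\<lambda>\<zeta>. u \<zeta> - v \<zeta>) = 0"
    using L2_seminorm_eq_0_iff[of "\<lambda>\<zeta>. u \<zeta> - v \<zeta>"] d eq by (simp add: boundary_series_def)
  then have "(\<Sum>\<^sub>\<infinity>\<alpha>\<in>hardy_index. (cmod (a \<alpha> - b \<alpha>))\<^sup>2) = 0"
    using L2_seminorm_boundary_series[OF d] by simp
  then show ?thesis
    using infsum_cmod_sq_eq_0[of "\<lambda>\<alpha>. a \<alpha> - b \<alpha>" hardy_index \<alpha>] d \<alpha> by (simp add: boundary_series_def)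
qed

text \<open>The Cauchy property of the partial sums: beyond \<open>K\<close> only the tail of the square sum matters.\<close>
lemma L2_seminorm_char_sum_diff_le:
  assumes a: "(\<lambda>\<alpha>. (cmod (a \<alpha>))\<^sup>2) summable_on A" and "finite G" "finite H" "K \<subseteq> G" "K \<subseteq> H" "G \<subseteq> A" "H \<subseteq> A"
  shows "(L2_seminorm (\<lambda>\<zeta>. char_sum a G \<zeta> - char_sum a H \<zeta>))\<^sup>2 \<le>
    (\<Sum>\<^sub>\<infinity>\<alpha>\<in>A. (cmod (a \<alpha>))\<^sup>2) - (\<Sum>\<alpha>\<in>K. (cmod (a \<alpha>))\<^sup>2)"
proof -
  let ?D = "(G - H) \<union> (H - G)"
  have "(\<Sum>\<alpha>\<in>?D. (cmod (a \<alpha>))\<^sup>2) + (\<Sum>\<alpha>\<in>K. (cmod (a \<alpha>))\<^sup>2) = (\<Sum>\<alpha>\<in>?D \<union> K. (cmod (a \<alpha>))\<^sup>2)"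
    using assms finite_subset[of K G] by (intro sum.union_disjoint[symmetric]) auto
  also have "\<dots> \<le> (\<Sum>\<^sub>\<infinity>\<alpha>\<in>A. (cmod (a \<alpha>))\<^sup>2)"
    using assms finite_subset[of K G] by (intro finite_sum_le_infsum) auto
  finally show ?thesis
    unfolding L2_seminorm_char_sum_diff[OF assms(2,3)] by simp
qed

lemma nn_integral_L2_seminorm:
  assumes "square_integrable u"
  shows "(\<integral>\<^sup>+\<zeta>. ennreal ((cmod (u \<zeta>))\<^sup>2) \<partial>torus_measure) = ennreal ((L2_seminorm u)\<^sup>2)"
  using assms unfolding L2_seminorm_sq square_integrable_def
  by (intro nn_integral_eq_integral) simp_all

text \<open>Riesz--Fischer. Along a sequence of finite index sets with tails below \<open>4\<^bsup>-k\<^esup>\<close> the increments \<open>d k\<close> have \<open>L\<^sup>1\<close>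
norms at most \<open>2\<^bsup>-k\<^esup>\<close>, so the partial sums converge almost everywhere. Fatou's lemma transfers the
\<open>L\<^sup>2\<close> estimates to the limit, and not only along the sequence but for all larger finite index sets.\<close>
lemma exists_boundary_series:
  fixes a :: "int ^ 'n::{finite,linorder} \<Rightarrow> complex"
  assumes a: "(\<lambda>\<alpha>. (cmod (a \<alpha>))\<^sup>2) summable_on hardy_index"
  obtains u where "boundary_series a u"
proof -
  define \<sigma> where "\<sigma> = (\<Sum>\<^sub>\<infinity>\<alpha>\<in>hardy_index. (cmod (a \<alpha>))\<^sup>2)"
  have "\<exists>K. finite K \<and> K \<subseteq> hardy_index \<and> dist (\<Sum>\<alpha>\<in>K. (cmod (a \<alpha>))\<^sup>2) \<sigma> \<le> (1 / 4) ^ k" for k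
    unfolding \<sigma>_def by (rule infsum_finite_approximation[OF a]) simp
  then obtain K where K: "\<And>k. finite (K k)" "\<And>k. K k \<subseteq> hardy_index"
    "\<And>k. dist (\<Sum>\<alpha>\<in>K k. (cmod (a \<alpha>))\<^sup>2) \<sigma> \<le> (1 / 4) ^ k" by metis
  define G where "G k = (\<Union>i\<le>k. K i)" for k
  have G: "finite (G k)" "G k \<subseteq> hardy_index" for k using K by (auto simp: G_def)
  have G_mono: "G k \<subseteq> G m" if "k \<le> m" for k m using that by (force simp: G_def)
  have tail: "\<sigma> - (\<Sum>\<alpha>\<in>G k. (cmod (a \<alpha>))\<^sup>2) \<le> (1 / 4) ^ k" for k
  proof -
    have "(\<Sum>\<alpha>\<in>K k. (cmod (a \<alpha>))\<^sup>2) \<le> (\<Sum>\<alpha>\<in>G k. (cmod (a \<alpha>))\<^sup>2)"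
      by (intro sum_mono2 G) (auto simp: G_def)
    then show ?thesis using K(3)[of k] by (simp add: dist_real_def)
  qed
  define S where "S k = char_sum a (G k)" for k
  have close: "(L2_seminorm (\<lambda>\<zeta>. S m \<zeta> - char_sum a H \<zeta>))\<^sup>2 \<le> (1 / 4) ^ k"
    if "k \<le> m" "finite H" "G k \<subseteq> H" "H \<subseteq> hardy_index" for k m H
    unfolding S_def
    using L2_seminorm_char_sum_diff_le[OF a G(1) that(2) G_mono[OF that(1)] that(3) G(2) that(4)] tail[of k]
    by (simp add: \<sigma>_def)
  define d where "d k \<zeta> = S (Suc k) \<zeta> - S k \<zeta>" for k \<zeta>
  have d_cont: "continuous_on torus (d k)" for k
    unfolding d_def S_def by (intro continuous_on_diff continuous_on_char_sum)
  have d_int: "(LINT \<zeta>|torus_measure. cmod (d k \<zeta>)) \<le> (1 / 2) ^ k" for k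
  proof -
    \<comment> \<open>Balanced so that, with \<open>L\<^sup>2\<close> norm squared at most \<open>4\<^bsup>-k\<^esup>\<close>, both terms integrate to at most \<open>2\<^bsup>-k\<^esup>\<close>.\<close>
    have young: "cmod w \<le> (2 ^ k * (cmod w)\<^sup>2 + (1 / 2) ^ k) / 2" for w
    proof -
      have "0 \<le> (2 ^ k * cmod w - 1)\<^sup>2" by simp
      then have "2 * (2 ^ k * cmod w) \<le> 2 ^ k * (2 ^ k * (cmod w)\<^sup>2) + 1"
        by (simp add: power2_eq_square algebra_simps)
      then show ?thesis by (simp add: field_simps power_one_over)
    qed
    have int: "integrable torus_measure (\<lambda>\<zeta>. (cmod (d k \<zeta>))\<^sup>2)"
      by (intro integrable_torusI continuous_intros d_cont)
    have "(LINT \<zeta>|torus_measure. (cmod (d k \<zeta>))\<^sup>2) \<le> (1 / 4) ^ k"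
      using close[OF le_SucI[OF order_refl] G(1) order_refl G(2), of k] unfolding L2_seminorm_sq
      by (simp add: d_def S_def[symmetric])
    then have "2 ^ k * (LINT \<zeta>|torus_measure. (cmod (d k \<zeta>))\<^sup>2) \<le> 2 ^ k * (1 / 4) ^ k"
      by (intro mult_left_mono) simp_all
    also have "\<dots> = (1 / 2) ^ k" by (simp flip: power_mult_distrib)
    finally have le: "2 ^ k * (LINT \<zeta>|torus_measure. (cmod (d k \<zeta>))\<^sup>2) \<le> (1 / 2) ^ k" .
    have "(LINT \<zeta>|torus_measure. cmod (d k \<zeta>)) \<le>
        (LINT \<zeta>|torus_measure. (2 ^ k * (cmod (d k \<zeta>))\<^sup>2 + (1 / 2) ^ k) / 2)"
      by (intro integral_mono integrable_torusI continuous_intros d_cont young) simp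
    also have "\<dots> = (2 ^ k * (LINT \<zeta>|torus_measure. (cmod (d k \<zeta>))\<^sup>2) + (1 / 2) ^ k) / 2"
      using int by (simp add: measure_torus)
    finally show ?thesis using le by simp
  qed
  have d_meas: "(\<lambda>\<zeta>. ennreal (cmod (d k \<zeta>))) \<in> borel_measurable torus_measure" for k
    using measurable_torusI[OF d_cont[of k]] by simp
  have "(\<integral>\<^sup>+\<zeta>. (\<Sum>k. ennreal (cmod (d k \<zeta>))) \<partial>torus_measure) = (\<Sum>k. \<integral>\<^sup>+\<zeta>. ennreal (cmod (d k \<zeta>)) \<partial>torus_measure)"
    by (rule nn_integral_suminf) (rule d_meas)
  also have "\<dots> \<le> (\<Sum>k. ennreal ((1 / 2) ^ k))"
  proof (rule suminf_le)
    fix k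
    have "(\<integral>\<^sup>+\<zeta>. ennreal (cmod (d k \<zeta>)) \<partial>torus_measure) = ennreal (LINT \<zeta>|torus_measure. cmod (d k \<zeta>))"
      by (intro nn_integral_eq_integral integrable_torusI continuous_on_norm d_cont) simp
    then show "(\<integral>\<^sup>+\<zeta>. ennreal (cmod (d k \<zeta>)) \<partial>torus_measure) \<le> ennreal ((1 / 2) ^ k)"
      by (simp add: ennreal_leI d_int)
  qed simp_all
  also have "\<dots> = ennreal (\<Sum>k. (1 / 2) ^ k)"
    by (rule suminf_ennreal2) (simp_all add: summable_geometric)
  also have "\<dots> < top" by (rule ennreal_less_top)
  finally have "(\<integral>\<^sup>+\<zeta>. (\<Sum>k. ennreal (cmod (d k \<zeta>))) \<partial>torus_measure) \<noteq> \<infinity>"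
    unfolding infinity_ennreal_def by (rule less_imp_neq)
  then have "AE \<zeta> in torus_measure. (\<Sum>k. ennreal (cmod (d k \<zeta>))) \<noteq> \<infinity>"
    using d_meas by (intro nn_integral_PInf_AE) simp_all
  then have lim: "AE \<zeta> in torus_measure. (\<lambda>k. S k \<zeta>) \<longlonglongrightarrow> lim (\<lambda>k. S k \<zeta>)"
  proof (rule AE_mp, intro AE_I2 impI)
    fix \<zeta> assume "(\<Sum>k. ennreal (cmod (d k \<zeta>))) \<noteq> \<infinity>"
    then have "summable (\<lambda>k. cmod (d k \<zeta>))"
      by (intro summable_suminf_not_top) (simp_all add: infinity_ennreal_def)
    then have "summable (\<lambda>k. d k \<zeta>)" by (rule summable_norm_cancel)
    then have "convergent (\<lambda>n. S 0 \<zeta> + (\<Sum>k<n. d k \<zeta>))"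
      by (intro convergent_add convergent_const) (simp add: summable_iff_convergent)
    also have "(\<lambda>n. S 0 \<zeta> + (\<Sum>k<n. d k \<zeta>)) = (\<lambda>n. S n \<zeta>)"
      using sum_lessThan_telescope[of "\<lambda>k. S k \<zeta>"] by (simp add: d_def)
    finally show "(\<lambda>k. S k \<zeta>) \<longlonglongrightarrow> lim (\<lambda>k. S k \<zeta>)" by (simp add: convergent_LIMSEQ_iff)
  qed
  define u where "u \<zeta> = lim (\<lambda>k. S k \<zeta>)" for \<zeta>
  have S_meas: "S k \<in> borel_measurable torus_measure" for k
    unfolding S_def by (intro measurable_torusI continuous_on_char_sum)
  have u_meas: "u \<in> borel_measurable torus_measure"
    unfolding u_def by (rule borel_measurable_lim_metric) (rule S_meas)
  have char_meas: "char_sum a H \<in> borel_measurable torus_measure" for H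
    by (intro measurable_torusI continuous_on_char_sum)
  have Fatou: "(\<integral>\<^sup>+\<zeta>. ennreal ((cmod (u \<zeta> - char_sum a H \<zeta>))\<^sup>2) \<partial>torus_measure) \<le> ennreal ((1 / 4) ^ k)"
    if H: "finite H" "G k \<subseteq> H" "H \<subseteq> hardy_index" for k H
  proof -
    let ?g = "\<lambda>m \<zeta>. ennreal ((cmod (S m \<zeta> - char_sum a H \<zeta>))\<^sup>2)"
    have "(\<integral>\<^sup>+\<zeta>. ennreal ((cmod (u \<zeta> - char_sum a H \<zeta>))\<^sup>2) \<partial>torus_measure) =
        (\<integral>\<^sup>+\<zeta>. liminf (\<lambda>m. ?g m \<zeta>) \<partial>torus_measure)"
    proof (rule nn_integral_cong_AE, rule AE_mp[OF lim], intro AE_I2 impI)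
      fix \<zeta> assume "(\<lambda>k. S k \<zeta>) \<longlonglongrightarrow> lim (\<lambda>k. S k \<zeta>)"
      then have "(\<lambda>m. ?g m \<zeta>) \<longlonglongrightarrow> ennreal ((cmod (u \<zeta> - char_sum a H \<zeta>))\<^sup>2)"
        unfolding u_def by (intro tendsto_ennrealI tendsto_intros)
      then show "ennreal ((cmod (u \<zeta> - char_sum a H \<zeta>))\<^sup>2) = liminf (\<lambda>m. ?g m \<zeta>)"
        by (intro lim_imp_Liminf[symmetric]) simp_all
    qed
    also have "\<dots> \<le> liminf (\<lambda>m. \<integral>\<^sup>+\<zeta>. ?g m \<zeta> \<partial>torus_measure)"
      using S_meas char_meas[of H] by (intro nn_integral_liminf) simp
    also have "\<dots> \<le> limsup (\<lambda>m. \<integral>\<^sup>+\<zeta>. ?g m \<zeta> \<partial>torus_measure)"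
      by (rule Liminf_le_Limsup) simp
    also have "\<dots> \<le> ennreal ((1 / 4) ^ k)"
    proof (rule Limsup_bounded, rule eventually_sequentiallyI)
      fix m assume "k \<le> m"
      have "square_integrable (\<lambda>\<zeta>. S m \<zeta> - char_sum a H \<zeta>)"
        unfolding S_def by (intro square_integrable_diff square_integrable_char_sum)
      from nn_integral_L2_seminorm[OF this]
      show "(\<integral>\<^sup>+\<zeta>. ?g m \<zeta> \<partial>torus_measure) \<le> ennreal ((1 / 4) ^ k)"
        using close[OF \<open>k \<le> m\<close> H] by (simp add: ennreal_leI)
    qed
    finally show ?thesis .
  qed
  have "square_integrable (\<lambda>\<zeta>. u \<zeta> - S 0 \<zeta>)"
    unfolding square_integrable_def
  proof
    show "(\<lambda>\<zeta>. u \<zeta> - S 0 \<zeta>) \<in> borel_measurable torus_measure"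
      using u_meas S_meas by (rule borel_measurable_diff)
    then have "(\<lambda>\<zeta>. (cmod (u \<zeta> - S 0 \<zeta>))\<^sup>2) \<in> borel_measurable torus_measure" by measurable
    moreover have "(\<integral>\<^sup>+\<zeta>. ennreal ((cmod (u \<zeta> - S 0 \<zeta>))\<^sup>2) \<partial>torus_measure) < \<infinity>"
      unfolding S_def infinity_ennreal_def
      by (rule le_less_trans[OF Fatou[OF G(1) order_refl G(2)] ennreal_less_top])
    ultimately show "integrable torus_measure (\<lambda>\<zeta>. (cmod (u \<zeta> - S 0 \<zeta>))\<^sup>2)"
      by (intro integrableI_nonneg AE_I2 zero_le_power2)
  qed
  from square_integrable_add[OF this square_integrable_char_sum[of a "G 0"]]
  have u_sq: "square_integrable u" by (simp add: S_def)
  have u_close: "L2_seminorm (\<lambda>\<zeta>. u \<zeta> - char_sum a H \<zeta>) \<le> (1 / 2) ^ k"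
    if H: "finite H" "G k \<subseteq> H" "H \<subseteq> hardy_index" for k H
  proof (rule power2_le_imp_le)
    have "ennreal ((L2_seminorm (\<lambda>\<zeta>. u \<zeta> - char_sum a H \<zeta>))\<^sup>2) \<le> ennreal ((1 / 4) ^ k)"
      using Fatou[OF H] nn_integral_L2_seminorm[OF square_integrable_diff[OF u_sq square_integrable_char_sum[of a H]]]
      by simp
    then have "(L2_seminorm (\<lambda>\<zeta>. u \<zeta> - char_sum a H \<zeta>))\<^sup>2 \<le> (1 / 4) ^ k" by simp
    also have "(1 / 4 :: real) ^ k = ((1 / 2) ^ k)\<^sup>2"
      by (simp add: power2_eq_square flip: power_mult_distrib)
    finally show "(L2_seminorm (\<lambda>\<zeta>. u \<zeta> - char_sum a H \<zeta>))\<^sup>2 \<le> ((1 / 2) ^ k)\<^sup>2" .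
  qed simp
  have "((\<lambda>F. L2_seminorm (\<lambda>\<zeta>. u \<zeta> - char_sum a F \<zeta>)) \<longlongrightarrow> 0) (finite_subsets_at_top hardy_index)"
  proof (rule tendstoI)
    fix e :: real assume "0 < e"
    then obtain k :: nat where "(1 / 2) ^ k < e"
      using real_arch_pow_inv[OF \<open>0 < e\<close>, of "1 / 2"] by force
    then have "dist (L2_seminorm (\<lambda>\<zeta>. u \<zeta> - char_sum a H \<zeta>)) 0 < e"
      if "finite H" "G k \<subseteq> H" "H \<subseteq> hardy_index" for H
      using u_close[OF that] L2_seminorm_nonneg[of "\<lambda>\<zeta>. u \<zeta> - char_sum a H \<zeta>"] by simp
    then show "\<forall>\<^sub>F F in finite_subsets_at_top hardy_index. dist (L2_seminorm (\<lambda>\<zeta>. u \<zeta> - char_sum a F \<zeta>)) 0 < e"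
      unfolding eventually_finite_subsets_at_top
      by (intro exI[of _ "G k"] conjI G allI impI) simp
  qed
  then have "boundary_series a u"
    using a u_sq by (simp add: boundary_series_iff)
  then show ?thesis by (rule that)
qed

section \<open>The boundary correspondence\<close>

lemma ae_class_self: "u \<in> borel_measurable torus_measure \<Longrightarrow> u \<in> ae_class u"
  by (simp add: ae_class_def)

lemma ae_class_nonempty: "u \<in> borel_measurable torus_measure \<Longrightarrow> ae_class u \<noteq> {}"
  using ae_class_self by blast

lemma ae_class_eqI:
  assumes "AE \<zeta> in torus_measure. u \<zeta> = v \<zeta>"
  shows "ae_class u = ae_class v"
proof -
  have "(AE \<zeta> in torus_measure. w \<zeta> = u \<zeta>) \<longleftrightarrow> (AE \<zeta> in torus_measure. w \<zeta> = v \<zeta>)" for w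
  proof
    assume "AE \<zeta> in torus_measure. w \<zeta> = u \<zeta>"
    with assms show "AE \<zeta> in torus_measure. w \<zeta> = v \<zeta>" by eventually_elim simp
  next
    assume "AE \<zeta> in torus_measure. w \<zeta> = v \<zeta>"
    with assms show "AE \<zeta> in torus_measure. w \<zeta> = u \<zeta>" by eventually_elim simp
  qed
  then show ?thesis by (simp add: ae_class_def)
qed

lemma ae_class_eqD:
  assumes "ae_class u = ae_class v" "u \<in> borel_measurable torus_measure"
  shows "AE \<zeta> in torus_measure. u \<zeta> = v \<zeta>"
  using ae_class_self[OF assms(2)] unfolding assms(1) by (simp add: ae_class_def)

text \<open>Addition of classes is defined as a union over representatives; all members of the union coincide.\<close>
lemma vadd_ae_class:
  assumes u: "u \<in> borel_measurable torus_measure" and v: "v \<in> borel_measurable torus_measure"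
  shows "vadd boundary_hardy_space (ae_class u) (ae_class v) = ae_class (\<lambda>\<zeta>. u \<zeta> + v \<zeta>)"
proof -
  have "ae_class (\<lambda>\<zeta>. u' \<zeta> + v' \<zeta>) = ae_class (\<lambda>\<zeta>. u \<zeta> + v \<zeta>)"
    if "u' \<in> ae_class u" "v' \<in> ae_class v" for u' v'
  proof (rule ae_class_eqI)
    have "AE \<zeta> in torus_measure. u' \<zeta> = u \<zeta>" "AE \<zeta> in torus_measure. v' \<zeta> = v \<zeta>"
      using that by (simp_all add: ae_class_def)
    then show "AE \<zeta> in torus_measure. u' \<zeta> + v' \<zeta> = u \<zeta> + v \<zeta>"
      by eventually_elim simp
  qed
  then have "(\<Union>u'\<in>ae_class u. \<Union>v'\<in>ae_class v. ae_class (\<lambda>\<zeta>. u' \<zeta> + v' \<zeta>)) =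
      (\<Union>u'\<in>ae_class u. \<Union>v'\<in>ae_class v. ae_class (\<lambda>\<zeta>. u \<zeta> + v \<zeta>))"
    by (intro SUP_cong refl)
  also have "\<dots> = ae_class (\<lambda>\<zeta>. u \<zeta> + v \<zeta>)"
    by (simp only: UN_constant ae_class_nonempty[OF u] ae_class_nonempty[OF v] if_False)
  finally show ?thesis
    by (simp add: boundary_hardy_space_def L2_torus_def)
qed

lemma vscale_ae_class:
  assumes u: "u \<in> borel_measurable torus_measure"
  shows "vscale boundary_hardy_space c (ae_class u) = ae_class (\<lambda>\<zeta>. c * u \<zeta>)"
proof -
  have "ae_class (\<lambda>\<zeta>. c * u' \<zeta>) = ae_class (\<lambda>\<zeta>. c * u \<zeta>)" if "u' \<in> ae_class u" for u'
  proof (rule ae_class_eqI)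
    have "AE \<zeta> in torus_measure. u' \<zeta> = u \<zeta>"
      using that by (simp add: ae_class_def)
    then show "AE \<zeta> in torus_measure. c * u' \<zeta> = c * u \<zeta>"
      by eventually_elim simp
  qed
  then have "(\<Union>u'\<in>ae_class u. ae_class (\<lambda>\<zeta>. c * u' \<zeta>)) = (\<Union>u'\<in>ae_class u. ae_class (\<lambda>\<zeta>. c * u \<zeta>))"
    by (intro SUP_cong refl)
  also have "\<dots> = ae_class (\<lambda>\<zeta>. c * u \<zeta>)"
    by (simp only: UN_constant ae_class_nonempty[OF u] if_False)
  finally show ?thesis
    by (simp add: boundary_hardy_space_def L2_torus_def)
qed

lemma vnorm_ae_class:
  assumes u: "u \<in> borel_measurable torus_measure"
  shows "vnorm boundary_hardy_space (ae_class u) = L2_seminorm u"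
proof -
  define v where "v = (SOME v. v \<in> ae_class u)"
  have "v \<in> ae_class u" unfolding v_def using ae_class_self[OF u] by (rule someI[where P = "\<lambda>v. v \<in> ae_class u"])
  then have v: "v \<in> borel_measurable torus_measure" "AE \<zeta> in torus_measure. v \<zeta> = u \<zeta>"
    by (simp_all add: ae_class_def)
  have "(LINT \<zeta>|torus_measure. (cmod (v \<zeta>))\<^sup>2) = (LINT \<zeta>|torus_measure. (cmod (u \<zeta>))\<^sup>2)"
  proof (rule integral_cong_AE)
    show "AE \<zeta> in torus_measure. (cmod (v \<zeta>))\<^sup>2 = (cmod (u \<zeta>))\<^sup>2"
      using v(2) by eventually_elim simp
  qed (use u v in simp_all)
  then show ?thesis
    by (simp add: boundary_hardy_space_def L2_torus_def L2_seminorm_def v_def)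
qed

lemma laurent_series_add:
  assumes "laurent_series a f" "laurent_series b g"
  shows "laurent_series (\<lambda>\<alpha>. a \<alpha> + b \<alpha>) (\<lambda>z. f z + g z)"
  using assms unfolding laurent_series_def ring_distribs by (intro ballI has_sum_add) simp_all

lemma laurent_series_scale:
  assumes "laurent_series a f"
  shows "laurent_series (\<lambda>\<alpha>. c * a \<alpha>) (\<lambda>z. c * f z)"
  using assms unfolding laurent_series_def mult.assoc by (intro ballI has_sum_cmult_right) simp

text \<open>The difference of the two families represents the zero function, whose norm is zero and is also the
square sum of the differences.\<close>
lemma laurent_coefficients_unique:
  fixes f :: "complex ^ 'n::{finite,linorder} \<Rightarrow> complex"
  assumes f: "laurent_series a f" "laurent_series b f"
    and d: "(\<lambda>\<alpha>. (cmod (a \<alpha> - b \<alpha>))\<^sup>2) summable_on hardy_index" and \<alpha>: "\<alpha> \<in> hardy_index"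
  shows "a \<alpha> = b \<alpha>"
proof -
  have "laurent_series (\<lambda>\<alpha>. a \<alpha> - b \<alpha>) (\<lambda>_. 0)"
    using laurent_series_add[OF f(1) laurent_series_scale[OF f(2), of "-1"]] by simp
  from hardy_norm_sq_laurent_series[OF this d]
  have "ennreal (\<Sum>\<^sub>\<infinity>\<alpha>\<in>hardy_index. (cmod (a \<alpha> - b \<alpha>))\<^sup>2) = hardy_norm_sq (\<lambda>_ :: complex ^ 'n::{finite,linorder}. 0)"
    by simp
  also have "\<dots> = 0"
    using hardy_norm_sq_laurent_series[of "\<lambda>_. 0" "\<lambda>_ :: complex ^ 'n::{finite,linorder}. 0"]
    by (simp add: laurent_series_def)
  finally have "(\<Sum>\<^sub>\<infinity>\<alpha>\<in>hardy_index. (cmod (a \<alpha> - b \<alpha>))\<^sup>2) = 0"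
    by (simp add: ennreal_eq_0_iff infsum_nonneg antisym)
  from infsum_cmod_sq_eq_0[OF d this \<alpha>] show ?thesis by simp
qed

lemma boundary_series_measurable: "boundary_series a u \<Longrightarrow> u \<in> borel_measurable torus_measure"
  by (simp add: boundary_series_def square_integrable_def)

text \<open>The Laurent coefficients of a function are unique, and they determine the boundary class.\<close>
lemma boundary_function_unique:
  assumes "boundary_function f X" "boundary_function f Y"
  shows "X = Y"
proof -
  obtain a u b v where X: "laurent_series a f" "boundary_series a u" "X = ae_class u"
    and Y: "laurent_series b f" "boundary_series b v" "Y = ae_class v"
    using assms unfolding boundary_function_def by metis
  have "a \<alpha> = b \<alpha>" if "\<alpha> \<in> hardy_index" for \<alpha>
    using laurent_coefficients_unique[OF X(1) Y(1) _ that] boundary_series_diff[OF X(2) Y(2)]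
    by (simp add: boundary_series_def)
  from boundary_series_determines_function[OF X(2) Y(2) this] show ?thesis
    unfolding X(3) Y(3) by (rule ae_class_eqI)
qed

lemma boundary_function_exists:
  assumes "f \<in> vecs hardy_space"
  shows "\<exists>X. boundary_function f X"
proof -
  obtain a where a: "(\<lambda>\<alpha>. (cmod (a \<alpha>))\<^sup>2) summable_on hardy_index" "laurent_series a f"
    using assms by (auto simp: hardy_space_def intro: laurent_expansion)
  obtain u where "boundary_series a u" using exists_boundary_series[OF a(1)] .
  with a(2) show ?thesis by (auto simp: boundary_function_def)
qed

theorem proposition2p4:
  assumes "CARD('n::{finite,linorder}) \<ge> 2"
  shows "\<exists>T :: (complex ^ 'n::{finite,linorder} \<Rightarrow> complex) \<Rightarrow> (complex ^ 'n::{finite,linorder} \<Rightarrow> complex) set.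
           isometric_isomorphism hardy_space boundary_hardy_space T \<and>
           (\<forall>f\<in>vecs hardy_space. boundary_function f (T f))"
proof (intro exI conjI ballI)
  define T :: "(complex ^ 'n::{finite,linorder} \<Rightarrow> complex) \<Rightarrow> (complex ^ 'n::{finite,linorder} \<Rightarrow> complex) set"
    where "T f = (SOME X. boundary_function f X)" for f
  show T: "boundary_function f (T f)" if "f \<in> vecs hardy_space" for f
    unfolding T_def using boundary_function_exists[OF that] by (rule someI_ex)
  have T_eq: "T f = X" if "boundary_function f X" for f X
    unfolding T_def using boundary_function_unique that by (metis someI)
  show "isometric_isomorphism hardy_space boundary_hardy_space T"
    unfolding isometric_isomorphism_def
  proof (intro conjI ballI allI)
    show "bij_betw T (vecs hardy_space) (vecs boundary_hardy_space)"
      unfolding bij_betw_def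
    proof
      show "inj_on T (vecs hardy_space)"
      proof (rule inj_onI)
        fix f g :: "complex ^ 'n::{finite,linorder} \<Rightarrow> complex"
        assume f: "f \<in> vecs hardy_space" and g: "g \<in> vecs hardy_space" and "T f = T g"
        then obtain a u b v where a: "laurent_series a f" "boundary_series a u"
          and b: "laurent_series b g" "boundary_series b v" and "ae_class u = ae_class v"
          using T[OF f] T[OF g] unfolding boundary_function_def by metis
        then have ab: "a \<alpha> = b \<alpha>" if "\<alpha> \<in> hardy_index" for \<alpha>
          using boundary_series_determines_coefficients[OF a(2) b(2) _ that]
            ae_class_eqD boundary_series_measurable by metis
        have "f z = g z" for z
        proof (cases "z \<in> hartogs_triangle")
          case True
          have "hardy_series a z = hardy_series b z"
            unfolding hardy_series_def using ab by (simp cong: infsum_cong)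
          then show ?thesis
            using laurent_series_eq[OF a(1) True] laurent_series_eq[OF b(1) True] by simp
        next
          case False
          then show ?thesis using f g by (simp add: hardy_space_def)
        qed
        then show "f = g" by (rule ext)
      qed
      show "T ` vecs hardy_space = vecs boundary_hardy_space"
      proof
        show "T ` vecs hardy_space \<subseteq> vecs boundary_hardy_space"
          using T by (fastforce simp: boundary_hardy_space_def boundary_function_def)
        show "vecs boundary_hardy_space \<subseteq> T ` vecs hardy_space"
        proof
          fix X :: "(complex ^ 'n::{finite,linorder} \<Rightarrow> complex) set"
          assume "X \<in> vecs boundary_hardy_space"
          then obtain a u where u: "X = ae_class u" "boundary_series a u"
            by (auto simp: boundary_hardy_space_def)
          then have a: "(\<lambda>\<alpha>. (cmod (a \<alpha>))\<^sup>2) summable_on hardy_index" by (simp add: boundary_series_def)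
          have L: "laurent_series a (hardy_series a)"
            by (rule laurent_series_hardy_series) (rule square_summable_bounded[OF a])
          have "holomorphic_multi (hardy_series a) hartogs_triangle"
            by (rule holomorphic_multi_hardy_series) (rule square_summable_bounded[OF a])
          moreover have "hardy_norm_sq (hardy_series a) < \<infinity>"
            unfolding hardy_norm_sq_laurent_series[OF L a] by simp
          ultimately have "hardy_series a \<in> vecs hardy_space"
            by (simp add: hardy_space_def) (simp add: hardy_series_def)
          moreover have "boundary_function (hardy_series a) X"
            using u L unfolding boundary_function_def by blast
          ultimately show "X \<in> T ` vecs hardy_space" using T_eq by blast
        qed
      qed
    qed
  next
    fix f g :: "complex ^ 'n::{finite,linorder} \<Rightarrow> complex"
    assume f: "f \<in> vecs hardy_space" and g: "g \<in> vecs hardy_space"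
    obtain a u b v where a: "laurent_series a f" "boundary_series a u" "T f = ae_class u"
      and b: "laurent_series b g" "boundary_series b v" "T g = ae_class v"
      using T[OF f] T[OF g] unfolding boundary_function_def by metis
    have "boundary_function (\<lambda>z. f z + g z) (ae_class (\<lambda>\<zeta>. u \<zeta> + v \<zeta>))"
      using laurent_series_add[OF a(1) b(1)] boundary_series_add[OF a(2) b(2)]
      unfolding boundary_function_def by blast
    then show "T (vadd hardy_space f g) = vadd boundary_hardy_space (T f) (T g)"
      unfolding a(3) b(3) vadd_ae_class[OF boundary_series_measurable[OF a(2)] boundary_series_measurable[OF b(2)]]
      by (simp add: hardy_space_def T_eq)
  next
    fix c and f :: "complex ^ 'n::{finite,linorder} \<Rightarrow> complex"
    assume f: "f \<in> vecs hardy_space"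
    obtain a u where a: "laurent_series a f" "boundary_series a u" "T f = ae_class u"
      using T[OF f] unfolding boundary_function_def by metis
    have "boundary_function (\<lambda>z. c * f z) (ae_class (\<lambda>\<zeta>. c * u \<zeta>))"
      using laurent_series_scale[OF a(1)] boundary_series_scale[OF a(2)]
      unfolding boundary_function_def by blast
    then show "T (vscale hardy_space c f) = vscale boundary_hardy_space c (T f)"
      unfolding a(3) vscale_ae_class[OF boundary_series_measurable[OF a(2)]]
      by (simp add: hardy_space_def T_eq)
  next
    fix f :: "complex ^ 'n::{finite,linorder} \<Rightarrow> complex"
    assume f: "f \<in> vecs hardy_space"
    obtain a u where a: "laurent_series a f" "boundary_series a u" "T f = ae_class u"
      using T[OF f] unfolding boundary_function_def by metis
    then have "(\<lambda>\<alpha>. (cmod (a \<alpha>))\<^sup>2) summable_on hardy_index" by (simp add: boundary_series_def)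
    from hardy_norm_sq_laurent_series[OF a(1) this]
    show "vnorm boundary_hardy_space (T f) = vnorm hardy_space f"
      unfolding a(3) vnorm_ae_class[OF boundary_series_measurable[OF a(2)]] L2_seminorm_boundary_series[OF a(2)]
      by (simp add: hardy_space_def infsum_nonneg)
  qed
qed

end
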